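(* Let $\Sigma$ be a non-empty finite subset of $\mathcal{G}=\mathbb{C}\times\mathbb{C}^*$ and let $T$ be a positive integer. Denote by $I$ the ideal of $\mathbb{C}[X_0,X_1,X_2]$ generated by the homogeneous polynomials $P$ satisfying $(\mathcal{D}^iP)(1,\gamma)=0$ for each $\gamma\in\Sigma$ and each $i=0,\dots,T-1$. Let $D$ be a positive integer and suppose that there exist a finite subset $\Sigma_1$ of $\mathcal{G}$ and an integer $T_1\ge 0$ such that \[ D<(T_1+1)\min\{|\pi_1(\Sigma_1)|,|\pi_2(\Sigma_1)|\}\quad\text{and}\quad (T+T_1)\,|\Sigma+\Sigma_1|<\binom{D+2}{2}. \] Then the resultant $\mathrm{Res}_D$ in degree $D$ vanishes to order at least $T|\Sigma|$ at each point of $(I_D)^3$.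
   Context: $\mathcal{G}=\mathbb{C}\times\mathbb{C}^*$ is a commutative group written additively: $(\xi,\eta)+(\xi',\eta')=(\xi+\xi',\eta\eta')$. $\pi_1:\mathcal{G}\to\mathbb{C}$ and $\pi_2:\mathcal{G}\to\mathbb{C}^*$ are the two projections, and $\Sigma+\Sigma_1=\{\gamma+\gamma_1:\gamma\in\Sigma,\gamma_1\in\Sigma_1\}$. $\mathcal{D}=X_0\frac{\partial}{\partial X_1}+X_2\frac{\partial}{\partial X_2}$ is a derivation of $\mathbb{C}[X_0,X_1,X_2]$, and for $\gamma=(\xi,\eta)$, $P(1,\gamma)=P(1,\xi,\eta)$. $I_D$ is the homogeneous part of degree $D$ of $I$. $\mathrm{Res}_D:\mathbb{C}[X_0,X_1,X_2]_D^3\to\mathbb{C}$ is the generic resultant: the polynomial map vanishing exactly on triples of degree-$D$ forms with a common zero in $\mathbb{P}^2(\mathbb{C})$, whose underlying polynomial in the coefficients has integer coefficients and is irreducible over $\mathbb{Z}$. Vanishing to order at least $k$ means all partial derivatives of order $<k$ vanish. *)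

theory Defs
  imports
    Complex_Main
    "HOL-Library.Poly_Mapping"
    "HOL-Library.Numeral_Type"
    "HOL-Computational_Algebra.Factorial_Ring"
begin

text \<open>
  Polynomials in indeterminates indexed by a type are finitely supported maps from monomials
  (exponent vectors) to coefficients; \<open>HOL-Library.Poly_Mapping\<close> provides their ring structure.
\<close>

type_synonym ('v, 'a) mpoly = "('v \<Rightarrow>\<^sub>0 nat) \<Rightarrow>\<^sub>0 'a"

definition indet :: "'v \<Rightarrow> ('v, 'a::comm_semiring_1) mpoly" where
  "indet x = Poly_Mapping.single (Poly_Mapping.single x 1) 1"

definition mpoly_eval :: "('v \<Rightarrow> 'a::comm_semiring_1) \<Rightarrow> ('v, 'a) mpoly \<Rightarrow> 'a" where
  "mpoly_eval u p = (\<Sum>m\<in>Poly_Mapping.keys p.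
     Poly_Mapping.lookup p m * (\<Prod>x\<in>Poly_Mapping.keys m. u x ^ Poly_Mapping.lookup m x))"

text \<open>
  Formal partial derivative.  If \<open>x\<close> does not occur in \<open>m\<close>, the subtraction of exponents is
  truncated, but the coefficient of that summand is zero.
\<close>

definition pdiff :: "'v \<Rightarrow> ('v, 'a::comm_semiring_1) mpoly \<Rightarrow> ('v, 'a) mpoly" where
  "pdiff x p = (\<Sum>m\<in>Poly_Mapping.keys p.
     Poly_Mapping.single (m - Poly_Mapping.single x 1)
       (of_nat (Poly_Mapping.lookup m x) * Poly_Mapping.lookup p m))"

lemma lookup_pdiff:
  fixes x :: 'v and p :: "('v, 'a::comm_semiring_1) mpoly"
  shows "Poly_Mapping.lookup (pdiff x p) m =
     of_nat (Suc (Poly_Mapping.lookup m x)) *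
     Poly_Mapping.lookup p (m + Poly_Mapping.single x 1)"
proof -
  let ?n = "m + Poly_Mapping.single x 1"
  have *: "(k - Poly_Mapping.single x 1 = m \<and> Poly_Mapping.lookup k x \<noteq> 0) \<longleftrightarrow> k = ?n"
    for k :: "'v \<Rightarrow>\<^sub>0 nat"
  proof
    assume k: "k - Poly_Mapping.single x 1 = m \<and> Poly_Mapping.lookup k x \<noteq> 0"
    then have m: "m = k - Poly_Mapping.single x 1" by simp
    show "k = ?n"
      using k by (intro poly_mapping_eqI)
        (auto simp: m lookup_add lookup_minus lookup_single when_def)
  next
    assume "k = ?n"
    then show "k - Poly_Mapping.single x 1 = m \<and> Poly_Mapping.lookup k x \<noteq> 0"
      by (simp add: lookup_add)
  qed
  have "Poly_Mapping.lookup (pdiff x p) m = (\<Sum>k\<in>Poly_Mapping.keys p.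
      (of_nat (Poly_Mapping.lookup k x) * Poly_Mapping.lookup p k
         when k - Poly_Mapping.single x 1 = m))"
    by (simp add: pdiff_def lookup_sum lookup_single)
  also have "\<dots> = (\<Sum>k\<in>Poly_Mapping.keys p. if ?n = k
      then of_nat (Poly_Mapping.lookup k x) * Poly_Mapping.lookup p k else 0)"
  proof (rule sum.cong)
    fix k
    show "(of_nat (Poly_Mapping.lookup k x) * Poly_Mapping.lookup p k
         when k - Poly_Mapping.single x 1 = m) = (if ?n = k
      then of_nat (Poly_Mapping.lookup k x) * Poly_Mapping.lookup p k else 0)"
      using *[of k] by (cases "Poly_Mapping.lookup k x = 0") (auto simp: when_def)
  qed simp
  also have "\<dots> = of_nat (Poly_Mapping.lookup ?n x) * Poly_Mapping.lookup p ?n"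
    by (auto simp: in_keys_iff)
  finally show ?thesis by (simp add: lookup_add)
qed

definition vanishes_to_order ::
    "nat \<Rightarrow> ('v, 'a::comm_semiring_1) mpoly \<Rightarrow> ('v \<Rightarrow> 'a) \<Rightarrow> bool" where
  "vanishes_to_order k F u \<longleftrightarrow>
     (\<forall>xs. length xs < k \<longrightarrow> mpoly_eval u (foldr pdiff xs F) = 0)"

lemma module_mult: "module ((*) :: 'a::comm_ring_1 \<Rightarrow> 'a \<Rightarrow> 'a)"
  by standard (simp_all add: algebra_simps)

text \<open>The ideal generated by \<open>B\<close> is the span of \<open>B\<close> in the ring viewed as a module over itself.\<close>

definition ideal_generated :: "'a::comm_ring_1 set \<Rightarrow> 'a set" where
  "ideal_generated B = module.span (*) B"

text \<open>
  The three indeterminates $X_0, X_1, X_2$ are indexed by the elements \<open>0\<close>, \<open>1\<close>, \<open>2\<close>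
  of the three-element type \<open>3\<close>.
\<close>

type_synonym cpoly3 = "(3, complex) mpoly"

definition monomials_of_degree :: "nat \<Rightarrow> (3 \<Rightarrow>\<^sub>0 nat) set" where
  "monomials_of_degree D = {m. (\<Sum>i\<in>UNIV. Poly_Mapping.lookup m i) = D}"

definition forms :: "nat \<Rightarrow> cpoly3 set" where
  "forms D = {P. Poly_Mapping.keys P \<subseteq> monomials_of_degree D}"

definition homogeneous :: "cpoly3 \<Rightarrow> bool" where
  "homogeneous P \<longleftrightarrow> (\<exists>D. P \<in> forms D)"

definition deriv_D :: "cpoly3 \<Rightarrow> cpoly3" where
  "deriv_D P = indet 0 * pdiff 1 P + indet 2 * pdiff 2 P"

definition group_G :: "(complex \<times> complex) set" where
  "group_G = UNIV \<times> (UNIV - {0})"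

fun G_add :: "complex \<times> complex \<Rightarrow> complex \<times> complex \<Rightarrow> complex \<times> complex" where
  "G_add (\<xi>, \<eta>) (\<xi>', \<eta>') = (\<xi> + \<xi>', \<eta> * \<eta>')"

definition G_sumset ::
    "(complex \<times> complex) set \<Rightarrow> (complex \<times> complex) set \<Rightarrow> (complex \<times> complex) set" where
  "G_sumset A B = {G_add \<gamma> \<gamma>' | \<gamma> \<gamma>'. \<gamma> \<in> A \<and> \<gamma>' \<in> B}"

definition affine_point :: "complex \<times> complex \<Rightarrow> 3 \<Rightarrow> complex" where
  "affine_point \<gamma> = (\<lambda>i. if i = 0 then 1 else if i = 1 then fst \<gamma> else snd \<gamma>)"

definition ideal_I :: "(complex \<times> complex) set \<Rightarrow> nat \<Rightarrow> cpoly3 set" where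
  "ideal_I \<Sigma> T = ideal_generated
     {P. homogeneous P \<and>
         (\<forall>\<gamma>\<in>\<Sigma>. \<forall>i<T. mpoly_eval (affine_point \<gamma>) ((deriv_D ^^ i) P) = 0)}"

text \<open>
  \<open>Coeff j m\<close> is the indeterminate standing for the coefficient of the monomial \<open>m\<close> in the
  \<open>j\<close>-th form of a triple; \<open>coeffs_of f\<close> assigns to it its value at the triple \<open>f\<close>.
\<close>

datatype coeff_var = Coeff 3 "3 \<Rightarrow>\<^sub>0 nat"

fun coeffs_of :: "(3 \<Rightarrow> cpoly3) \<Rightarrow> coeff_var \<Rightarrow> complex" where
  "coeffs_of f (Coeff j m) = Poly_Mapping.lookup (f j) m"

definition common_projective_zero :: "(3 \<Rightarrow> cpoly3) \<Rightarrow> bool" where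
  "common_projective_zero f \<longleftrightarrow>
     (\<exists>z. (\<exists>i. z i \<noteq> 0) \<and> (\<forall>j. mpoly_eval z (f j) = 0))"

abbreviation complexify :: "('v, int) mpoly \<Rightarrow> ('v, complex) mpoly" where
  "complexify R \<equiv> Poly_Mapping.map of_int R"

text \<open>
  These properties determine the generic resultant up to sign.  \<open>R\<close> lives in a ring that has the
  coefficients of forms of all degrees as indeterminates; the first condition confines it to those
  of degree \<open>D\<close>.  Irreducibility in the larger ring is the same as in the subring, since
  factors of a nonzero polynomial over the integers only involve indeterminates of that polynomial.
\<close>

definition generic_resultant :: "nat \<Rightarrow> (coeff_var, int) mpoly \<Rightarrow> bool" where
  "generic_resultant D R \<longleftrightarrow>
     (\<forall>M\<in>Poly_Mapping.keys R.
        Poly_Mapping.keys M \<subseteq> {Coeff j m | j m. m \<in> monomials_of_degree D}) \<and>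
     irreducible R \<and>
     (\<forall>f. (\<forall>j. f j \<in> forms D) \<longrightarrow>
        (mpoly_eval (coeffs_of f) (complexify R) = 0 \<longleftrightarrow> common_projective_zero f))"

end

theory Submission
  imports Defs
    "HOL-Computational_Algebra.Computational_Algebra"
    "HOL-Computational_Algebra.Field_as_Ring"
    "Jordan_Normal_Form.Char_Poly"
begin

text \<open>
  For large \<open>\<nu>\<close> consider the square matrices whose columns are the coefficients of multiples, of
  degree \<open>\<nu>\<close>, of the members of a triple of forms of degree \<open>D\<close>.  Their determinants vanish
  whenever the triple has a common zero.  All multiples of forms in \<open>I\<close> lie in a subspace of
  codimension at least \<open>T |\<Sigma>|\<close>, so such a determinant vanishes to order \<open>T |\<Sigma>|\<close> at each point of
  \<open>(I\<^sub>D)\<^sup>3\<close>.  It remains to divide out the extraneous factor.  The zero estimate provides two coprime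
  forms in \<open>I\<^sub>D\<close>: take a nonzero form of degree at most \<open>D\<close> vanishing to order \<open>T + T\<^sub>1\<close> on
  \<open>\<Sigma> + \<Sigma>\<^sub>1\<close>; a common prime factor of the translates by \<open>\<Sigma>\<^sub>1\<close> of its derivatives of order up to \<open>T\<^sub>1\<close>
  would have too many translates dividing it with multiplicity \<open>T\<^sub>1 + 1\<close>.  At triples whose first two
  members are coprime, the columns can be chosen with at most \<open>D\<^sup>2\<close> multiples of the third form and
  such that the determinant is not identically zero as a function of the third form.  Along the
  pencil of a generic third form the resultant has \<open>D\<^sup>2\<close> distinct roots, so there the determinant
  divides the resultant up to a factor that does not vanish at the given triple.
\<close>

section \<open>Divisibility of bivariate polynomials\<close>

text \<open>The two occurrences of D^2 have to match: Bezout's number is both the number of columns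
  that the multiples of two coprime forms leave to the third form and the number of points of the
  grid. A surplus column would leave room for an extraneous factor that depends on the parameter of
  the pencil.

  The triple at which the order is measured and the triple whose intersections are known explicitly
  are different, so they are joined by a surface with parameters s and t: s leads from the first
  triple at 0 to the grid at 1, and t moves the third form. The direction of the pencil changes with
  s as well, since at s = 0 it has to make the determinant nonzero and at s = 1 it has to separate
  the grid points.

  A triple of forms in the ideal need not have coprime members. It is joined by a line to a triple
  that begins with the two coprime forms; all but finitely many points of this line are good, and
  the order of vanishing can only rise in the limit.\<close>

hide_const (open) Module.smult

lemma pos_degree_prime_factor:
  fixes m :: "complex poly poly"
  assumes "degree m > 0"
  obtains p where "prime p" "p dvd m" "degree p > 0"
proof -
  have m0: "m \<noteq> 0" using assms by auto
  have deg0: "degree (prod_mset M) = 0" if "\<forall>p\<in>#M. degree p = 0" for M :: "complex poly poly multiset"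
    using that
  proof (induction M)
    case (add x M)
    then have "degree (x * prod_mset M) \<le> 0"
      using degree_mult_le[of x "prod_mset M"] by auto
    then show ?case by simp
  qed auto
  have "\<exists>p\<in>#prime_factorization m. degree p > 0"
  proof (rule ccontr)
    assume "\<not> ?thesis"
    then have "degree (prod_mset (prime_factorization m)) = 0"
      by (intro deg0) auto
    moreover have "m dvd prod_mset (prime_factorization m)"
      using prod_mset_prime_factorization_weak[OF m0] by (metis associated_iff_dvd)
    ultimately show False
      using assms dvd_imp_degree_le[of m "prod_mset (prime_factorization m)"] by auto
  qed
  then show ?thesis using that
    by (auto simp: in_prime_factors_iff)
qed

text \<open>Euclid's algorithm over the rational functions in the inner variable, with denominators
  cleared. A nonzero element \<open>m\<close> of least degree in the ideal of \<open>p\<close> and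
  \<open>q\<close> divides every element of that ideal up to a nonzero factor in the inner variable;
  a prime factor of \<open>m\<close> of positive degree would then divide both \<open>p\<close> and
  \<open>q\<close>.\<close>

lemma bezout_up_to_constant:
  fixes p q :: "complex poly poly"
  assumes p0: "p \<noteq> 0"
    and cop: "\<And>\<pi>. prime \<pi> \<Longrightarrow> \<pi> dvd p \<Longrightarrow> \<pi> dvd q \<Longrightarrow> degree \<pi> = 0"
  obtains A B c where "c \<noteq> 0" "A * p + B * q = [:c:]"
proof -
  define J where "J = {m. m \<noteq> 0 \<and> (\<exists>A B. m = A * p + B * q)}"
  have "p = 1 * p + 0 * q" by simp
  then have "p \<in> J" unfolding J_def using p0 by blast
  then obtain m where m: "m \<in> J" and min: "\<And>m'. m' \<in> J \<Longrightarrow> degree m \<le> degree m'"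
    using arg_min_natI[of "\<lambda>m. m \<in> J" p degree] arg_min_nat_le[of "\<lambda>m. m \<in> J" _ degree]
    by (metis (no_types, lifting))
  from m obtain A B where m0: "m \<noteq> 0" and mAB: "m = A * p + B * q" unfolding J_def by auto
  have red: "\<exists>a. a \<noteq> 0 \<and> m dvd smult a f" if "\<exists>A B. f = A * p + B * q" for f
  proof -
    from that obtain A' B' where f: "f = A' * p + B' * q" by auto
    obtain h r where qr: "pseudo_divmod f m = (h, r)" by force
    define a where "a = coeff m (degree m) ^ (Suc (degree f) - degree m)"
    from pseudo_divmod[OF m0 qr] have eq: "smult a f = m * h + r" and
      r: "r = 0 \<or> degree r < degree m" unfolding a_def by auto
    have "r = smult a f - m * h" using eq by simp
    also have "\<dots> = (smult a A' - h * A) * p + (smult a B' - h * B) * q"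
      by (simp add: f mAB algebra_simps smult_add_right)
    finally have "r = 0 \<or> r \<in> J" unfolding J_def by blast
    then have "r = 0" using r min[of r] by auto
    then show ?thesis using eq m0 by (intro exI[of _ a]) (auto simp: a_def)
  qed
  have "degree m = 0"
  proof (rule ccontr)
    assume "degree m \<noteq> 0"
    then obtain \<pi> where \<pi>: "prime \<pi>" "\<pi> dvd m" "degree \<pi> > 0"
      using pos_degree_prime_factor[of m] by auto
    have dv: "\<pi> dvd f" if "\<exists>A B. f = A * p + B * q" for f
    proof -
      from red[OF that] obtain a where a: "a \<noteq> 0" "m dvd smult a f" by auto
      then have "\<pi> dvd [:a:] * f" using \<pi>(2) dvd_trans by fastforce
      then have "\<pi> dvd [:a:] \<or> \<pi> dvd f" using \<pi>(1) prime_dvd_mult_iff by blast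
      moreover have "\<not> \<pi> dvd [:a:]"
        using \<pi>(3) a(1) dvd_imp_degree_le[of \<pi> "[:a:]"] by auto
      ultimately show ?thesis by simp
    qed
    have "\<pi> dvd p" by (rule dv) (rule exI[of _ 1], rule exI[of _ 0], simp)
    moreover have "\<pi> dvd q" by (rule dv) (rule exI[of _ 0], rule exI[of _ 1], simp)
    ultimately show False using cop \<pi> by auto
  qed
  then obtain c where "m = [:c:]" by (metis degree_0_id)
  then show ?thesis using that[of c A B] m0 mAB by auto
qed

section \<open>Specialising the inner variable\<close>

lemma comm_ring_hom_poly_at: "comm_ring_hom (\<lambda>p. poly p (a :: 'a :: comm_ring_1))"
  by unfold_locales auto

lemma comm_ring_hom_map_poly:
  assumes "comm_ring_hom h"
  shows "comm_ring_hom (map_poly h)"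
proof -
  interpret h: comm_ring_hom h by fact
  interpret m: map_poly_comm_ring_hom h ..
  show ?thesis by unfold_locales
qed

abbreviation ev_in :: "complex \<Rightarrow> complex poly poly \<Rightarrow> complex poly" where
  "ev_in s \<equiv> map_poly (\<lambda>c. poly c s)"

lemma comm_ring_hom_ev_in: "comm_ring_hom (ev_in s)"
  by (intro comm_ring_hom_map_poly comm_ring_hom_poly_at)

lemma poly_ev_in: "poly (ev_in s p) t = poly (poly p [:t:]) s"
  by (induction p) (auto simp: map_poly_pCons)

lemma coeff_ev_in: "coeff (ev_in s p) k = poly (coeff p k) s"
  by (simp add: coeff_map_poly)

lemma ev_in_mult: "ev_in s (p * q) = ev_in s p * ev_in s q"
  and ev_in_add: "ev_in s (p + q) = ev_in s p + ev_in s q"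
  and ev_in_smult: "ev_in s (smult c p) = smult (poly c s) (ev_in s p)"
proof -
  interpret comm_ring_hom "ev_in s" by (rule comm_ring_hom_ev_in)
  show "ev_in s (p * q) = ev_in s p * ev_in s q" "ev_in s (p + q) = ev_in s p + ev_in s q"
    by (rule hom_mult hom_add)+
  show "ev_in s (smult c p) = smult (poly c s) (ev_in s p)"
    by (rule poly_eqI) (simp add: coeff_map_poly)
qed

lemma ev_in_dvd: "p dvd q \<Longrightarrow> ev_in s p dvd ev_in s q"
  by (auto simp: dvd_def ev_in_mult)

lemma exists_nonroot: "(p :: complex poly) \<noteq> 0 \<Longrightarrow> \<exists>s. poly p s \<noteq> 0"
  using poly_all_0_iff_0 by blast

lemma prod_pairwise_coprime_dvd:
  fixes f :: "'i \<Rightarrow> 'a::semiring_gcd"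
  assumes "finite S" "\<And>p. p \<in> S \<Longrightarrow> f p dvd d"
    "\<And>p q. p \<in> S \<Longrightarrow> q \<in> S \<Longrightarrow> p \<noteq> q \<Longrightarrow> coprime (f p) (f q)"
  shows "(\<Prod>p\<in>S. f p) dvd d"
  using assms
proof (induction S)
  case (insert p S)
  have "coprime (f p) (\<Prod>p\<in>S. f p)"
    using insert by (intro prod_coprime_right) auto
  then show ?case using insert by (simp add: divides_mult)
qed auto

lemma prod_distinct_primes_dvd:
  fixes d :: "complex poly poly"
  assumes "finite S" "\<And>p. p \<in> S \<Longrightarrow> prime p" "\<And>p. p \<in> S \<Longrightarrow> p dvd d"
  shows "\<Prod>S dvd d"
  using prod_pairwise_coprime_dvd[of S "\<lambda>p. p" d] assms primes_coprime by blast

text \<open>Nullstellensatz for an irreducible plane curve. If \<open>p\<close> did not divide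
  \<open>d\<close>, some combination of the two would be a nonzero polynomial in \<open>s\<close>
  alone. At a value of \<open>s\<close> where neither it nor the leading coefficient of
  \<open>p\<close> vanishes, \<open>p\<close> still has a root in \<open>t\<close>, which would be a
  common zero.\<close>

lemma prime_root_transfer:
  fixes d p :: "complex poly poly"
  assumes p: "prime p" "degree p > 0"
    and imp: "\<And>s t. poly (poly p [:t:]) s = 0 \<Longrightarrow> poly (poly d [:t:]) s = 0"
  shows "p dvd d"
proof (rule ccontr)
  assume nd: "\<not> p dvd d"
  have p0: "p \<noteq> 0" using p by auto
  have cop: "degree \<pi> = 0" if "prime \<pi>" "\<pi> dvd p" "\<pi> dvd d" for \<pi>
    using that p nd primes_dvd_imp_eq by blast
  obtain A B c where c: "c \<noteq> 0" "A * p + B * d = [:c:]"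
    using bezout_up_to_constant[OF p0 cop] by blast
  obtain s where s: "poly (c * lead_coeff p) s \<noteq> 0"
    using exists_nonroot[of "c * lead_coeff p"] c p0 by auto
  have "degree (ev_in s p) \<ge> degree p"
    using s by (intro le_degree) (auto simp: coeff_ev_in)
  then have "\<not> constant (poly (ev_in s p))"
    using p(2) constant_degree by force
  then obtain t where "poly (ev_in s p) t = 0"
    using fundamental_theorem_of_algebra by blast
  then have t: "poly (poly p [:t:]) s = 0" by (simp add: poly_ev_in)
  have "poly (poly (A * p + B * d) [:t:]) s = 0" using t imp[OF t] by simp
  then show False using c s by simp
qed

text \<open>
  The polynomials \<open>d\<close> and \<open>r\<close> in \<open>s, t\<close> are written with outer variable \<open>t\<close>.  The radical of \<open>r\<close>
  divides \<open>d\<close> up to a factor in \<open>s\<close> alone, and since \<open>r(1, t)\<close> has \<open>n\<close> distinct roots while \<open>d\<close> has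
  degree at most \<open>n\<close> in \<open>t\<close>, it agrees with \<open>d\<close> up to such factors.
\<close>

lemma bivariate_order_transfer:
  fixes d r :: "complex poly poly"
  assumes d0: "ev_in 0 d \<noteq> 0"
    and deg: "degree d \<le> n"
    and imp: "\<And>s t. poly (poly r [:t:]) s = 0 \<Longrightarrow> poly (poly d [:t:]) s = 0"
    and Z: "finite Z" "card Z \<ge> n" "\<And>t. t \<in> Z \<Longrightarrow> poly (poly r [:t:]) 1 = 0"
    and nz: "poly (poly r [:t0:]) 1 \<noteq> 0"
    and dv: "[:0, 1:] ^ M dvd poly d 0"
  shows "[:0, 1:] ^ M dvd poly r 0"
proof -
  have r0: "r \<noteq> 0" using nz by auto
  have dn0: "d \<noteq> 0" using d0 by auto
  define S where "S = prime_factors r"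
  define S1 where "S1 = {p\<in>S. degree p > 0}"
  \<comment> \<open>\<open>C\<close> collects the primes in \<open>s\<close> alone. They need not
    divide \<open>d\<close>, which is why \<open>d\<close> and the radical of \<open>r\<close> are
    compared only up to factors in \<open>s\<close>.\<close>
  define C where "C = \<Prod>(S - S1)"
  have fin: "finite S" "S1 \<subseteq> S" by (auto simp: S_def S1_def)
  have pr: "prime p" "p dvd r" "p \<noteq> 0" if "p \<in> S" for p
    using that by (auto simp: S_def in_prime_factors_iff)
  have S1d: "\<Prod>S1 dvd d"
  proof (rule prod_distinct_primes_dvd)
    fix p assume p: "p \<in> S1"
    show "p dvd d"
    proof (rule prime_root_transfer)
      fix s t assume "poly (poly p [:t:]) s = 0"
      moreover have "p dvd r" using p pr S1_def by auto
      ultimately have "poly (poly r [:t:]) s = 0" by (auto elim!: dvdE)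
      then show "poly (poly d [:t:]) s = 0" by (rule imp)
    qed (use p pr S1_def in auto)
  qed (use fin pr in \<open>auto intro: finite_subset\<close>)
  have C0: "C \<noteq> 0" using fin pr by (auto simp: C_def)
  have "degree (\<Prod>X) = 0" if "X \<subseteq> S - S1" "finite X" for X
    using that(2,1)
  proof (induction X)
    case (insert x X)
    then have "x \<noteq> 0" "\<Prod>X \<noteq> 0" "degree x = 0" using pr by (auto simp: S1_def)
    then show ?case using insert by (simp add: degree_mult_eq)
  qed auto
  then have degC: "degree C = 0" using fin by (auto simp: C_def)
  have split: "\<Prod>S = \<Prod>S1 * C"
    unfolding C_def using fin by (metis mult.commute prod.subset_diff)
  then have "\<Prod>S dvd d * C" using S1d by (simp add: mult_dvd_mono)
  then obtain e where e: "d * C = \<Prod>S * e" by auto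
  have Sr: "\<Prod>S dvd r"
    by (rule prod_distinct_primes_dvd) (use fin pr in auto)
  \<comment> \<open>At \<open>s = 1\<close> every element of \<open>Z\<close> is a root of the
    radical, so its degree in \<open>t\<close> is at least \<open>n\<close>.\<close>
  have degS: "n \<le> degree (\<Prod>S)"
  proof -
    have "ev_in 1 r \<noteq> 0" using nz by (metis poly_0 poly_ev_in)
    then have ne: "ev_in 1 (\<Prod>S) \<noteq> 0" using ev_in_dvd[OF Sr, of 1] by auto
    have rt: "poly (ev_in 1 (\<Prod>S)) t = 0" if t: "t \<in> Z" for t
    proof -
      have "r dvd prod_mset (prime_factorization r)"
        using prod_mset_prime_factorization_weak[OF r0] by (metis associated_iff_dvd)
      then have "poly (poly (prod_mset (prime_factorization r)) [:t:]) 1 = 0"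
        using Z(3)[OF t] by (auto elim!: dvdE)
      moreover have "\<exists>p\<in>#N. poly (poly p [:t:]) 1 = 0"
        if "poly (poly (prod_mset N) [:t:]) 1 = 0" for N :: "complex poly poly multiset"
        using that by (induction N) auto
      ultimately obtain p where p: "p \<in> S" "poly (poly p [:t:]) 1 = 0"
        unfolding S_def by blast
      then have "p dvd \<Prod>S" using fin by (metis dvd_prodI)
      then show ?thesis using p(2) by (auto elim!: dvdE simp: poly_ev_in)
    qed
    have "card Z \<le> card {t. poly (ev_in 1 (\<Prod>S)) t = 0}"
      using rt ne by (intro card_mono poly_roots_finite) auto
    also have "\<dots> \<le> degree (ev_in 1 (\<Prod>S))" using ne by (rule card_poly_roots_bound)
    also have "\<dots> \<le> degree (\<Prod>S)" by (rule degree_map_poly_le)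
    finally show ?thesis using Z(2) by simp
  qed
  have e0: "e \<noteq> 0" using e dn0 C0 by auto
  have S0: "\<Prod>S \<noteq> 0" using e dn0 C0 by auto
  \<comment> \<open>Comparing degrees in \<open>t\<close> leaves nothing for \<open>e\<close>: it is
    a polynomial in \<open>s\<close> only.\<close>
  have "degree d + degree C = degree (\<Prod>S) + degree e"
    using e dn0 C0 e0 S0 by (metis degree_mult_eq)
  then have "degree e = 0" using degC degS deg by simp
  then obtain \<epsilon> where \<epsilon>: "e = [:\<epsilon>:]" by (metis degree_0_id)
  obtain u where u: "r = \<Prod>S * u" using Sr by auto
  have "d * (C * u) = (d * C) * u" by (simp only: mult.assoc)
  also have "\<dots> = smult \<epsilon> r" unfolding e u \<epsilon> by simp
  finally have "d * (C * u) = smult \<epsilon> r" .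
  moreover have "\<epsilon> \<noteq> 0" using e0 \<epsilon> by auto
  \<comment> \<open>Powers of \<open>s\<close> in the extraneous factor cancel: if \<open>s\<close>
    divides it, then \<open>d * q\<close> vanishes at \<open>s = 0\<close>, where \<open>d\<close>
    is not identically 0, so \<open>s\<close> divides \<open>q\<close>.\<close>
  moreover have "\<exists>q' \<epsilon>'. poly \<epsilon>' 0 \<noteq> 0 \<and> d * q' = smult \<epsilon>' r"
    if "d * q = smult \<epsilon> r" "\<epsilon> \<noteq> 0" for q \<epsilon>
    using that
  proof (induction "degree \<epsilon>" arbitrary: \<epsilon> q rule: less_induct)
    case less
    show ?case
    proof (cases "poly \<epsilon> 0 = 0")
      case True
      then have "[:0, 1:] dvd \<epsilon>" by (simp add: poly_eq_0_iff_dvd)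
      then obtain \<epsilon>1 where \<epsilon>1: "\<epsilon> = [:0, 1:] * \<epsilon>1" by auto
      have "ev_in 0 (d * q) = 0" using less True by (simp add: ev_in_smult)
      then have "ev_in 0 q = 0" using d0 by (auto simp: ev_in_mult)
      then have "poly (coeff q k) 0 = 0" for k using coeff_ev_in[of 0 q k] by simp
      then have "[:0, 1:] dvd coeff q k" for k by (simp add: poly_eq_0_iff_dvd)
      then have "[:[:0, 1:]:] dvd q" by (simp add: const_poly_dvd_iff)
      then obtain q1 where q1: "q = smult [:0, 1:] q1" by auto
      have eq1: "d * q1 = smult \<epsilon>1 r"
      proof -
        have "smult [:0, 1:] (d * q1) = smult [:0, 1:] (smult \<epsilon>1 r)"
          using less.prems(1) unfolding q1 \<epsilon>1 by simp
        then have "smult [:0, 1:] (d * q1 - smult \<epsilon>1 r) = 0"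
          by (simp only: smult_diff_right diff_self)
        then show ?thesis by simp
      qed
      have \<epsilon>10: "\<epsilon>1 \<noteq> 0" using less.prems(2) \<epsilon>1 by auto
      then have "degree \<epsilon>1 < degree \<epsilon>" unfolding \<epsilon>1 by (subst degree_mult_eq) auto
      from less.hyps[OF this eq1 \<epsilon>10] show ?thesis .
    qed (use less in blast)
  qed
  ultimately obtain q' \<epsilon>' where q': "poly \<epsilon>' 0 \<noteq> 0" "d * q' = smult \<epsilon>' r" by blast
  \<comment> \<open>At \<open>t = 0\<close> the orders in \<open>s\<close> can be compared; as
    \<open>\<epsilon>'\<close> does not vanish at 0, that of \<open>r\<close> is at least that of
    \<open>d\<close>.\<close>
  have "poly d 0 * poly q' 0 = \<epsilon>' * poly r 0"
    using q'(2) by (metis poly_mult poly_smult)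
  then have "[:0, 1:] ^ M dvd \<epsilon>' * poly r 0" using dv by (metis dvd_mult2)
  then have "\<epsilon>' * poly r 0 = 0 \<or> M \<le> order 0 (\<epsilon>' * poly r 0)"
    using order_divides[of 0 M "\<epsilon>' * poly r 0"] by simp
  moreover have "\<epsilon>' \<noteq> 0" "order 0 \<epsilon>' = 0" using q'(1) by (auto simp: order_0I)
  ultimately have "poly r 0 = 0 \<or> M \<le> order 0 (poly r 0)"
    by (cases "poly r 0 = 0") (auto simp: order_mult)
  then show ?thesis using order_divides[of 0 M "poly r 0"] by simp
qed

section \<open>Evaluation and order of vanishing\<close>

definition mmon :: "('v \<Rightarrow> 'b::comm_semiring_1) \<Rightarrow> ('v \<Rightarrow>\<^sub>0 nat) \<Rightarrow> 'b" where
  "mmon u m = (\<Prod>x\<in>Poly_Mapping.keys m. u x ^ Poly_Mapping.lookup m x)"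

text \<open>The coefficient map allows evaluation of a complex polynomial at a point over a
  polynomial ring. Restriction to a line or to a surface with two parameters is then again an
  evaluation, and \<open>hom_mev\<close> specialises the parameters.\<close>

definition mev :: "('a::zero \<Rightarrow> 'b::comm_semiring_1) \<Rightarrow> ('v \<Rightarrow> 'b) \<Rightarrow> ('v, 'a) mpoly \<Rightarrow> 'b" where
  "mev \<iota> u p = (\<Sum>m\<in>Poly_Mapping.keys p. \<iota> (Poly_Mapping.lookup p m) * mmon u m)"

lemma mpoly_eval_eq_mev: "mpoly_eval u p = mev (\<lambda>c. c) u p"
  by (simp add: mpoly_eval_def mev_def mmon_def)

lemma mmon_superset:
  assumes "finite A" "Poly_Mapping.keys m \<subseteq> A"
  shows "mmon u m = (\<Prod>x\<in>A. u x ^ Poly_Mapping.lookup m x)"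
  unfolding mmon_def using assms
  by (intro prod.mono_neutral_left) (auto simp: in_keys_iff)

lemma mmon_zero [simp]: "mmon u 0 = 1"
  by (simp add: mmon_def)

lemma mmon_single: "mmon u (Poly_Mapping.single x n) = u x ^ n"
  by (simp add: mmon_def)

lemma mmon_add: "mmon u (m + n) = mmon u m * mmon u n"
proof -
  let ?A = "Poly_Mapping.keys m \<union> Poly_Mapping.keys n"
  have "Poly_Mapping.keys (m + n) \<subseteq> ?A" by (rule Poly_Mapping.keys_add)
  then show ?thesis
    by (simp add: mmon_superset[of ?A] lookup_add power_add prod.distrib)
qed

lemma mev_superset:
  assumes "finite A" "Poly_Mapping.keys p \<subseteq> A" "\<iota> 0 = 0"
  shows "mev \<iota> u p = (\<Sum>m\<in>A. \<iota> (Poly_Mapping.lookup p m) * mmon u m)"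
  unfolding mev_def using assms
  by (intro sum.mono_neutral_left) (auto simp: in_keys_iff)

lemma mev_zero [simp]: "mev \<iota> u 0 = 0"
  by (simp add: mev_def)

lemma mev_single: "\<iota> 0 = 0 \<Longrightarrow> mev \<iota> u (Poly_Mapping.single m c) = \<iota> c * mmon u m"
  by (simp add: mev_def)

lemma poly_mapping_sum_single:
  "p = (\<Sum>m\<in>Poly_Mapping.keys p. Poly_Mapping.single m (Poly_Mapping.lookup p m))"
  by (rule poly_mapping_eqI) (auto simp: lookup_sum lookup_single when_def in_keys_iff)

lemma mpoly_induct [case_names single add]:
  fixes P :: "('v, 'a::comm_monoid_add) mpoly \<Rightarrow> bool"
  assumes "\<And>m c. P (Poly_Mapping.single m c)" "\<And>p q. P p \<Longrightarrow> P q \<Longrightarrow> P (p + q)"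
  shows "P p"
proof -
  have "P (\<Sum>m\<in>A. Poly_Mapping.single m (f m))" if "finite A" for A f
    using that
  proof (induction A)
    case empty
    have "P (Poly_Mapping.single 0 0)" by (rule assms)
    then show ?case by simp
  qed (simp add: assms)
  then show ?thesis by (subst poly_mapping_sum_single) simp
qed

context comm_ring_hom
begin

lemma mev_add: "mev hom u (p + q) = mev hom u p + mev hom u q"
proof -
  let ?A = "Poly_Mapping.keys p \<union> Poly_Mapping.keys q"
  have "Poly_Mapping.keys (p + q) \<subseteq> ?A" by (rule Poly_Mapping.keys_add)
  then show ?thesis
    by (simp add: mev_superset[of ?A] lookup_add hom_add distrib_right sum.distrib)
qed

lemma mev_one: "mev hom u 1 = 1"
  by (metis hom_one hom_zero mev_single mmon_zero mult_1 single_one)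

lemma mev_indet: "mev hom u (indet x) = u x"
  by (simp add: indet_def mev_single mmon_single)

lemma mev_mult: "mev hom u (p * q) = mev hom u p * mev hom u q"
proof (induction p rule: mpoly_induct)
  case (single m c)
  show ?case
  proof (induction q rule: mpoly_induct)
    case (single n d)
    show ?case by (simp add: mult_single mev_single mmon_add hom_mult)
  qed (simp add: distrib_left mev_add)
qed (simp add: distrib_right mev_add)

lemma comm_ring_hom_mev: "comm_ring_hom (mev hom u)"
  by unfold_locales (simp_all add: mev_add mev_mult mev_one)

lemma hom_mev:
  "hom (mev \<iota> u p) = mev (\<lambda>c. hom (\<iota> c)) (\<lambda>x. hom (u x)) p"
  by (simp add: mev_def mmon_def hom_sum hom_mult hom_prod hom_power)

end

lemma comm_ring_hom_id: "comm_ring_hom (\<lambda>c. c)"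
  by unfold_locales auto

lemma comm_ring_hom_const: "comm_ring_hom (\<lambda>c. [:c:])"
  by unfold_locales (auto simp: one_pCons)

lemma comm_ring_hom_comp:
  assumes "comm_ring_hom f" "comm_ring_hom g"
  shows "comm_ring_hom (\<lambda>c. f (g c))"
proof -
  interpret f: comm_ring_hom f by fact
  interpret g: comm_ring_hom g by fact
  show ?thesis by unfold_locales (simp_all add: f.hom_add f.hom_mult g.hom_add g.hom_mult)
qed

lemma mev_cong:
  assumes "\<And>m x. m \<in> Poly_Mapping.keys p \<Longrightarrow> x \<in> Poly_Mapping.keys m \<Longrightarrow> u x = w x"
  shows "mev \<iota> u p = mev \<iota> w p"
  unfolding mev_def mmon_def
  by (intro sum.cong prod.cong arg_cong2[of _ _ _ _ "(*)"] refl) (simp add: assms)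

section \<open>Formal derivatives and lines through a point\<close>

lemma pdiff_add: "pdiff x (p + q) = pdiff x p + pdiff x q"
  by (rule poly_mapping_eqI) (simp add: lookup_pdiff lookup_add algebra_simps)

lemma pdiff_single:
  "pdiff x (Poly_Mapping.single m c) =
     Poly_Mapping.single (m - Poly_Mapping.single x 1) (of_nat (Poly_Mapping.lookup m x) * c)"
  by (cases "c = 0") (simp_all add: pdiff_def)

lemma coeff_1_mult: "coeff (p * q) (Suc 0) = coeff p 0 * coeff q (Suc 0) + coeff p (Suc 0) * coeff q 0"
  by (simp add: coeff_mult)

lemma coeff_0_power: "coeff (p ^ n) 0 = (coeff p 0) ^ n"
  by (induction n) (auto simp: coeff_mult_0)

lemma coeff_1_power:
  "coeff ([:a, e:] ^ n) (Suc 0) = of_nat n * a ^ (n - 1) * (e :: 'a::comm_ring_1)"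
proof (induction n)
  case (Suc n)
  have "coeff ([:a, e:] ^ Suc n) (Suc 0) = a * (of_nat n * a ^ (n - 1) * e) + e * a ^ n"
    by (simp add: coeff_1_mult coeff_0_power Suc)
  also have "\<dots> = of_nat (Suc n) * a ^ n * e"
    by (cases n) (auto simp: algebra_simps)
  finally show ?case by simp
qed auto

text \<open>Taylor's formula to first order in the coordinate \<open>x\<close>. Both sides are
  additive in \<open>F\<close>, so a monomial suffices, and there only the power of \<open>x\<close>
  has a linear term. The increment \<open>e\<close> is a ring element because it will be the
  parameter of the line itself.\<close>

lemma coeff_1_mev:
  fixes \<iota> :: "'a::comm_ring_1 \<Rightarrow> 'b::comm_ring_1"
  assumes "comm_ring_hom \<iota>"
  shows "coeff (mev (\<lambda>c. [:\<iota> c:]) (\<lambda>y. if y = x then [:w y, e:] else [:w y:]) F) (Suc 0)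
    = e * mev \<iota> w (pdiff x F)"
proof -
  interpret comm_ring_hom \<iota> by fact
  interpret c: comm_ring_hom "\<lambda>c. [:\<iota> c:]"
    by (intro comm_ring_hom_comp[OF comm_ring_hom_const] assms)
  interpret k: comm_ring_hom "\<lambda>c :: 'b. [:c:]" by (rule comm_ring_hom_const)
  let ?U = "\<lambda>y. if y = x then [:w y, e:] else [:w y:]"
  show ?thesis
  proof (induction F rule: mpoly_induct)
    case (single m c)
    let ?n = "Poly_Mapping.lookup m x"
    let ?A = "insert x (Poly_Mapping.keys m)"
    let ?W = "\<Prod>y\<in>?A - {x}. w y ^ Poly_Mapping.lookup m y"
    have "mmon ?U m = (\<Prod>y\<in>?A. ?U y ^ Poly_Mapping.lookup m y)"
      by (rule mmon_superset) auto
    also have "\<dots> = ?U x ^ ?n * (\<Prod>y\<in>?A - {x}. ?U y ^ Poly_Mapping.lookup m y)"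
      by (rule prod.remove) auto
    also have "(\<Prod>y\<in>?A - {x}. ?U y ^ Poly_Mapping.lookup m y) =
        (\<Prod>y\<in>?A - {x}. [:w y ^ Poly_Mapping.lookup m y:])"
      by (rule prod.cong) (auto simp: poly_const_pow)
    also have "\<dots> = [:?W:]"
      by (rule k.hom_prod[symmetric])
    finally have 1: "coeff (mmon ?U m) (Suc 0) = of_nat ?n * w x ^ (?n - 1) * e * ?W"
      by (simp add: coeff_1_power coeff_1_mult)
    have "mmon w (m - Poly_Mapping.single x 1) =
        (\<Prod>y\<in>?A. w y ^ Poly_Mapping.lookup (m - Poly_Mapping.single x 1) y)"
      by (rule mmon_superset) (auto simp: in_keys_iff lookup_minus lookup_single when_def)
    also have "\<dots> = w x ^ (?n - 1) *
        (\<Prod>y\<in>?A - {x}. w y ^ Poly_Mapping.lookup (m - Poly_Mapping.single x 1) y)"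
      by (subst prod.remove[of _ x]) (auto simp: lookup_minus)
    also have "(\<Prod>y\<in>?A - {x}. w y ^ Poly_Mapping.lookup (m - Poly_Mapping.single x 1) y) = ?W"
      by (rule prod.cong) (auto simp: lookup_minus lookup_single when_def)
    finally have 2: "mmon w (m - Poly_Mapping.single x 1) = w x ^ (?n - 1) * ?W" .
    have "coeff (mev (\<lambda>c. [:\<iota> c:]) ?U (Poly_Mapping.single m c)) (Suc 0)
        = \<iota> c * coeff (mmon ?U m) (Suc 0)"
      by (simp add: mev_single)
    also have "\<dots> = e * (\<iota> (of_nat ?n * c) * mmon w (m - Poly_Mapping.single x 1))"
      unfolding 1 2 by (simp add: hom_mult hom_of_nat mult_ac)
    finally show ?case by (simp add: pdiff_single mev_single)
  qed (simp add: c.mev_add pdiff_add mev_add distrib_left)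
qed

lemma X_power_dvd_iff: "[:0, 1:] ^ k dvd p \<longleftrightarrow> (\<forall>j<k. coeff p j = (0 :: 'a::comm_ring_1))"
  using monom_1_dvd_iff'[of k p] by (simp add: monom_altdef)

lemma coeff_poly_const: "coeff (poly Q [:r:]) j = poly (map_poly (\<lambda>c. coeff c j) Q) r"
  by (induction Q) (auto simp: map_poly_pCons)

text \<open>For \<open>j < k\<close> the coefficient at exponent \<open>j\<close> of the inner
  variable is a polynomial in the outer one with all numbers outside \<open>E\<close> as roots,
  hence 0. This serves both for differentiating in the outer variable and for passing to a limit at
  an exceptional value.\<close>

lemma X_power_dvd_coeffs:
  fixes Q :: "complex poly poly"
  assumes "\<And>r. r \<notin> E \<Longrightarrow> [:0, 1:] ^ k dvd poly Q [:r:]" "finite E"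
  shows "[:0, 1:] ^ k dvd coeff Q i"
  unfolding X_power_dvd_iff
proof (intro allI impI)
  fix j assume j: "j < k"
  let ?q = "map_poly (\<lambda>c. coeff c j) Q"
  have "poly ?q r = 0" if "r \<notin> E" for r
    using assms(1)[OF that] j unfolding X_power_dvd_iff coeff_poly_const by blast
  then have "UNIV - E \<subseteq> {r. poly ?q r = 0}" by auto
  moreover have "infinite (UNIV - E)" by (rule Diff_infinite_finite[OF assms(2) infinite_UNIV_char_0])
  ultimately have "infinite {r. poly ?q r = 0}" using finite_subset by blast
  then have "?q = 0" using poly_roots_finite by blast
  then have "coeff ?q i = 0" by simp
  then show "coeff (coeff Q i) j = 0" by (simp add: coeff_map_poly)
qed

text \<open>A derivative of \<open>F\<close> at \<open>u + s v\<close> is the linear coefficient in \<open>r\<close> of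
  \<open>F (u + s (v + r e\<^sub>x))\<close> up to the factor \<open>s\<close>, which costs one order of vanishing.\<close>

lemma vanishes_to_order_if_lines:
  fixes F :: "('v, complex) mpoly"
  assumes "\<And>v. [:0, 1:] ^ k dvd mev (\<lambda>c. [:c:]) (\<lambda>x. [:u x, v x:]) F"
  shows "vanishes_to_order k F u"
  unfolding vanishes_to_order_def
proof (intro allI impI)
  fix xs :: "'v list" assume "length xs < k"
  with assms show "mpoly_eval u (foldr pdiff xs F) = 0"
  \<comment> \<open>\<open>foldr\<close> applies the last derivation of the list first, so the list
    is taken apart at its end and the derivative takes the place of \<open>F\<close>.\<close>
  proof (induction xs arbitrary: F k rule: rev_induct)
    case Nil
    then obtain j where j: "k = Suc j" by (cases k) auto
    have "[:0, 1:] ^ 1 dvd mev (\<lambda>c. [:c:]) (\<lambda>x. [:u x, 0:]) F"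
      by (rule power_le_dvd[OF Nil(1)[of "\<lambda>_. 0"]]) (simp add: j)
    then have "poly (mev (\<lambda>c. [:c:]) (\<lambda>x. [:u x, 0:]) F) 0 = 0"
      by (auto elim!: dvdE)
    then show ?case
      by (simp add: comm_ring_hom.hom_mev[OF comm_ring_hom_poly_at] mpoly_eval_eq_mev)
  next
    case (snoc x ys)
    then obtain j where j: "k = Suc j" by (cases k) auto
    have "[:0, 1:] ^ j dvd mev (\<lambda>c. [:c:]) (\<lambda>x. [:u x, v x:]) (pdiff x F)" for v
    proof -
      let ?w = "\<lambda>y. [:u y, v y:]"
      let ?Q = "mev (\<lambda>c. [:[:c:]:]) (\<lambda>y. if y = x then [:?w y, [:0, 1:]:] else [:?w y:]) F"
      have "poly ?Q [:r:] = mev (\<lambda>c. [:c:]) (\<lambda>y. [:u y, v y + (if y = x then r else 0):]) F" for r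
      proof -
        have "(\<lambda>y. poly (if y = x then [:?w y, [:0, 1:]:] else [:?w y:]) [:r:]) =
            (\<lambda>y. [:u y, v y + (if y = x then r else 0):])"
          by (rule ext) auto
        then show ?thesis
          by (simp only: comm_ring_hom.hom_mev[OF comm_ring_hom_poly_at]) simp
      qed
      then have "[:0, 1:] ^ k dvd poly ?Q [:r:]" for r using snoc.prems(1) by metis
      then have "[:0, 1:] ^ k dvd coeff ?Q (Suc 0)" by (intro X_power_dvd_coeffs[of "{}"]) auto
      then have "[:0, 1:] * [:0, 1:] ^ j dvd [:0, 1:] * mev (\<lambda>c. [:c:]) ?w (pdiff x F)"
        by (simp only: coeff_1_mev[OF comm_ring_hom_const] j power_Suc)
      then show ?thesis by (subst (asm) dvd_times_left_cancel_iff) auto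
    qed
    then have "mpoly_eval u (foldr pdiff ys (pdiff x F)) = 0"
      by (rule snoc.IH) (use snoc.prems(2) j in auto)
    then show ?case by simp
  qed
qed

section \<open>Plane polynomials and the one-parameter subgroup\<close>

text \<open>Substitution of \<open>X\<close> for the inner and \<open>Y\<close> for the outer
  variable. The arbitrary target ring lets it cover restriction to orbits, translations and shears
  alike.\<close>

definition bev :: "(complex \<Rightarrow> 'b::comm_ring_1) \<Rightarrow> 'b \<Rightarrow> 'b \<Rightarrow> complex poly poly \<Rightarrow> 'b" where
  "bev \<iota> X Y p = poly (map_poly (\<lambda>c. poly (map_poly \<iota> c) X) p) Y"

abbreviation cc :: "complex \<Rightarrow> complex poly poly" where "cc c \<equiv> [:[:c:]:]"
abbreviation px :: "complex poly poly" where "px \<equiv> [:[:0, 1:]:]"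
abbreviation py :: "complex poly poly" where "py \<equiv> [:0, 1:]"

lemma comm_ring_hom_bev:
  assumes "comm_ring_hom \<iota>"
  shows "comm_ring_hom (bev \<iota> X Y)"
proof -
  have 1: "comm_ring_hom (\<lambda>c. poly (map_poly \<iota> c) X)"
    by (rule comm_ring_hom_comp[OF comm_ring_hom_poly_at comm_ring_hom_map_poly[OF assms]])
  show ?thesis
    using comm_ring_hom_comp[OF comm_ring_hom_poly_at[of Y] comm_ring_hom_map_poly[OF 1]]
    unfolding bev_def .
qed

lemma comm_ring_hom_cc: "comm_ring_hom cc"
  by (rule comm_ring_hom_comp[OF comm_ring_hom_const comm_ring_hom_const])

context comm_ring_hom
begin

lemma hom_poly_map: "hom (poly p x) = poly (map_poly hom p) (hom x)"
  by (induction p) (simp_all add: Polynomial.map_poly_pCons hom_add hom_mult)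

end

lemma bev_pCons:
  assumes "comm_ring_hom \<iota>"
  shows "bev \<iota> X Y (pCons a p) = poly (map_poly \<iota> a) X + Y * bev \<iota> X Y p"
proof -
  interpret comm_ring_hom \<iota> by fact
  show ?thesis by (simp add: bev_def Polynomial.map_poly_pCons)
qed

lemma bev_gens:
  assumes "comm_ring_hom \<iota>"
  shows "bev \<iota> X Y (cc c) = \<iota> c" "bev \<iota> X Y px = X" "bev \<iota> X Y py = Y"
proof -
  interpret comm_ring_hom \<iota> by fact
  show "bev \<iota> X Y (cc c) = \<iota> c" "bev \<iota> X Y px = X" "bev \<iota> X Y py = Y"
    by (simp_all add: bev_def Polynomial.map_poly_pCons)
qed

lemma hom_bev:
  assumes "comm_ring_hom \<psi>" "comm_ring_hom \<iota>"
  shows "\<psi> (bev \<iota> X Y p) = bev (\<lambda>c. \<psi> (\<iota> c)) (\<psi> X) (\<psi> Y) p"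
proof -
  interpret h: comm_ring_hom \<psi> by fact
  interpret i: comm_ring_hom \<iota> by fact
  have *: "map_poly \<psi> (map_poly \<iota> a) = map_poly (\<lambda>c. \<psi> (\<iota> c)) a" for a :: "complex poly"
    by (simp add: map_poly_map_poly o_def)
  have hi: "comm_ring_hom (\<lambda>c. \<psi> (\<iota> c))" using assms by (rule comm_ring_hom_comp)
  show ?thesis
  proof (induction p)
    case 0
    then show ?case by (simp add: bev_def)
  next
    case (pCons a p)
    then show ?case
      by (simp add: bev_pCons[OF hi] bev_pCons[OF assms(2)] h.hom_add h.hom_mult h.hom_poly_map *)
  qed
qed

lemma bev_sub:
  assumes "comm_ring_hom \<iota>"
  shows "bev \<iota> X Y (bev cc X' Y' p) = bev \<iota> (bev \<iota> X Y X') (bev \<iota> X Y Y') p"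
  by (simp add: hom_bev[OF comm_ring_hom_bev[OF assms] comm_ring_hom_cc] bev_gens[OF assms])

lemma bev_id: "bev cc px py p = p"
proof -
  have "poly (map_poly cc a) px = [:a:]" for a
    by (induction a) (simp_all add: Polynomial.map_poly_pCons)
  then show ?thesis
    by (induction p) (simp_all add: bev_pCons[OF comm_ring_hom_cc] bev_def[of _ _ _ 0])
qed

lemma bev_expand:
  assumes "comm_ring_hom \<iota>"
  shows "bev \<iota> X Y p =
    (\<Sum>k\<le>degree p. \<Sum>j\<le>degree (coeff p k). \<iota> (coeff (coeff p k) j) * X ^ j * Y ^ k)"
proof -
  interpret comm_ring_hom \<iota> by fact
  have *: "poly (map_poly h q) x = (\<Sum>i\<le>degree q. h (coeff q i) * x ^ i)"
    if "h 0 = 0" for h :: "'c::comm_ring_1 \<Rightarrow> 'd::comm_ring_1" and q x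
  proof -
    have "poly (map_poly h q) x = (\<Sum>i\<le>degree (map_poly h q). h (coeff q i) * x ^ i)"
      by (simp add: poly_altdef coeff_map_poly that)
    also have "\<dots> = (\<Sum>i\<le>degree q. h (coeff q i) * x ^ i)"
    proof (rule sum.mono_neutral_left)
      show "\<forall>i\<in>{..degree q} - {..degree (map_poly h q)}. h (coeff q i) * x ^ i = 0"
      proof
        fix i assume "i \<in> {..degree q} - {..degree (map_poly h q)}"
        then have "coeff (map_poly h q) i = 0" by (intro coeff_eq_0) auto
        then show "h (coeff q i) * x ^ i = 0" by (simp add: coeff_map_poly that)
      qed
    qed (auto simp: degree_map_poly_le)
    finally show ?thesis .
  qed
  have "bev \<iota> X Y p = (\<Sum>k\<le>degree p. poly (map_poly \<iota> (coeff p k)) X * Y ^ k)"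
    unfolding bev_def by (rule *) simp
  also have "\<dots> = (\<Sum>k\<le>degree p. (\<Sum>j\<le>degree (coeff p k). \<iota> (coeff (coeff p k) j) * X ^ j) * Y ^ k)"
    by (subst *) simp_all
  finally show ?thesis by (simp only: sum_distrib_right)
qed

text \<open>
  Forms of degree \<open>n\<close> are dehomogenised by \<open>X\<^sub>0 = 1\<close> to polynomials of total degree at most \<open>n\<close> in
  \<open>x\<close> (inner variable) and \<open>y\<close> (outer variable).
\<close>

definition V :: "nat \<Rightarrow> complex poly poly set" where
  "V n = {p. \<forall>k j. coeff (coeff p k) j \<noteq> 0 \<longrightarrow> j + k \<le> n}"

lemma VD: "p \<in> V n \<Longrightarrow> j + k > n \<Longrightarrow> coeff (coeff p k) j = 0"
  unfolding V_def using not_less by blast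

lemma VI: "(\<And>j k. j + k > n \<Longrightarrow> coeff (coeff p k) j = 0) \<Longrightarrow> p \<in> V n"
  unfolding V_def using not_less by blast

lemma V_degree_coeff: "p \<in> V n \<Longrightarrow> coeff p k \<noteq> 0 \<Longrightarrow> degree (coeff p k) + k \<le> n"
  using VD[of p n "degree (coeff p k)" k] by (intro leI) auto

lemma V_degree: "p \<in> V n \<Longrightarrow> degree p \<le> n"
  using V_degree_coeff[of p n "degree p"] by (cases "p = 0") auto

lemma V_mono: "m \<le> n \<Longrightarrow> V m \<subseteq> V n"
  unfolding V_def by (auto intro: le_trans)

lemma V_0 [simp]: "0 \<in> V n" by (simp add: V_def)

lemma V_add: "p \<in> V n \<Longrightarrow> q \<in> V n \<Longrightarrow> p + q \<in> V n"
  by (rule VI) (simp add: VD)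

lemma V_sum: "(\<And>i. i \<in> A \<Longrightarrow> f i \<in> V n) \<Longrightarrow> sum f A \<in> V n"
  by (induction A rule: infinite_finite_induct) (auto intro: V_add)

lemma V_cc: "cc c \<in> V n"
  by (auto simp: V_def coeff_pCons split: nat.splits)

lemma V_mult: "p \<in> V m \<Longrightarrow> q \<in> V n \<Longrightarrow> p * q \<in> V (m + n)"
proof -
  assume p: "p \<in> V m" and q: "q \<in> V n"
  have "coeff (coeff (p * q) k) j = 0" if jk: "j + k > m + n" for j k
  proof -
    have "coeff (coeff p i) l * coeff (coeff q (k - i)) (j - l) = 0" if "i \<le> k" "l \<le> j" for i l
    proof (cases "l + i > m")
      case True
      then show ?thesis using VD[OF p] by simp
    next
      case False
      then show ?thesis using VD[OF q, of "j - l" "k - i"] jk that by simp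
    qed
    then show ?thesis unfolding coeff_mult coeff_sum by (intro sum.neutral ballI) auto
  qed
  then show ?thesis unfolding V_def using not_less by blast
qed

lemma V_1: "1 \<in> V n"
  using V_cc[of 1 n] by (simp add: one_pCons)

lemma V_power: "p \<in> V m \<Longrightarrow> p ^ k \<in> V (k * m)"
  by (induction k) (auto simp: V_1 intro: V_mult)

lemma V_bev:
  assumes p: "p \<in> V n" and X: "X \<in> V (Suc 0)" and Y: "Y \<in> V (Suc 0)"
  shows "bev cc X Y p \<in> V n"
  unfolding bev_expand[OF comm_ring_hom_cc]
proof (intro V_sum)
  fix k j
  show "cc (coeff (coeff p k) j) * X ^ j * Y ^ k \<in> V n"
  proof (cases "coeff (coeff p k) j = 0")
    case False
    then have "j + k \<le> n" using VD[OF p, of j k] by force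
    moreover have "cc (coeff (coeff p k) j) * X ^ j * Y ^ k \<in> V (0 + j * Suc 0 + k * Suc 0)"
      by (intro V_mult V_cc V_power X Y)
    ultimately show ?thesis using V_mono[of "j + k" n] by auto
  qed simp
qed

text \<open>The dehomogenisation d/dx + y d/dy of \<open>deriv_D\<close>: the vector field on the
  group whose flow is translation by the one-parameter subgroup (t, exp t).\<close>

definition dv :: "complex poly poly \<Rightarrow> complex poly poly" where
  "dv p = map_poly pderiv p + py * pderiv p"

lemma coeff_dv: "coeff (dv p) k = pderiv (coeff p k) + of_nat k * coeff p k"
  by (cases k) (auto simp: dv_def coeff_map_poly coeff_pderiv)

lemma dv_add: "dv (p + q) = dv p + dv q"
  by (rule poly_eqI) (simp add: coeff_dv pderiv_add algebra_simps)

lemma dv_mult: "dv (p * q) = dv p * q + p * dv q"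
proof (rule poly_eqI)
  fix k
  have *: "pderiv (sum f A) = (\<Sum>i\<in>A. pderiv (f i))" for f :: "nat \<Rightarrow> complex poly" and A
    by (induction A rule: infinite_finite_induct) (auto simp: pderiv_add)
  have "coeff (dv (p * q)) k = (\<Sum>i\<le>k. pderiv (coeff p i * coeff q (k - i))
      + of_nat k * (coeff p i * coeff q (k - i)))"
    by (simp add: coeff_dv coeff_mult * sum.distrib sum_distrib_left)
  also have "\<dots> = (\<Sum>i\<le>k. coeff (dv p) i * coeff q (k - i) + coeff p i * coeff (dv q) (k - i))"
  proof (rule sum.cong)
    fix i assume "i \<in> {..k}"
    then have "(of_nat k :: complex poly) = of_nat i + of_nat (k - i)"
      by (simp flip: of_nat_add)
    then show "pderiv (coeff p i * coeff q (k - i)) + of_nat k * (coeff p i * coeff q (k - i)) =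
        coeff (dv p) i * coeff q (k - i) + coeff p i * coeff (dv q) (k - i)"
      by (simp add: coeff_dv pderiv_mult algebra_simps)
  qed simp
  also have "\<dots> = coeff (dv p * q + p * dv q) k"
    by (simp add: coeff_mult sum.distrib)
  finally show "coeff (dv (p * q)) k = coeff (dv p * q + p * dv q) k" .
qed

lemma dv_power: "dv (p ^ Suc n) = of_nat (Suc n) * p ^ n * dv p"
  by (induction n) (simp_all add: dv_mult algebra_simps)

lemma V_dv: "p \<in> V n \<Longrightarrow> dv p \<in> V n"
proof -
  assume p: "p \<in> V n"
  have "coeff (coeff (dv p) k) j = 0" if "j + k > n" for j k
    using VD[OF p, of j k] VD[OF p, of "Suc j" k] that
    by (simp add: coeff_dv coeff_pderiv of_nat_poly)
  then show ?thesis unfolding V_def using not_less by blast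
qed

lemma V_dv_iter: "p \<in> V n \<Longrightarrow> (dv ^^ i) p \<in> V n"
  by (induction i) (auto intro: V_dv)

text \<open>
  Restriction to the orbit \<open>(\<xi> + t, \<eta> exp t)\<close> of a point turns the derivation into \<open>d/dt\<close>.
\<close>

definition theta :: "complex \<times> complex \<Rightarrow> complex poly poly \<Rightarrow> complex fps" where
  "theta \<gamma> = bev fps_const (fps_const (fst \<gamma>) + fps_X) (fps_const (snd \<gamma>) * fps_exp 1)"

lemma comm_ring_hom_fps_const: "comm_ring_hom fps_const"
  by unfold_locales (auto simp: fps_const_add[symmetric] fps_const_mult[symmetric]
      simp del: fps_const_add fps_const_mult)

lemma comm_ring_hom_theta: "comm_ring_hom (theta \<gamma>)"
  unfolding theta_def by (rule comm_ring_hom_bev[OF comm_ring_hom_fps_const])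

lemma theta_mult: "theta \<gamma> (p * q) = theta \<gamma> p * theta \<gamma> q"
  and theta_add: "theta \<gamma> (p + q) = theta \<gamma> p + theta \<gamma> q"
proof -
  interpret comm_ring_hom "theta \<gamma>" by (rule comm_ring_hom_theta)
  show "theta \<gamma> (p * q) = theta \<gamma> p * theta \<gamma> q" "theta \<gamma> (p + q) = theta \<gamma> p + theta \<gamma> q"
    by (rule hom_mult hom_add)+
qed

text \<open>Chain rule along the orbit: the first coordinate has derivative 1 and the second is its
  own derivative.\<close>

lemma theta_dv: "theta \<gamma> (dv p) = fps_deriv (theta \<gamma> p)"
proof -
  let ?X = "fps_const (fst \<gamma>) + fps_X :: complex fps"
  let ?Y = "fps_const (snd \<gamma>) * fps_exp 1 :: complex fps"
  interpret h: comm_ring_hom "theta \<gamma>" by (rule comm_ring_hom_theta)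
  have 1: "poly (map_poly fps_const (pderiv a)) X = fps_deriv (poly (map_poly fps_const a) X)"
    if "fps_deriv X = 1" for a and X :: "complex fps"
  proof (induction a)
    case (pCons c a)
    have "poly (map_poly fps_const (p + q)) X = poly (map_poly fps_const p) X + poly (map_poly fps_const q) X"
      for p q :: "complex poly"
      by (rule comm_ring_hom.axioms(1)[OF comm_ring_hom_comp[OF comm_ring_hom_poly_at
            comm_ring_hom_map_poly[OF comm_ring_hom_fps_const]],
            THEN ring_hom.axioms(1), THEN semiring_hom.axioms(1),
            THEN comm_monoid_add_hom.axioms(1), THEN monoid_add_hom.axioms(2),
            THEN semigroup_add_hom.axioms(1), THEN plus_hom.hom_add])
    then show ?case
      by (simp add: pderiv_pCons Polynomial.map_poly_pCons pCons.IH that)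
  qed auto
  show ?thesis
  proof (induction p)
    case 0
    then show ?case by (simp add: dv_def)
  next
    case (pCons a p)
    have t1: "theta \<gamma> [:b:] = poly (map_poly fps_const b) ?X" for b
      by (simp add: theta_def bev_pCons[OF comm_ring_hom_fps_const]) (simp add: bev_def)
    have t2: "theta \<gamma> py = ?Y"
      by (simp add: theta_def bev_gens[OF comm_ring_hom_fps_const])
    have "pCons a p = [:a:] + py * p" by simp
    then have "dv (pCons a p) = dv [:a:] + dv (py * p)" by (simp only: dv_add)
    also have "dv [:a:] = [:pderiv a:]" by (simp add: dv_def Polynomial.map_poly_pCons)
    also have "dv (py * p) = py * p + py * dv p"
      by (simp add: dv_mult) (simp add: dv_def Polynomial.map_poly_pCons pderiv_pCons)
    finally have e: "dv (pCons a p) = [:pderiv a:] + (py * p + py * dv p)" .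
    have "theta \<gamma> (dv (pCons a p)) = poly (map_poly fps_const (pderiv a)) ?X
        + ?Y * theta \<gamma> p + ?Y * theta \<gamma> (dv p)"
      by (simp only: e theta_add theta_mult t1 t2 add.assoc)
    also have "\<dots> = fps_deriv (poly (map_poly fps_const a) ?X + ?Y * theta \<gamma> p)"
      by (subst 1) (simp_all add: pCons.IH algebra_simps)
    also have "\<dots> = fps_deriv (theta \<gamma> (pCons a p))"
      by (simp add: theta_def bev_pCons[OF comm_ring_hom_fps_const])
    finally show ?case .
  qed
qed

lemma theta_dv_iter: "theta \<gamma> ((dv ^^ i) p) = (fps_deriv ^^ i) (theta \<gamma> p)"
  by (induction i) (auto simp: theta_dv)

text \<open>The affine counterpart of the degree \<open>n\<close> part of the ideal: by
  \<open>eval_deriv_D_iter_eq_0_iff\<close> a Taylor coefficient along the orbit vanishes exactly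
  when the iterated derivative vanishes at the point.\<close>

definition Vsub :: "(complex \<times> complex) set \<Rightarrow> nat \<Rightarrow> nat \<Rightarrow> complex poly poly set" where
  "Vsub S T n = {p \<in> V n. \<forall>\<gamma>\<in>S. \<forall>i<T. fps_nth (theta \<gamma> p) i = 0}"

lemma fps_mult_nth_low:
  "(\<And>i. i < T \<Longrightarrow> fps_nth f i = 0) \<Longrightarrow> i < T \<Longrightarrow> fps_nth (f * g) i = (0 :: complex)"
  by (simp add: fps_mult_nth)

lemma Vsub_mult:
  assumes "p \<in> Vsub S T m" "q \<in> V n"
  shows "p * q \<in> Vsub S T (m + n)"
  unfolding Vsub_def
proof (intro CollectI conjI ballI allI impI)
  show "p * q \<in> V (m + n)" using assms by (auto simp: Vsub_def intro: V_mult)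
  fix \<gamma> i assume "\<gamma> \<in> S" "i < T"
  then show "fps_nth (theta \<gamma> (p * q)) i = 0"
    using assms(1) unfolding theta_mult Vsub_def by (intro fps_mult_nth_low[of T]) auto
qed

lemma fps_deriv_iter_low:
  "(\<And>i. i < T + j \<Longrightarrow> fps_nth f i = 0) \<Longrightarrow> i < T \<Longrightarrow> fps_nth ((fps_deriv ^^ j) f) i = (0::complex)"
proof (induction j arbitrary: T i)
  case (Suc j)
  have "fps_nth ((fps_deriv ^^ j) f) (Suc i) = 0"
    using Suc.prems by (intro Suc.IH[of "Suc T"]) auto
  then show ?case by simp
qed auto

text \<open>Pullback under translation by a group element; for nonzero \<open>\<eta>\<close> it is a
  ring automorphism, and it respects the bound on the total degree.\<close>

definition tau :: "complex \<Rightarrow> complex \<Rightarrow> complex poly poly \<Rightarrow> complex poly poly" where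
  "tau \<xi> \<eta> = bev cc [:[:\<xi>, 1:]:] [:0, [:\<eta>:]:]"

lemma comm_ring_hom_tau: "comm_ring_hom (tau \<xi> \<eta>)"
  unfolding tau_def by (rule comm_ring_hom_bev[OF comm_ring_hom_cc])

lemma V_tau: "p \<in> V n \<Longrightarrow> tau \<xi> \<eta> p \<in> V n"
  unfolding tau_def by (rule V_bev) (auto simp: V_def coeff_pCons split: nat.splits)

lemma coeff_tau: "coeff (tau \<xi> \<eta> p) k = smult (\<eta> ^ k) (pcompose (coeff p k) [:\<xi>, 1:])"
proof -
  have 1: "poly (map_poly cc a) [:[:\<xi>, 1:]:] = [:pcompose a [:\<xi>, 1:]:]" for a
    by (induction a) (simp_all add: Polynomial.map_poly_pCons pcompose_pCons)
  show ?thesis unfolding tau_def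
  proof (induction p arbitrary: k)
    case 0
    show ?case by (simp add: bev_def)
  next
    case (pCons a p)
    then show ?case
      by (cases k) (simp_all add: bev_pCons[OF comm_ring_hom_cc] 1 mult.commute)
  qed
qed

lemma tau_tau: "tau \<xi> \<eta> (tau \<xi>' \<eta>' p) = tau (\<xi> + \<xi>') (\<eta> * \<eta>') p"
proof (rule poly_eqI)
  fix k
  have "pcompose [:\<xi>', 1:] [:\<xi>, 1:] = [:\<xi> + \<xi>', 1:]"
    by (simp add: pcompose_pCons)
  then have "pcompose (pcompose (coeff p k) [:\<xi>', 1:]) [:\<xi>, 1:] = pcompose (coeff p k) [:\<xi> + \<xi>', 1:]"
    by (metis pcompose_assoc)
  then show "coeff (tau \<xi> \<eta> (tau \<xi>' \<eta>' p)) k = coeff (tau (\<xi> + \<xi>') (\<eta> * \<eta>') p) k"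
    by (simp add: coeff_tau pcompose_smult power_mult_distrib)
qed

lemma tau_0_1: "tau 0 1 p = p"
  by (rule poly_eqI) (simp add: coeff_tau)

lemma theta_tau:
  "theta \<gamma> (tau (fst \<gamma>') (snd \<gamma>') p) = theta (G_add \<gamma> \<gamma>') p"
proof -
  have 1: "bev fps_const X Y [:[:\<xi>, 1:]:] = fps_const \<xi> + X" for X Y \<xi>
    by (simp add: bev_def Polynomial.map_poly_pCons)
  have 2: "bev fps_const X Y [:0, [:\<eta>:]:] = fps_const \<eta> * Y" for X Y \<eta>
    by (simp add: bev_def Polynomial.map_poly_pCons)
  have 3: "fst (G_add \<gamma> \<gamma>') = fst \<gamma> + fst \<gamma>'" "snd (G_add \<gamma> \<gamma>') = snd \<gamma> * snd \<gamma>'"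
    by (cases \<gamma>; cases \<gamma>'; simp)+
  show ?thesis
    unfolding theta_def tau_def bev_sub[OF comm_ring_hom_fps_const] 1 2 3
      fps_const_add[symmetric] fps_const_mult[symmetric]
    by (simp only: mult_ac add_ac)
qed

text \<open>At most \<open>T1\<close> derivations leave order \<open>T\<close> out of
  \<open>T + T1\<close>, and the translation moves the conditions at
  \<open>\<gamma> + \<gamma>1\<close> back to \<open>\<gamma>\<close>. This family supplies the many
  solutions needed to avoid common factors.\<close>

lemma Vsub_family:
  assumes P: "P \<in> Vsub (G_sumset S S1) (T + T1) n" and "\<gamma>1 \<in> S1" "j \<le> T1"
  shows "tau (fst \<gamma>1) (snd \<gamma>1) ((dv ^^ j) P) \<in> Vsub S T n"
  unfolding Vsub_def
proof (intro CollectI conjI ballI allI impI)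
  show "tau (fst \<gamma>1) (snd \<gamma>1) ((dv ^^ j) P) \<in> V n"
    using P by (auto simp: Vsub_def intro: V_tau V_dv_iter)
  fix \<gamma> i assume "\<gamma> \<in> S" "i < T"
  then have "G_add \<gamma> \<gamma>1 \<in> G_sumset S S1" using assms(2) unfolding G_sumset_def by blast
  then have "fps_nth (theta (G_add \<gamma> \<gamma>1) P) i = 0" if "i < T + j" for i
    using P that assms(3) by (auto simp: Vsub_def)
  then show "fps_nth (theta \<gamma> (tau (fst \<gamma>1) (snd \<gamma>1) ((dv ^^ j) P))) i = 0"
    unfolding theta_tau theta_dv_iter using \<open>i < T\<close> by (rule fps_deriv_iter_low)
qed

section \<open>The zero estimate\<close>

lemma underdetermined_system:
  fixes a :: "'i \<Rightarrow> 'j \<Rightarrow> 'a::field"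
  assumes "finite I" "finite J" "card I < card J"
  shows "\<exists>x. (\<exists>j\<in>J. x j \<noteq> 0) \<and> (\<forall>i\<in>I. (\<Sum>j\<in>J. a i j * x j) = 0)"
  using assms
proof (induction I arbitrary: J a rule: finite_induct)
  case empty
  then have "J \<noteq> {}" by auto
  then show ?case by (intro exI[of _ "\<lambda>_. 1"]) auto
next
  case (insert i I)
  show ?case
  proof (cases "\<forall>j\<in>J. a i j = 0")
    case True
    have "card I < card J" using insert by auto
    then show ?thesis using insert.IH[of J a] insert.prems(1) True by auto
  next
    case False
    then obtain j0 where j0: "j0 \<in> J" "a i j0 \<noteq> 0" by auto
    define a' where "a' = (\<lambda>k j. a k j - a k j0 / a i j0 * a i j)"
    have "card I < card (J - {j0})" using insert j0 by auto
    then obtain x where x: "\<exists>j\<in>J - {j0}. x j \<noteq> 0" "\<forall>k\<in>I. (\<Sum>j\<in>J - {j0}. a' k j * x j) = 0"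
      using insert.IH[of "J - {j0}" a'] insert.prems(1) by auto
    define y where "y = x(j0 := - (\<Sum>j\<in>J - {j0}. a i j * x j) / a i j0)"
    have sy: "(\<Sum>j\<in>J. a k j * y j) = a k j0 * y j0 + (\<Sum>j\<in>J - {j0}. a k j * x j)" for k
      using insert.prems(1) j0(1) by (subst sum.remove[of _ j0]) (auto simp: y_def intro!: sum.cong)
    have "(\<Sum>j\<in>J. a k j * y j) = 0" if "k \<in> insert i I" for k
    proof (cases "k = i")
      case True
      then show ?thesis using j0(2) by (subst sy) (simp add: y_def)
    next
      case False
      then have "(\<Sum>j\<in>J - {j0}. a' k j * x j) = 0" using that x(2) by auto
      then have "(\<Sum>j\<in>J - {j0}. a k j * x j) = a k j0 / a i j0 * (\<Sum>j\<in>J - {j0}. a i j * x j)"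
        by (simp add: a'_def left_diff_distrib sum_subtractf sum_distrib_left mult.assoc)
      then show ?thesis by (subst sy) (simp add: y_def)
    qed
    moreover have "\<exists>j\<in>J. y j \<noteq> 0" using x(1) by (auto simp: y_def)
    ultimately show ?thesis by blast
  qed
qed

definition pairs :: "nat \<Rightarrow> (nat \<times> nat) set" where
  "pairs n = {(j, k). j + k \<le> n}"

lemma pairs_Sigma: "pairs n = prod.swap ` (SIGMA k:{..n}. {..n - k})"
  by (auto simp: pairs_def image_iff)

lemma finite_pairs [simp]: "finite (pairs n)"
  by (simp add: pairs_Sigma)

lemma card_pairs: "2 * card (pairs n) = (n + 1) * (n + 2)"
proof -
  have "card (pairs n) = (\<Sum>k\<le>n. Suc (n - k))"
    unfolding pairs_Sigma by (subst card_image) (auto simp: inj_on_def)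
  moreover have "2 * (\<Sum>k\<le>n. Suc (n - k)) = (n + 1) * (n + 2)"
  proof (induction n)
    case (Suc n)
    have "(\<Sum>k\<le>Suc n. Suc (Suc n - k)) = Suc (Suc n) + (\<Sum>k\<le>n. Suc (n - k))"
      by (subst sum.atMost_Suc_shift) simp
    then show ?case using Suc.IH by (simp del: sum.atMost_Suc add: algebra_simps)
  qed simp
  ultimately show ?thesis by simp
qed

lemma card_pairs_choose: "card (pairs n) = (n + 2) choose 2"
proof -
  have "2 * card (pairs n) = (n + 2) * (n + 1)" by (metis card_pairs mult.commute)
  then show ?thesis by (simp add: choose_two)
qed

lemma Vsub_V: "p \<in> Vsub S T n \<Longrightarrow> p \<in> V n"
  by (simp add: Vsub_def)

lemma Vsub_add: "p \<in> Vsub S T n \<Longrightarrow> q \<in> Vsub S T n \<Longrightarrow> p + q \<in> Vsub S T n"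
  by (simp add: Vsub_def V_add theta_add)

lemma Vsub_mono: "m \<le> n \<Longrightarrow> Vsub S T m \<subseteq> Vsub S T n"
  unfolding Vsub_def using V_mono by blast

lemma Vsub_scale: "p \<in> Vsub S T n \<Longrightarrow> cc c * p \<in> Vsub S T n"
  using Vsub_mult[of p S T n "cc c" 0] V_cc by (simp add: mult.commute)

lemma theta_cc: "theta \<gamma> (cc c) = fps_const c"
  by (simp add: theta_def bev_gens[OF comm_ring_hom_fps_const])

lemma theta_sum: "theta \<gamma> (sum f A) = (\<Sum>i\<in>A. theta \<gamma> (f i))"
proof -
  interpret comm_ring_hom "theta \<gamma>" by (rule comm_ring_hom_theta)
  show ?thesis by (rule hom_sum)
qed

lemma monom_eq_cc: "monom (monom c j) k = cc c * monom (monom 1 j) k"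
  by (simp add: smult_monom)

lemma exists_nonzero_Vsub:
  assumes "finite S" "T * card S < (n + 2) choose 2"
  obtains P where "P \<in> Vsub S T n" "P \<noteq> 0"
proof -
  have "card (S \<times> {..<T}) < card (pairs n)"
    using assms by (simp add: card_pairs_choose card_cartesian_product mult.commute)
  then obtain x :: "nat \<times> nat \<Rightarrow> complex" where x: "\<exists>j\<in>pairs n. x j \<noteq> 0"
    "\<forall>i\<in>S \<times> {..<T}. (\<Sum>j\<in>pairs n. fps_nth (theta (fst i) (monom (monom 1 (fst j)) (snd j))) (snd i) * x j) = 0"
    using underdetermined_system[of "S \<times> {..<T}" "pairs n"
        "\<lambda>i j. fps_nth (theta (fst i) (monom (monom 1 (fst j)) (snd j))) (snd i)"] assms(1)
    by auto
  define P where "P = (\<Sum>j\<in>pairs n. monom (monom (x j) (fst j)) (snd j))"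
  have cP: "coeff (coeff P k) j = (if (j, k) \<in> pairs n then x (j, k) else 0)" for j k
  proof -
    have "coeff (coeff P k) j = (\<Sum>i\<in>pairs n. if i = (j, k) then x i else 0)"
      unfolding P_def coeff_sum by (intro sum.cong) (auto simp: prod_eq_iff)
    then show ?thesis by simp
  qed
  have "P \<in> V n" by (rule VI) (auto simp: cP pairs_def)
  moreover have "fps_nth (theta \<gamma> P) i = 0" if "\<gamma> \<in> S" "i < T" for \<gamma> i
  proof -
    have "theta \<gamma> P = (\<Sum>j\<in>pairs n. fps_const (x j) * theta \<gamma> (monom (monom 1 (fst j)) (snd j)))"
      unfolding P_def theta_sum by (subst monom_eq_cc) (simp only: theta_mult theta_cc)
    then have "fps_nth (theta \<gamma> P) i = (\<Sum>j\<in>pairs n. x j * fps_nth (theta \<gamma> (monom (monom 1 (fst j)) (snd j))) i)"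
      by (simp add: fps_sum_nth)
    also have "\<dots> = 0" using x(2) that by (simp add: mult.commute)
    finally show ?thesis .
  qed
  moreover have "P \<noteq> 0"
  proof
    assume "P = 0"
    then have "x j = 0" if "j \<in> pairs n" for j
      using that cP[of "snd j" "fst j"] by simp
    then show False using x(1) by auto
  qed
  ultimately show ?thesis using that[of P] by (auto simp: Vsub_def)
qed

text \<open>With \<open>P = p ^ Suc n * A\<close> the product rule gives \<open>dv P\<close> as
  \<open>p ^ n * dv p * A\<close> times a unit, modulo \<open>p ^ Suc n\<close>. The induction
  hypothesis holds for \<open>dv P\<close> too, so \<open>p\<close> divides \<open>dv p * A\<close>
  and therefore \<open>A\<close>.\<close>

lemma prime_power_dvd_if_dv_iterates:
  assumes p: "prime_elem p" "\<not> p dvd dv p" and "\<And>j. j \<le> n \<Longrightarrow> p dvd (dv ^^ j) P"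
  shows "p ^ Suc n dvd P"
  using assms(3)
proof (induction n arbitrary: P)
  case 0
  from "0"[of 0] show ?case by simp
next
  case (Suc n)
  have 1: "p ^ Suc n dvd P" by (rule Suc.IH) (rule Suc.prems, simp)
  have 2: "p ^ Suc n dvd dv P"
  proof (rule Suc.IH)
    fix j assume "j \<le> n"
    then show "p dvd (dv ^^ j) (dv P)" using Suc.prems[of "Suc j"] by (simp add: funpow_swap1)
  qed
  from 1 obtain A where A: "P = p ^ Suc n * A" by auto
  have "dv P = p ^ n * (of_nat (Suc n) * dv p * A) + p ^ Suc n * dv A"
    unfolding A dv_mult dv_power by (simp only: mult_ac)
  then have "p ^ Suc n dvd p ^ n * (of_nat (Suc n) * dv p * A)"
    using 2 by (metis dvd_add_left_iff dvd_triv_left)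
  then have "p dvd of_nat (Suc n) * dv p * A"
    using p(1) by (simp only: power_Suc2) (auto dest: prime_elem_not_zeroI)
  moreover have "\<not> p dvd of_nat (Suc n)"
  proof -
    have "(of_nat (Suc n) :: complex poly poly) = cc (of_nat (Suc n))"
      by (simp only: of_nat_poly)
    then have "is_unit (of_nat (Suc n) :: complex poly poly)"
      by (simp add: is_unit_const_poly_iff del: of_nat_Suc)
    then show ?thesis using p(1) by (meson dvd_unit_imp_unit prime_elem_not_unit)
  qed
  ultimately have "p dvd A" using p by (meson prime_elem_dvd_mult_iff)
  then have "p ^ Suc n * p dvd P" unfolding A by (rule mult_dvd_mono[OF dvd_refl])
  then show ?case by (simp only: power_Suc2[symmetric])
qed

lemma py_dvd_iff: "py dvd p \<longleftrightarrow> coeff p 0 = 0"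
  using X_power_dvd_iff[of 1 p] by simp

lemma degree_dv_le: "degree (dv p) \<le> degree p"
  by (rule degree_le) (auto simp: coeff_dv coeff_eq_0)

text \<open>As \<open>dv\<close> does not raise the degree in y, the cofactor \<open>w\<close> is a
  polynomial in x, and the coefficients of \<open>p\<close> satisfy a_k' = (w - k) a_k. Comparing
  degrees in x gives w = k and a constant a_k whenever a_k is nonzero; so a nonzero a_0 would make
  \<open>p\<close> a constant. Geometrically, y = 0 is the only irreducible curve invariant under
  the flow.\<close>

lemma py_dvd_if_dv_invariant:
  assumes p: "prime_elem p" and dvp: "p dvd dv p"
  shows "py dvd p"
proof -
  have p0: "p \<noteq> 0" using p by (auto dest: prime_elem_not_zeroI)
  obtain w where w: "dv p = p * [:w:]"
  proof (cases "dv p = 0")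
    case True
    then show ?thesis using that[of 0] by simp
  next
    case False
    from dvp obtain q where q: "dv p = p * q" by auto
    with False have "q \<noteq> 0" by auto
    then have "degree p + degree q \<le> degree p"
      using q p0 degree_dv_le[of p] by (simp add: degree_mult_eq)
    then have "degree q = 0" by simp
    then show ?thesis using that[of "coeff q 0"] q by (metis degree_0_id)
  qed
  have key: "w = of_nat k \<and> degree (coeff p k) = 0" if k: "coeff p k \<noteq> 0" for k
  proof -
    have "pderiv (coeff p k) + of_nat k * coeff p k = w * coeff p k"
      using arg_cong[OF w, of "\<lambda>q. coeff q k"] by (simp add: coeff_dv)
    then have e: "pderiv (coeff p k) = (w - of_nat k) * coeff p k"
      by (simp add: algebra_simps)
    have "w = of_nat k"
    proof (rule ccontr)
      assume ne: "w \<noteq> of_nat k"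
      then have "degree (pderiv (coeff p k)) = degree (w - of_nat k) + degree (coeff p k)"
        unfolding e using k by (subst degree_mult_eq) auto
      moreover have "pderiv (coeff p k) \<noteq> 0" unfolding e using k ne by auto
      then have "degree (coeff p k) \<noteq> 0" by (auto simp: pderiv_eq_0_iff)
      ultimately show False by (simp add: degree_pderiv)
    qed
    then show ?thesis using e by (simp add: pderiv_eq_0_iff)
  qed
  have "coeff p 0 = 0"
  proof (rule ccontr)
    assume c: "coeff p 0 \<noteq> 0"
    have "coeff p k = 0" if "k > 0" for k
    proof (rule ccontr)
      assume "coeff p k \<noteq> 0"
      then have "(of_nat k :: complex poly) = of_nat 0" using key[of k] key[OF c] by simp
      then show False using that by (simp only: of_nat_eq_iff)
    qed
    then have "degree p = 0" by (metis leading_coeff_0_iff gr0I p0)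
    then have "p = [:coeff p 0:]" by (metis degree_0_id)
    also have "coeff p 0 = [:coeff (coeff p 0) 0:]" using key[OF c] by (metis degree_0_id)
    finally have e: "p = cc (coeff (coeff p 0) 0)" .
    then have "coeff (coeff p 0) 0 \<noteq> 0" using p0 by auto
    then have "is_unit p" by (subst e) (simp add: is_unit_const_poly_iff)
    then show False using p by auto
  qed
  then show ?thesis by (simp add: py_dvd_iff)
qed

section \<open>Prime factors and their translates\<close>

lemma tau_mult: "tau \<xi> \<eta> (p * q) = tau \<xi> \<eta> p * tau \<xi> \<eta> q"
proof -
  interpret comm_ring_hom "tau \<xi> \<eta>" by (rule comm_ring_hom_tau)
  show ?thesis by (rule hom_mult)
qed

lemma tau_dvd: "p dvd q \<Longrightarrow> tau \<xi> \<eta> p dvd tau \<xi> \<eta> q"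
  by (auto simp: dvd_def tau_mult)

lemma tau_inverse: "\<eta> \<noteq> 0 \<Longrightarrow> tau (- \<xi>) (1 / \<eta>) (tau \<xi> \<eta> p) = p"
  "\<eta> \<noteq> 0 \<Longrightarrow> tau \<xi> \<eta> (tau (- \<xi>) (1 / \<eta>) p) = p"
  by (simp_all add: tau_tau tau_0_1)

lemma tau_0: "tau \<xi> \<eta> 0 = 0"
  by (simp add: tau_def bev_def)

lemma prime_elem_tau:
  assumes p: "prime_elem p" and \<eta>: "\<eta> \<noteq> 0"
  shows "prime_elem (tau \<xi> \<eta> p)"
proof (rule prime_elemI)
  let ?i = "tau (- \<xi>) (1 / \<eta>)"
  have bk: "tau \<xi> \<eta> p dvd a \<longleftrightarrow> p dvd ?i a" for a
    using tau_dvd[of "tau \<xi> \<eta> p" a "- \<xi>" "1 / \<eta>"] tau_dvd[of p "?i a" \<xi> \<eta>] \<eta>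
    by (auto simp: tau_inverse)
  show "tau \<xi> \<eta> p \<noteq> 0"
    using p \<eta> tau_inverse(1)[of \<eta> \<xi> p] by (auto simp: tau_0 dest: prime_elem_not_zeroI)
  have "?i 1 = 1" by (simp add: tau_def bev_def one_pCons Polynomial.map_poly_pCons)
  then show "\<not> is_unit (tau \<xi> \<eta> p)" using p by (simp add: bk)
  fix a b assume "tau \<xi> \<eta> p dvd a * b"
  then show "tau \<xi> \<eta> p dvd a \<or> tau \<xi> \<eta> p dvd b"
    using p by (simp add: bk tau_mult prime_elem_dvd_mult_iff)
qed

lemma lead_coeff_shift: "lead_coeff (pcompose q [:a, 1:]) = lead_coeff (q :: complex poly)"
  by (subst lead_coeff_comp) auto

lemma pcompose_shift_eq_0: "pcompose q [:a, 1:] = 0 \<longleftrightarrow> (q :: complex poly) = 0"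
  using lead_coeff_shift[of q a] by (metis leading_coeff_0_iff)

lemma degree_tau: "\<eta> \<noteq> 0 \<Longrightarrow> degree (tau \<xi> \<eta> p) = degree p"
proof -
  assume \<eta>: "\<eta> \<noteq> 0"
  have "coeff (tau \<xi> \<eta> p) k = 0 \<longleftrightarrow> coeff p k = 0" for k
    using \<eta> by (simp add: coeff_tau pcompose_shift_eq_0)
  then show ?thesis by (simp add: degree_def)
qed

lemma prime_elem_lin: "prime_elem [:[:- r, 1:]:]" for r :: complex
proof -
  have "prime_elem [:- r, 1:]"
    by (rule prime_elem_linear_field_poly) simp
  then show ?thesis by (simp add: prime_elem_const_poly_iff)
qed

lemma coprime_linear: "a \<noteq> b \<Longrightarrow> coprime [:- a, 1:] [:- b, 1 :: complex:]"
proof (rule prime_elem_imp_coprime)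
  show "prime_elem [:- a, 1:]"
    by (rule prime_elem_linear_field_poly) simp
  assume "a \<noteq> b"
  then show "\<not> [:- a, 1:] dvd [:- b, 1:]" by (simp flip: poly_eq_0_iff_dvd)
qed

text \<open>Translating \<open>\<pi>\<close> back gives a common factor of \<open>P\<close> and its
  iterated derivatives. It is not divisible by y, because \<open>P\<close> is not; so it is not
  invariant and the criterion for multiplicity applies.\<close>

lemma translate_power_dvd:
  assumes P: "\<not> py dvd P" and \<pi>: "prime_elem \<pi>" and \<gamma>: "\<eta> \<noteq> 0"
    and dvd: "\<And>j. j \<le> n \<Longrightarrow> \<pi> dvd tau \<xi> \<eta> ((dv ^^ j) P)"
  shows "tau (- \<xi>) (1 / \<eta>) \<pi> ^ Suc n dvd P"
proof -
  let ?p = "tau (- \<xi>) (1 / \<eta>) \<pi>"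
  have d: "?p dvd (dv ^^ j) P" if "j \<le> n" for j
    using tau_dvd[OF dvd[OF that], of "- \<xi>" "1 / \<eta>"] \<gamma> by (simp add: tau_inverse)
  have pr: "prime_elem ?p" using \<pi> \<gamma> by (intro prime_elem_tau) auto
  have "\<not> py dvd ?p" using d[of 0] P dvd_trans[of py ?p P] by auto
  then have "\<not> ?p dvd dv ?p" using py_dvd_if_dv_invariant[OF pr] by blast
  then show ?thesis using pr d by (intro prime_power_dvd_if_dv_iterates)
qed

text \<open>The translates of x - r are the x - (r + \<open>\<xi>\<close>) with \<open>\<xi>\<close>
  in the first projection of \<open>S1\<close>, coprime when distinct. Each divides \<open>P\<close>
  with multiplicity \<open>T1 + 1\<close>, hence also a nonzero coefficient of \<open>P\<close> in
  y, whose degree is at most \<open>n\<close>.\<close>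

lemma card_translates_horizontal:
  fixes S1 :: "(complex \<times> complex) set"
  assumes P: "P \<noteq> 0" "P \<in> V n" "\<not> py dvd P"
    and S1: "S1 \<subseteq> group_G" "finite S1"
    and dvd: "\<And>\<gamma> j. \<gamma> \<in> S1 \<Longrightarrow> j \<le> T1 \<Longrightarrow> [:[:- r, 1:]:] dvd tau (fst \<gamma>) (snd \<gamma>) ((dv ^^ j) P)"
  shows "(T1 + 1) * card (fst ` S1) \<le> n"
proof -
  obtain k where k: "coeff P k \<noteq> 0" using P(1) by (metis leading_coeff_0_iff)
  have 1: "[:- (r + \<xi>), 1:] ^ Suc T1 dvd coeff P k" if "\<xi> \<in> fst ` S1" for \<xi>
  proof -
    from that obtain \<gamma> where \<gamma>: "\<gamma> \<in> S1" "\<xi> = fst \<gamma>" by auto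
    then have nz: "snd \<gamma> \<noteq> 0" using S1 by (auto simp: group_G_def)
    have "tau (- fst \<gamma>) (1 / snd \<gamma>) [:[:- r, 1:]:] = [:[:- (r + \<xi>), 1:]:]"
      by (rule poly_eqI) (simp add: coeff_tau coeff_pCons pcompose_pCons \<gamma>(2) split: nat.splits)
    then have "[:[:- (r + \<xi>), 1:]:] ^ Suc T1 dvd P"
      using translate_power_dvd[OF P(3) prime_elem_lin nz dvd[OF \<gamma>(1)]] by metis
    then have "[:[:- (r + \<xi>), 1:] ^ Suc T1:] dvd P" by (simp only: poly_const_pow)
    then show ?thesis by (simp only: const_poly_dvd_iff)
  qed
  have "(\<Prod>\<xi>\<in>fst ` S1. [:- (r + \<xi>), 1:] ^ Suc T1) dvd coeff P k"
  proof (rule prod_pairwise_coprime_dvd)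
    fix \<xi> \<xi>' :: complex assume "\<xi> \<noteq> \<xi>'"
    then have "coprime [:- (r + \<xi>), 1:] [:- (r + \<xi>'), 1:]" by (intro coprime_linear) auto
    then show "coprime ([:- (r + \<xi>), 1:] ^ Suc T1) ([:- (r + \<xi>'), 1:] ^ Suc T1)"
      by (intro coprime_power_left_iff[THEN iffD2] disjI1 coprime_power_right_iff[THEN iffD2] disjI1)
  qed (use S1 1 in auto)
  then have "degree (\<Prod>\<xi>\<in>fst ` S1. [:- (r + \<xi>), 1:] ^ Suc T1) \<le> degree (coeff P k)"
    using k by (rule dvd_imp_degree_le)
  also have "degree (\<Prod>\<xi>\<in>fst ` S1. [:- (r + \<xi>), 1:] ^ Suc T1) = (T1 + 1) * card (fst ` S1)"
    by (subst degree_prod_eq_sum_degree) (auto simp: degree_linear_power simp del: power_Suc)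
  also have "degree (coeff P k) \<le> n" using V_degree_coeff[OF P(2) k] by simp
  finally show ?thesis .
qed

text \<open>A shift of x keeps leading coefficients in x, so in the coefficient of y^k a translate
  scales them by the k-th power of \<open>\<eta>\<close>. For k = 0 this shows that the unit between
  the two translates is 1, and k = \<open>degree \<pi>\<close> gives the equation.\<close>

lemma associated_translates:
  assumes \<pi>: "coeff \<pi> 0 \<noteq> 0" and nz: "\<eta> \<noteq> 0" "\<eta>' \<noteq> 0"
    and eq: "normalize (tau \<xi> \<eta> \<pi>) = normalize (tau \<xi>' \<eta>' \<pi>)"
  shows "\<eta> ^ degree \<pi> = \<eta>' ^ degree \<pi>"
proof -
  obtain u where u: "is_unit u" "tau \<xi> \<eta> \<pi> = u * tau \<xi>' \<eta>' \<pi>"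
    using eq by (metis associatedE1)
  then obtain c where c: "u = cc c"
    by (metis is_unit_poly_iff)
  have lc: "\<eta> ^ k = c * \<eta>' ^ k" if k: "coeff \<pi> k \<noteq> 0" for k
  proof -
    have "smult (\<eta> ^ k) (pcompose (coeff \<pi> k) [:\<xi>, 1:]) =
        smult (c * \<eta>' ^ k) (pcompose (coeff \<pi> k) [:\<xi>', 1:])"
      using arg_cong[OF u(2), of "\<lambda>q. coeff q k"] unfolding c coeff_tau by (simp add: coeff_tau mult.commute)
    then have "lead_coeff (smult (\<eta> ^ k) (pcompose (coeff \<pi> k) [:\<xi>, 1:])) =
        lead_coeff (smult (c * \<eta>' ^ k) (pcompose (coeff \<pi> k) [:\<xi>', 1:]))" by simp
    then have "\<eta> ^ k * lead_coeff (coeff \<pi> k) = c * \<eta>' ^ k * lead_coeff (coeff \<pi> k)"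
      by (simp only: lead_coeff_smult lead_coeff_shift)
    then show ?thesis using k by simp
  qed
  have "c = 1" using lc[OF \<pi>] by simp
  moreover have "coeff \<pi> (degree \<pi>) \<noteq> 0" using \<pi> by auto
  ultimately show ?thesis using lc[of "degree \<pi>"] by simp
qed

text \<open>Different second projections may give associated translates, but a translate arises from
  at most b = \<open>degree \<pi>\<close> of them, the roots of a polynomial z^b - c. Conversely
  each translate consumes b times \<open>T1 + 1\<close> of the degree of \<open>P\<close> in y, so
  the two factors b compensate.\<close>

lemma card_translates_vertical:
  assumes P: "P \<noteq> 0" "P \<in> V n" "\<not> py dvd P"
    and S1: "S1 \<subseteq> group_G" "finite S1"
    and \<pi>: "prime_elem \<pi>" "degree \<pi> > 0" "coeff \<pi> 0 \<noteq> 0"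
    and dvd: "\<And>\<gamma> j. \<gamma> \<in> S1 \<Longrightarrow> j \<le> T1 \<Longrightarrow> \<pi> dvd tau (fst \<gamma>) (snd \<gamma>) ((dv ^^ j) P)"
  shows "(T1 + 1) * card (snd ` S1) \<le> n"
proof -
  define pg where "pg = (\<lambda>\<gamma> :: complex \<times> complex. tau (- fst \<gamma>) (1 / snd \<gamma>) \<pi>)"
  \<comment> \<open>Normalising identifies associated translates, so that distinct members of
    \<open>S\<close> are coprime.\<close>
  define S where "S = (\<lambda>\<gamma>. normalize (pg \<gamma>)) ` S1"
  have nz: "snd \<gamma> \<noteq> 0" if "\<gamma> \<in> S1" for \<gamma> using S1 that by (auto simp: group_G_def)
  have fS: "finite S" using S1 by (simp add: S_def)
  have S: "prime p \<and> p ^ Suc T1 dvd P \<and> degree p = degree \<pi>" if "p \<in> S" for p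
  proof -
    from that obtain \<gamma> where \<gamma>: "\<gamma> \<in> S1" "p = normalize (pg \<gamma>)" by (auto simp: S_def)
    have "pg \<gamma> ^ Suc T1 dvd P"
      unfolding pg_def by (rule translate_power_dvd[OF P(3) \<pi>(1) nz[OF \<gamma>(1)] dvd[OF \<gamma>(1)]])
    moreover have "p ^ Suc T1 dvd pg \<gamma> ^ Suc T1" unfolding \<gamma>(2) by (intro dvd_power_same) simp
    moreover have pe: "prime_elem (pg \<gamma>)"
      unfolding pg_def using \<pi>(1) nz[OF \<gamma>(1)] by (intro prime_elem_tau) auto
    then have "prime p" unfolding \<gamma>(2) by (simp add: prime_def)
    moreover have "degree p = degree (pg \<gamma>)"
      unfolding \<gamma>(2) using pe by (intro antisym dvd_imp_degree_le) (auto dest: prime_elem_not_zeroI)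
    moreover have "degree (pg \<gamma>) = degree \<pi>" unfolding pg_def using nz[OF \<gamma>(1)] by (simp add: degree_tau)
    ultimately show ?thesis by (metis dvd_trans)
  qed
  have nzp: "p \<noteq> 0" if "p \<in> S" for p using S[OF that] by auto
  have "(\<Prod>p\<in>S. p ^ Suc T1) dvd P"
  proof (rule prod_pairwise_coprime_dvd)
    fix p q assume "p \<in> S" "q \<in> S" "p \<noteq> q"
    then have "coprime p q" using S primes_coprime by blast
    then show "coprime (p ^ Suc T1) (q ^ Suc T1)"
      by (intro coprime_power_left_iff[THEN iffD2] disjI1 coprime_power_right_iff[THEN iffD2] disjI1)
  qed (use S fS in auto)
  then have "degree (\<Prod>p\<in>S. p ^ Suc T1) \<le> degree P" using P(1) by (rule dvd_imp_degree_le)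
  also have "degree (\<Prod>p\<in>S. p ^ Suc T1) = (\<Sum>p\<in>S. degree (p ^ Suc T1))"
    by (intro degree_prod_eq_sum_degree ballI power_not_zero) (rule nzp)
  also have "\<dots> = (\<Sum>p\<in>S. Suc T1 * degree \<pi>)"
    using S nzp by (intro sum.cong refl) (simp add: degree_power_eq del: power_Suc)
  also have "\<dots> = Suc T1 * (card S * degree \<pi>)" by (simp add: algebra_simps)
  finally have le: "Suc T1 * (card S * degree \<pi>) \<le> n" using V_degree[OF P(2)] by simp
  define A where "A = (\<lambda>p. {snd \<gamma> | \<gamma>. \<gamma> \<in> S1 \<and> normalize (pg \<gamma>) = p})"
  have cA: "card (A p) \<le> degree \<pi>" if "p \<in> S" for p
  proof -
    from that obtain \<gamma>0 where \<gamma>0: "\<gamma>0 \<in> S1" "p = normalize (pg \<gamma>0)" by (auto simp: S_def)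
    define b where "b = degree \<pi>"
    let ?q = "monom 1 b - [:snd \<gamma>0 ^ b:]"
    have "coeff ?q b = 1" using \<pi>(2) by (simp add: b_def coeff_pCons split: nat.splits)
    then have q0: "?q \<noteq> 0" by (metis coeff_0 zero_neq_one)
    have "snd \<gamma> ^ b = snd \<gamma>0 ^ b" if "\<gamma> \<in> S1" "normalize (pg \<gamma>) = p" for \<gamma>
    proof -
      have "(1 / snd \<gamma>) ^ b = (1 / snd \<gamma>0) ^ b"
        unfolding b_def
        by (rule associated_translates[OF \<pi>(3)])
           (use that \<gamma>0 nz in \<open>auto simp: pg_def\<close>)
      then show ?thesis using that \<gamma>0 nz by (simp add: power_divide)
    qed
    then have "A p \<subseteq> {z. poly ?q z = 0}" by (auto simp: A_def poly_monom)
    then have "card (A p) \<le> card {z. poly ?q z = 0}"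
      using q0 by (intro card_mono poly_roots_finite)
    also have "\<dots> \<le> degree ?q" using q0 by (rule card_poly_roots_bound)
    also have "\<dots> \<le> b" by (intro degree_diff_le degree_monom_le) simp_all
    finally show ?thesis by (simp add: b_def)
  qed
  have fA: "finite (A p)" for p
    by (rule finite_subset[of _ "snd ` S1"]) (use S1(2) in \<open>force simp: A_def\<close>)+
  have "snd ` S1 \<subseteq> (\<Union>p\<in>S. A p)" by (force simp: S_def A_def)
  then have "card (snd ` S1) \<le> card (\<Union>p\<in>S. A p)" using fS fA by (intro card_mono) auto
  also have "\<dots> \<le> (\<Sum>p\<in>S. card (A p))" using fS by (rule card_UN_le)
  also have "\<dots> \<le> (\<Sum>p\<in>S. degree \<pi>)" using cA by (rule sum_mono)
  finally have "card (snd ` S1) \<le> card S * degree \<pi>" by simp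
  then have "Suc T1 * card (snd ` S1) \<le> Suc T1 * (card S * degree \<pi>)" by (rule mult_le_mono2)
  then show ?thesis using le by simp
qed

text \<open>Over the complex numbers a prime in x alone has a linear factor x - r, to which the
  horizontal count applies. A prime of positive degree in y is not divisible by y, since
  translations only rescale y and y does not divide \<open>P\<close>; the vertical count then
  applies.\<close>

lemma no_common_prime_of_translates:
  assumes P: "P \<noteq> 0" "P \<in> V n" "\<not> py dvd P"
    and S1: "S1 \<subseteq> group_G" "finite S1"
    and bd: "n < (T1 + 1) * min (card (fst ` S1)) (card (snd ` S1))"
    and \<pi>: "prime \<pi>"
  shows "\<exists>\<gamma>\<in>S1. \<exists>j\<le>T1. \<not> \<pi> dvd tau (fst \<gamma>) (snd \<gamma>) ((dv ^^ j) P)"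
proof (rule ccontr)
  assume "\<not> ?thesis"
  then have dvd: "\<pi> dvd tau (fst \<gamma>) (snd \<gamma>) ((dv ^^ j) P)" if "\<gamma> \<in> S1" "j \<le> T1" for \<gamma> j
    using that by blast
  have b1: "n < (T1 + 1) * card (fst ` S1)" and b2: "n < (T1 + 1) * card (snd ` S1)"
    by (rule less_le_trans[OF bd mult_le_mono2], simp)+
  have \<pi>0: "\<pi> \<noteq> 0" "\<not> is_unit \<pi>" using \<pi> by auto
  show False
  proof (cases "degree \<pi> = 0")
    case True
    then obtain w where w: "\<pi> = [:w:]" by (metis degree_0_id)
    have "\<not> constant (poly w)"
    proof
      assume "constant (poly w)"
      then obtain c where "w = [:c:]" using constant_degree degree_0_id by metis
      then show False using \<pi>0 w by (auto simp: is_unit_const_poly_iff)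
    qed
    then obtain r where "poly w r = 0" using fundamental_theorem_of_algebra by blast
    then have "[:- r, 1:] dvd w" by (simp add: poly_eq_0_iff_dvd)
    then have "[:[:- r, 1:]:] dvd \<pi>" by (simp add: w const_poly_dvd)
    then show False
      using card_translates_horizontal[OF P S1, of T1 r] dvd b1 by (meson dvd_trans not_le)
  next
    case False
    have "coeff \<pi> 0 \<noteq> 0"
    proof
      assume z: "coeff \<pi> 0 = 0"
      have "S1 \<noteq> {}" using b1 by auto
      then obtain \<gamma> where \<gamma>: "\<gamma> \<in> S1" by auto
      from dvd[OF \<gamma>, of 0] have "\<pi> dvd tau (fst \<gamma>) (snd \<gamma>) P" by simp
      moreover have "py dvd \<pi>" using z by (simp add: py_dvd_iff)
      ultimately have "py dvd tau (fst \<gamma>) (snd \<gamma>) P" by (metis dvd_trans)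
      then have "coeff P 0 = 0" by (simp add: py_dvd_iff coeff_tau pcompose_shift_eq_0)
      then show False using P(3) by (simp add: py_dvd_iff)
    qed
    then show False
      using card_translates_vertical[OF P S1, of \<pi> T1] dvd b2 \<pi> False by (meson bot_nat_0.not_eq_extremum not_le prime_def)
  qed
qed

text \<open>If \<open>f\<close> serves the old primes and \<open>u\<close> the new one, each prime
  divides \<open>f + cc c * u\<close> for at most one \<open>c\<close>: two such constants would
  make it divide \<open>u\<close> and then \<open>f\<close>.\<close>

lemma avoid_primes:
  assumes "finite Ps" "\<And>\<pi>. \<pi> \<in> Ps \<Longrightarrow> prime \<pi> \<and> (\<exists>u\<in>Vsub S T n. \<not> \<pi> dvd u)"
  shows "\<exists>f\<in>Vsub S T n. \<forall>\<pi>\<in>Ps. \<not> \<pi> dvd f"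
  using assms
proof (induction Ps)
  case empty
  have "0 \<in> Vsub S T n" using theta_cc[of _ 0] by (simp add: Vsub_def)
  then show ?case by auto
next
  case (insert \<pi> Ps)
  from insert obtain f where f: "f \<in> Vsub S T n" "\<forall>\<pi>\<in>Ps. \<not> \<pi> dvd f" by auto
  from insert.prems[of \<pi>] obtain u where u: "u \<in> Vsub S T n" "\<not> \<pi> dvd u" by auto
  have fin: "finite {c. \<rho> dvd f + cc c * u}" if \<rho>: "\<rho> \<in> insert \<pi> Ps" for \<rho>
  proof -
    have pr: "prime \<rho>" using insert.prems \<rho> by auto
    have "c = c'" if c: "\<rho> dvd f + cc c * u" "\<rho> dvd f + cc c' * u" for c c'
    proof (rule ccontr)
      assume ne: "c \<noteq> c'"
      have "\<rho> dvd (f + cc c * u) - (f + cc c' * u)" using c by (rule dvd_diff)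
      also have "(f + cc c * u) - (f + cc c' * u) = cc (c - c') * u"
        by (simp add: smult_diff_left[symmetric])
      finally have "\<rho> dvd cc (c - c') * u" .
      moreover have "is_unit (cc (c - c'))" using ne by (simp add: is_unit_const_poly_iff)
      ultimately have "\<rho> dvd u" by (metis dvd_mult_unit_iff')
      then have "\<rho> dvd cc c * u" by (rule dvd_mult)
      then have "\<rho> dvd f" using c(1) by (metis dvd_add_left_iff)
      then show False using f(2) u(2) \<open>\<rho> dvd u\<close> \<rho> by auto
    qed
    then have "{c. \<rho> dvd f + cc c * u} \<subseteq> {c0}" if "\<rho> dvd f + cc c0 * u" for c0
      using that by blast
    then show ?thesis
      by (cases "\<exists>c0. \<rho> dvd f + cc c0 * u") (blast intro: finite_subset, simp)
  qed
  have "finite (\<Union>\<rho>\<in>insert \<pi> Ps. {c. \<rho> dvd f + cc c * u})" using fin insert.hyps by auto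
  then obtain c where "c \<notin> (\<Union>\<rho>\<in>insert \<pi> Ps. {c. \<rho> dvd f + cc c * u})"
    using ex_new_if_finite infinite_UNIV_char_0 by blast
  then have "\<forall>\<rho>\<in>insert \<pi> Ps. \<not> \<rho> dvd f + cc c * u" by blast
  moreover have "f + cc c * u \<in> Vsub S T n" using f u by (intro Vsub_add Vsub_scale)
  ultimately show ?case by blast
qed

text \<open>\<open>n\<close> is the least degree with a nonzero solution. On every orbit y is a unit
  among the power series, so a quotient by y would be a solution of smaller degree. Minimality also
  makes the total degree exactly \<open>n\<close>.\<close>

lemma minimal_form:
  assumes fin: "finite S" and S: "S \<subseteq> group_G" and bd: "T * card S < (D + 2) choose 2"
  obtains n P where "n \<le> D" "P \<in> Vsub S T n" "P \<noteq> 0" "\<not> py dvd P"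
    "\<exists>k\<le>n. coeff (coeff P k) (n - k) \<noteq> 0"
proof -
  define Q where "Q = (\<lambda>n. \<exists>P\<in>Vsub S T n. P \<noteq> 0)"
  have QD: "Q D" using exists_nonzero_Vsub[OF fin bd] unfolding Q_def by blast
  define n where "n = (LEAST n. Q n)"
  have "Q n" unfolding n_def using QD by (rule LeastI)
  then obtain P where P: "P \<in> Vsub S T n" "P \<noteq> 0" unfolding Q_def by auto
  have min: "p = 0" if "p \<in> Vsub S T m" "m < n" for p m
    using that not_less_Least[of m Q] unfolding n_def Q_def by blast
  have 1: "\<not> py dvd P"
  proof
    assume "py dvd P"
    then obtain q where q: "P = py * q" by auto
    have q0: "q \<noteq> 0" using P(2) q by auto
    have cq: "coeff q k = coeff P (Suc k)" for k unfolding q by simp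
    have n0: "n > 0"
    proof (rule ccontr)
      assume "\<not> n > 0"
      then have "q = 0"
        using VD[OF Vsub_V[OF P(1)]] by (intro poly_eqI) (auto simp: cq)
      then show False using q0 by simp
    qed
    have "q \<in> V (n - 1)"
      using n0 VD[OF Vsub_V[OF P(1)]] by (intro VI) (auto simp: cq)
    moreover have "fps_nth (theta \<gamma> q) i = 0" if \<gamma>: "\<gamma> \<in> S" and i: "i < T" for \<gamma> i
    proof -
      have nz: "snd \<gamma> \<noteq> 0" using S \<gamma> by (auto simp: group_G_def)
      let ?Y = "fps_const (snd \<gamma>) * fps_exp 1" and ?Z = "fps_const (1 / snd \<gamma>) * fps_exp (- 1) :: complex fps"
      have YZ: "?Y * ?Z = 1"
      proof -
        have "fps_exp 1 * fps_exp (- 1) = (1 :: complex fps)"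
          by (metis add.right_inverse fps_exp_0 fps_exp_add_mult)
        moreover have "fps_const (snd \<gamma>) * fps_const (1 / snd \<gamma>) = 1" using nz by simp
        moreover have "?Y * ?Z = (fps_const (snd \<gamma>) * fps_const (1 / snd \<gamma>)) * (fps_exp 1 * fps_exp (- 1))"
          by (simp only: mult_ac)
        ultimately show ?thesis by simp
      qed
      have "theta \<gamma> P = ?Y * theta \<gamma> q"
        unfolding q theta_mult by (simp add: theta_def bev_gens[OF comm_ring_hom_fps_const])
      then have "theta \<gamma> P * ?Z = (?Y * ?Z) * theta \<gamma> q" by (simp only: mult_ac)
      then have "theta \<gamma> q = theta \<gamma> P * ?Z" unfolding YZ by simp
      then show ?thesis using P(1) \<gamma> i fps_mult_nth_low[of T "theta \<gamma> P" i ?Z] by (auto simp: Vsub_def)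
    qed
    ultimately have "q \<in> Vsub S T (n - 1)" by (auto simp: Vsub_def)
    then show False using min[of q "n - 1"] q0 n0 by simp
  qed
  have 2: "\<exists>k\<le>n. coeff (coeff P k) (n - k) \<noteq> 0"
  proof (rule ccontr)
    assume no: "\<not> ?thesis"
    have z: "coeff (coeff P k) j = 0" if "j + k \<ge> n" for j k
    proof (cases "j + k = n")
      case True
      then have "j = n - k" "k \<le> n" by auto
      then show ?thesis using no by auto
    qed (use that VD[OF Vsub_V[OF P(1)]] in auto)
    show False
    proof (cases "n = 0")
      case True
      then have "P = 0" using z by (intro poly_eqI) auto
      then show False using P by simp
    next
      case False
      then have "P \<in> V (n - 1)" using z by (intro VI) auto
      then have "P \<in> Vsub S T (n - 1)" using P(1) by (auto simp: Vsub_def)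
      then show False using min[of P "n - 1"] P(2) False by auto
    qed
  qed
  have "n \<le> D" unfolding n_def using QD by (rule Least_le)
  then show ?thesis using that P 1 2 by blast
qed

text \<open>No prime divides all members of the family from \<open>Vsub_family\<close>, so some
  solution \<open>F1\<close> avoids the finitely many prime factors of \<open>F0\<close>. The last
  conclusion says that \<open>F0\<close> has total degree exactly \<open>D\<close>, which a shear
  turns into degree \<open>D\<close> in y.\<close>

lemma zero_estimate:
  assumes S: "S \<subseteq> group_G" "finite S"
    and S1: "S1 \<subseteq> group_G" "finite S1"
    and bd: "D < (T1 + 1) * min (card (fst ` S1)) (card (snd ` S1))"
    and dim: "(T + T1) * card (G_sumset S S1) < (D + 2) choose 2"
  obtains F0 F1 where "F0 \<in> Vsub S T D" "F1 \<in> Vsub S T D" "coprime F0 F1"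
    "\<exists>k\<le>D. coeff (coeff F0 k) (D - k) \<noteq> 0"
proof -
  have fin: "finite (G_sumset S S1)"
    unfolding G_sumset_def using S S1 by (intro finite_image_set2) auto
  have sub: "G_sumset S S1 \<subseteq> group_G"
    using S S1 by (auto simp: G_sumset_def group_G_def)
  from minimal_form[OF fin sub dim] obtain n P where n: "n \<le> D"
    and P: "P \<in> Vsub (G_sumset S S1) (T + T1) n" "P \<noteq> 0" "\<not> py dvd P"
    and top: "\<exists>k\<le>n. coeff (coeff P k) (n - k) \<noteq> 0" by blast
  have "S1 \<noteq> {}" using bd by auto
  then obtain \<gamma> where \<gamma>: "\<gamma> \<in> S1" by auto
  then have nz: "snd \<gamma> \<noteq> 0" using S1 by (auto simp: group_G_def)
  \<comment> \<open>The power of x fills the degree up from \<open>n\<close> to \<open>D\<close> and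
    keeps the top-degree part nonzero.\<close>
  define F0 where "F0 = tau (fst \<gamma>) (snd \<gamma>) P * [:monom 1 (D - n):]"
  have "[:monom 1 (D - n):] \<in> V (D - n)"
    by (rule VI) (auto simp: coeff_pCons split: nat.splits)
  moreover have "tau (fst \<gamma>) (snd \<gamma>) P \<in> Vsub S T n"
    using Vsub_family[OF P(1) \<gamma>, of 0] by simp
  ultimately have "F0 \<in> Vsub S T (n + (D - n))" unfolding F0_def by (intro Vsub_mult)
  then have F0: "F0 \<in> Vsub S T D" using n by simp
  have topF0: "\<exists>k\<le>D. coeff (coeff F0 k) (D - k) \<noteq> 0"
  proof -
    from top obtain k where k: "k \<le> n" "coeff (coeff P k) (n - k) \<noteq> 0" by auto
    have "coeff P k \<noteq> 0" using k by auto
    then have "degree (coeff P k) \<le> n - k" using V_degree_coeff[OF Vsub_V[OF P(1)]] by force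
    then have dk: "degree (coeff P k) = n - k" using k(2) le_degree by (metis antisym)
    have "degree (pcompose (coeff P k) [:fst \<gamma>, 1:]) = n - k" by (simp add: dk)
    then have c: "coeff (pcompose (coeff P k) [:fst \<gamma>, 1:]) (n - k) \<noteq> 0"
      using lead_coeff_shift[of "coeff P k" "fst \<gamma>"] k(2) dk by simp
    have "coeff (coeff F0 k) (D - k) = coeff (coeff (tau (fst \<gamma>) (snd \<gamma>) P) k * monom 1 (D - n)) (D - k)"
      by (simp add: F0_def mult.commute)
    also have "\<dots> = coeff (coeff (tau (fst \<gamma>) (snd \<gamma>) P) k) (n - k)"
      using n k(1) by (subst mult.commute) (simp add: coeff_monom_mult)
    also have "\<dots> \<noteq> 0" using c nz by (simp add: coeff_tau)
    finally show ?thesis using k(1) n by (intro exI[of _ k]) auto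
  qed
  then have F00: "F0 \<noteq> 0" by auto
  have bdn: "n < (T1 + 1) * min (card (fst ` S1)) (card (snd ` S1))" using bd n by simp
  have "prime \<pi> \<and> (\<exists>u\<in>Vsub S T D. \<not> \<pi> dvd u)" if "\<pi> \<in> prime_factors F0" for \<pi>
  proof
    show pr: "prime \<pi>" using that by auto
    show "\<exists>u\<in>Vsub S T D. \<not> \<pi> dvd u"
      using no_common_prime_of_translates[OF P(2) Vsub_V[OF P(1)] P(3) S1 bdn pr]
        Vsub_family[OF P(1)] Vsub_mono[OF n] by (meson subsetD)
  qed
  then obtain F1 where F1: "F1 \<in> Vsub S T D" "\<forall>\<pi>\<in>prime_factors F0. \<not> \<pi> dvd F1"
    using avoid_primes[of "prime_factors F0" S T D] by auto
  have "coprime F0 F1"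
  proof (rule ccontr)
    assume "\<not> coprime F0 F1"
    then have "\<not> is_unit (gcd F0 F1)" "gcd F0 F1 \<noteq> 0" using F00 by (auto simp: coprime_iff_gcd_eq_1)
    then obtain \<pi> where "prime \<pi>" "\<pi> dvd gcd F0 F1" using prime_divisor_exists by blast
    then show False using F1(2) F00 by (auto simp: in_prime_factors_iff)
  qed
  then show ?thesis using that F0 F1(1) topF0 by blast
qed

section \<open>Forms in three variables\<close>

lemma exhaust3: "(x :: 3) = 0 \<or> x = 1 \<or> x = 2"
proof (induct x)
  case (of_int z)
  then have "0 \<le> z" "z < 3" by simp_all
  then have "z = 0 \<or> z = 1 \<or> z = 2" by arith
  then show ?case by auto
qed

lemma UNIV3: "(UNIV :: 3 set) = {0, 1, 2}"
  using exhaust3 by auto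

lemma distinct3 [simp]: "(1 :: 3) \<noteq> 2" "(2 :: 3) \<noteq> 1" "(0 :: 3) \<noteq> 2" "(2 :: 3) \<noteq> 0"
  by (simp_all add: eq_commute)

abbreviation aff3 :: "'a::one \<Rightarrow> 'a \<Rightarrow> 3 \<Rightarrow> 'a" where
  "aff3 X Y \<equiv> (\<lambda>i. if i = 0 then 1 else if i = 1 then X else Y)"

definition delta :: "cpoly3 \<Rightarrow> complex poly poly" where
  "delta = mev cc (aff3 px py)"

lemma comm_ring_hom_delta: "comm_ring_hom delta"
  unfolding delta_def by (rule comm_ring_hom.comm_ring_hom_mev[OF comm_ring_hom_cc])

lemma delta_mult: "delta (P * Q) = delta P * delta Q"
  and delta_add: "delta (P + Q) = delta P + delta Q"
proof -
  interpret comm_ring_hom delta by (rule comm_ring_hom_delta)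
  show "delta (P * Q) = delta P * delta Q" "delta (P + Q) = delta P + delta Q"
    by (rule hom_mult hom_add)+
qed

lemma bev_delta:
  assumes "comm_ring_hom \<iota>"
  shows "bev \<iota> X Y (delta P) = mev \<iota> (aff3 X Y) P"
proof -
  interpret comm_ring_hom "bev \<iota> X Y" by (rule comm_ring_hom_bev[OF assms])
  have 1: "bev \<iota> X Y 1 = 1" by simp
  have 2: "(\<lambda>x. bev \<iota> X Y (aff3 px py x)) = aff3 X Y"
  proof
    fix x :: 3
    show "bev \<iota> X Y (aff3 px py x) = aff3 X Y x"
      using 1 bev_gens(2,3)[OF assms, of X Y] by presburger
  qed
  have "bev \<iota> X Y (delta P) = mev (\<lambda>c. bev \<iota> X Y (cc c)) (\<lambda>x. bev \<iota> X Y (aff3 px py x)) P"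
    unfolding delta_def by (rule hom_mev)
  then show ?thesis unfolding 2 bev_gens(1)[OF assms] .
qed

lemma prod_keys3:
  fixes u :: "3 \<Rightarrow> 'a::comm_semiring_1"
  shows "mmon u m = u 0 ^ Poly_Mapping.lookup m 0 * u 1 ^ Poly_Mapping.lookup m 1 * u 2 ^ Poly_Mapping.lookup m 2"
proof -
  have "mmon u m = (\<Prod>x\<in>{0, 1, 2}. u x ^ Poly_Mapping.lookup m x)"
    by (rule mmon_superset) (metis finite_code UNIV3, metis UNIV3 subset_UNIV)
  also have "\<dots> = u 0 ^ Poly_Mapping.lookup m 0 * (u 1 ^ Poly_Mapping.lookup m 1 * u 2 ^ Poly_Mapping.lookup m 2)"
    by (subst prod.insert, simp, simp)+ simp
  finally show ?thesis by (simp only: mult.assoc)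
qed

lemma delta_single:
  "delta (Poly_Mapping.single m c) = monom (monom c (Poly_Mapping.lookup m 1)) (Poly_Mapping.lookup m 2)"
proof -
  have 1: "px ^ j = [:monom 1 j:]" for j
    by (simp add: poly_const_pow monom_altdef)
  have 2: "py ^ k = monom 1 k" for k
    by (simp add: monom_altdef)
  show ?thesis
    unfolding delta_def by (simp add: mev_single prod_keys3 1 2 smult_monom)
qed

text \<open>The monomial of degree \<open>n\<close> with affine exponents \<open>j\<close> and
  \<open>k\<close>; the truncated subtraction is exact when \<open>j + k \<le> n\<close>.\<close>

definition m3 :: "nat \<Rightarrow> nat \<Rightarrow> nat \<Rightarrow> 3 \<Rightarrow>\<^sub>0 nat" where
  "m3 n j k = Poly_Mapping.single 0 (n - j - k) + Poly_Mapping.single 1 j + Poly_Mapping.single 2 k"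

lemma lookup_m3 [simp]:
  "Poly_Mapping.lookup (m3 n j k) 0 = n - j - k"
  "Poly_Mapping.lookup (m3 n j k) 1 = j"
  "Poly_Mapping.lookup (m3 n j k) 2 = k"
  by (simp_all add: m3_def lookup_add lookup_single)

lemma monomials_of_degree_iff: "m \<in> monomials_of_degree n \<longleftrightarrow>
    Poly_Mapping.lookup m 0 + Poly_Mapping.lookup m 1 + Poly_Mapping.lookup m 2 = n"
proof -
  have "(\<Sum>i\<in>UNIV. Poly_Mapping.lookup m i) =
      Poly_Mapping.lookup m 0 + (Poly_Mapping.lookup m 1 + Poly_Mapping.lookup m 2)"
    unfolding UNIV3 by (subst sum.insert, simp, simp)+ simp
  then show ?thesis unfolding monomials_of_degree_def by (simp add: add.assoc)
qed

lemma m3_in: "j + k \<le> n \<Longrightarrow> m3 n j k \<in> monomials_of_degree n"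
  by (simp add: monomials_of_degree_iff)

lemma eq_m3_iff:
  assumes "m \<in> monomials_of_degree n" "j + k \<le> n"
  shows "m = m3 n j k \<longleftrightarrow> Poly_Mapping.lookup m 1 = j \<and> Poly_Mapping.lookup m 2 = k"
proof
  assume *: "Poly_Mapping.lookup m 1 = j \<and> Poly_Mapping.lookup m 2 = k"
  show "m = m3 n j k"
  proof (rule poly_mapping_eqI)
    fix x :: 3
    show "Poly_Mapping.lookup m x = Poly_Mapping.lookup (m3 n j k) x"
      using exhaust3[of x] * assms(1) by (auto simp: monomials_of_degree_iff)
  qed
qed simp

lemma coeff_delta:
  assumes P: "P \<in> forms n"
  shows "coeff (coeff (delta P) k) j = (if j + k \<le> n then Poly_Mapping.lookup P (m3 n j k) else 0)"
proof -
  interpret comm_ring_hom delta by (rule comm_ring_hom_delta)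
  have sub: "Poly_Mapping.keys P \<subseteq> monomials_of_degree n" using P by (simp add: forms_def)
  have "delta P = (\<Sum>m\<in>Poly_Mapping.keys P. delta (Poly_Mapping.single m (Poly_Mapping.lookup P m)))"
    by (subst poly_mapping_sum_single[of P]) (rule hom_sum)
  then have "coeff (coeff (delta P) k) j = (\<Sum>m\<in>Poly_Mapping.keys P.
      if Poly_Mapping.lookup m 1 = j \<and> Poly_Mapping.lookup m 2 = k then Poly_Mapping.lookup P m else 0)"
    by (simp add: coeff_sum delta_single) (intro sum.cong, auto)
  also have "\<dots> = (if j + k \<le> n then Poly_Mapping.lookup P (m3 n j k) else 0)"
  proof (cases "j + k \<le> n")
    case True
    have "(\<Sum>m\<in>Poly_Mapping.keys P.
        if Poly_Mapping.lookup m 1 = j \<and> Poly_Mapping.lookup m 2 = k then Poly_Mapping.lookup P m else 0)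
      = (\<Sum>m\<in>Poly_Mapping.keys P. if m = m3 n j k then Poly_Mapping.lookup P m else 0)"
      by (rule sum.cong[OF refl]) (use sub True in \<open>simp add: eq_m3_iff subset_iff\<close>)
    then show ?thesis using True by (simp add: in_keys_iff)
  next
    case False
    have "\<not> (Poly_Mapping.lookup m 1 = j \<and> Poly_Mapping.lookup m 2 = k)"
      if "m \<in> Poly_Mapping.keys P" for m
      using that sub False by (auto simp: monomials_of_degree_iff subset_iff)
    then show ?thesis using False by (intro trans[OF sum.neutral]) auto
  qed
  finally show ?thesis .
qed

lemma delta_V: "P \<in> forms n \<Longrightarrow> delta P \<in> V n"
  by (rule VI) (simp add: coeff_delta)

lemma forms_eqI:
  assumes "P \<in> forms n" "Q \<in> forms n" "delta P = delta Q"
  shows "P = Q"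
proof (rule poly_mapping_eqI)
  fix m
  show "Poly_Mapping.lookup P m = Poly_Mapping.lookup Q m"
  proof (cases "m \<in> monomials_of_degree n")
    case True
    let ?j = "Poly_Mapping.lookup m 1" and ?k = "Poly_Mapping.lookup m 2"
    have jk: "?j + ?k \<le> n" using True by (simp add: monomials_of_degree_iff)
    then have "m = m3 n ?j ?k" using True by (simp add: eq_m3_iff)
    then show ?thesis
      using coeff_delta[OF assms(1), of ?k ?j] coeff_delta[OF assms(2), of ?k ?j] assms(3) jk by simp
  next
    case False
    then have "m \<notin> Poly_Mapping.keys P" "m \<notin> Poly_Mapping.keys Q"
      using assms(1,2) by (auto simp: forms_def)
    then show ?thesis by (simp add: in_keys_iff)
  qed
qed

lemma forms_add: "P \<in> forms n \<Longrightarrow> Q \<in> forms n \<Longrightarrow> P + Q \<in> forms n"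
  using Poly_Mapping.keys_add[of P Q] by (auto simp: forms_def)

lemma forms_0 [simp]: "0 \<in> forms n"
  by (simp add: forms_def)

lemma forms_sum: "(\<And>i. i \<in> A \<Longrightarrow> f i \<in> forms n) \<Longrightarrow> sum f A \<in> forms n"
  by (induction A rule: infinite_finite_induct) (auto intro: forms_add)

lemma forms_mult: "P \<in> forms m \<Longrightarrow> Q \<in> forms n \<Longrightarrow> P * Q \<in> forms (m + n)"
proof -
  assume P: "P \<in> forms m" and Q: "Q \<in> forms n"
  have "Poly_Mapping.keys (P * Q) \<subseteq> {a + b | a b. a \<in> Poly_Mapping.keys P \<and> b \<in> Poly_Mapping.keys Q}"
    by (rule Poly_Mapping.keys_mult)
  also have "\<dots> \<subseteq> monomials_of_degree (m + n)"
  proof clarify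
    fix a b assume "a \<in> Poly_Mapping.keys P" "b \<in> Poly_Mapping.keys Q"
    then have "a \<in> monomials_of_degree m" "b \<in> monomials_of_degree n"
      using P Q by (auto simp: forms_def)
    then show "a + b \<in> monomials_of_degree (m + n)"
      by (simp add: monomials_of_degree_iff lookup_add)
  qed
  finally show ?thesis by (simp add: forms_def)
qed

lemma forms_const: "Poly_Mapping.single 0 c \<in> forms 0"
  by (auto simp: forms_def monomials_of_degree_iff)

lemma forms_scale: "P \<in> forms n \<Longrightarrow> Poly_Mapping.single 0 c * P \<in> forms n"
  using forms_mult[OF forms_const] by simp

lemma forms_indet: "indet i \<in> forms 1"
  using exhaust3[of i] by (auto simp: forms_def indet_def monomials_of_degree_iff lookup_single)

lemma lookup_scale: "Poly_Mapping.lookup (Poly_Mapping.single 0 c * P) m = c * Poly_Mapping.lookup P m"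
  by (simp add: mult_map_scale_conv_mult[symmetric] Poly_Mapping.map.rep_eq when_def)

lemma delta_scale: "delta (Poly_Mapping.single 0 c * P) = cc c * delta P"
  by (simp add: delta_mult delta_single monom_0)

section \<open>Homogenisation, the derivation and the ideal\<close>

definition homog :: "nat \<Rightarrow> complex poly poly \<Rightarrow> cpoly3" where
  "homog n p = (\<Sum>(j, k)\<in>pairs n. Poly_Mapping.single (m3 n j k) (coeff (coeff p k) j))"

lemma homog_forms: "homog n p \<in> forms n"
  unfolding homog_def
  by (rule forms_sum) (auto simp: forms_def pairs_def m3_in split: if_splits)

lemma delta_homog:
  assumes "p \<in> V n"
  shows "delta (homog n p) = p"
proof -
  interpret comm_ring_hom delta by (rule comm_ring_hom_delta)
  have "delta (homog n p) = (\<Sum>i\<in>pairs n. monom (monom (coeff (coeff p (snd i)) (fst i)) (fst i)) (snd i))"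
    unfolding homog_def hom_sum by (intro sum.cong refl) (auto simp: delta_single)
  also have "\<dots> = p"
  proof (intro poly_eqI)
    fix k j
    have "coeff (coeff (\<Sum>i\<in>pairs n. monom (monom (coeff (coeff p (snd i)) (fst i)) (fst i)) (snd i)) k) j
        = (\<Sum>i\<in>pairs n. if i = (j, k) then coeff (coeff p k) j else 0)"
      unfolding coeff_sum by (intro sum.cong) (auto simp: prod_eq_iff)
    also have "\<dots> = coeff (coeff p k) j"
      using VD[OF assms, of j k] by (subst sum.delta, simp) (auto simp: pairs_def)
    finally show "coeff (coeff (\<Sum>i\<in>pairs n. monom (monom (coeff (coeff p (snd i)) (fst i)) (fst i)) (snd i)) k) j
        = coeff (coeff p k) j" .
  qed
  finally show ?thesis .
qed

lemma homog_delta: "P \<in> forms n \<Longrightarrow> homog n (delta P) = P"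
  by (rule forms_eqI[OF homog_forms]) (auto intro: delta_homog delta_V)

lemma delta_pdiff_2: "delta (pdiff 2 P) = pderiv (delta P)"
  by (induction P rule: mpoly_induct)
     (simp_all add: pdiff_add delta_add pderiv_add pdiff_single delta_single lookup_minus lookup_single
        pderiv_monom of_nat_poly smult_monom)

lemma delta_pdiff_1: "delta (pdiff 1 P) = map_poly pderiv (delta P)"
proof (induction P rule: mpoly_induct)
  case (single m c)
  have "map_poly pderiv (monom q k) = monom (pderiv q) k" for q :: "complex poly" and k
    by (rule poly_eqI) (simp add: coeff_map_poly)
  then show ?case
    by (simp add: pdiff_single delta_single lookup_minus lookup_single pderiv_monom)
next
  case (add p q)
  have "map_poly pderiv (a + b) = map_poly pderiv a + map_poly pderiv b" for a b :: "complex poly poly"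
    by (rule poly_eqI) (simp add: coeff_map_poly pderiv_add)
  then show ?case using add by (simp add: pdiff_add delta_add)
qed

lemma delta_deriv_D: "delta (deriv_D P) = dv (delta P)"
proof -
  have i: "delta (indet 0) = 1" "delta (indet 2) = py"
    unfolding delta_def by (simp_all add: comm_ring_hom.mev_indet[OF comm_ring_hom_cc])
  show ?thesis
    by (simp add: deriv_D_def dv_def delta_add delta_mult i delta_pdiff_1 delta_pdiff_2)
qed

lemma delta_deriv_D_iter: "delta ((deriv_D ^^ i) P) = (dv ^^ i) (delta P)"
  by (induction i) (auto simp: delta_deriv_D)

lemma comm_ring_hom_fps_nth_0: "comm_ring_hom (\<lambda>f. fps_nth f 0 :: complex)"
  by unfold_locales (auto simp: fps_mult_nth)

lemma mpoly_eval_affine_point: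
  "mpoly_eval (affine_point \<gamma>) P = fps_nth (theta \<gamma> (delta P)) 0"
proof -
  have 1: "theta \<gamma> (delta P) = mev fps_const (aff3 (fps_const (fst \<gamma>) + fps_X) (fps_const (snd \<gamma>) * fps_exp 1)) P"
    unfolding theta_def by (rule bev_delta[OF comm_ring_hom_fps_const])
  have "(\<lambda>x. fps_nth (aff3 (fps_const (fst \<gamma>) + fps_X) (fps_const (snd \<gamma>) * fps_exp 1) x) 0) = affine_point \<gamma>"
    by (rule ext) (simp add: affine_point_def)
  then show ?thesis
    unfolding 1 comm_ring_hom.hom_mev[OF comm_ring_hom_fps_nth_0] mpoly_eval_eq_mev by simp
qed

lemma fps_nth_deriv_iter:
  "fps_nth ((fps_deriv ^^ i) f) n = fact (n + i) / fact n * (fps_nth f (n + i) :: complex)"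
proof (induction i arbitrary: n)
  case (Suc i)
  have "fps_nth ((fps_deriv ^^ Suc i) f) n = of_nat (n + 1) * fps_nth ((fps_deriv ^^ i) f) (Suc n)"
    by simp
  also have "\<dots> = of_nat (n + 1) * (fact (Suc n + i) / fact (Suc n) * fps_nth f (Suc n + i))"
    by (simp only: Suc.IH)
  also have "\<dots> = fact (n + Suc i) / fact n * fps_nth f (n + Suc i)"
  proof -
    have "(fact (Suc n) :: complex) = of_nat (Suc n) * fact n" by (rule fact_Suc)
    moreover have "(of_nat (Suc n) :: complex) \<noteq> 0" by (rule of_nat_neq_0)
    ultimately show ?thesis by (simp add: field_simps del: of_nat_Suc fact_Suc)
  qed
  finally show ?case .
qed simp

lemma eval_deriv_D_iter_eq_0_iff:
  "mpoly_eval (affine_point \<gamma>) ((deriv_D ^^ i) P) = 0 \<longleftrightarrow> fps_nth (theta \<gamma> (delta P)) i = 0"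
  by (simp add: mpoly_eval_affine_point delta_deriv_D_iter theta_dv_iter fps_nth_deriv_iter)

text \<open>Power series of order at least \<open>T\<close> form an ideal, so the polynomials whose
  restrictions to the orbits have that order do too. The conditions therefore pass from the
  generators to all of \<open>ideal_I\<close>.\<close>

lemma delta_ideal_I:
  assumes "P \<in> ideal_I S T" "P \<in> forms n"
  shows "delta P \<in> Vsub S T n"
proof -
  interpret m: Modules.module "(*) :: cpoly3 \<Rightarrow> _" by (rule module_mult)
  let ?Z = "{Q. \<forall>\<gamma>\<in>S. \<forall>i<T. fps_nth (theta \<gamma> (delta Q)) i = 0}"
  have z: "theta \<gamma> (delta 0) = 0" for \<gamma>
    using theta_cc[of \<gamma> 0] by (simp add: delta_def)
  have "m.subspace ?Z"
  proof (rule m.subspaceI)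
    show "0 \<in> ?Z" by (simp add: z)
    show "P + Q \<in> ?Z" if "P \<in> ?Z" "Q \<in> ?Z" for P Q
      using that by (simp add: delta_add theta_add)
    show "c * Q \<in> ?Z" if "Q \<in> ?Z" for c Q
    proof (intro CollectI ballI allI impI)
      fix \<gamma> i assume "\<gamma> \<in> S" "i < T"
      then have "fps_nth (theta \<gamma> (delta Q) * theta \<gamma> (delta c)) i = 0"
        using that by (intro fps_mult_nth_low[of T]) auto
      then show "fps_nth (theta \<gamma> (delta (c * Q))) i = 0"
        by (simp only: delta_mult theta_mult mult.commute)
    qed
  qed
  then have "ideal_I S T \<subseteq> ?Z"
    unfolding ideal_I_def ideal_generated_def
    by (intro m.span_minimal) (auto simp: eval_deriv_D_iter_eq_0_iff)
  then show ?thesis using assms delta_V by (auto simp: Vsub_def)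
qed

text \<open>The configuration with as many distinct intersection points as Bezout allows: the grid
  \<open>(1 : i : j)\<close> with \<open>i, j < D\<close>, which a pencil of curves of degree \<open>D\<close> meets at \<open>D\<^sup>2\<close> different parameters.\<close>

definition grid_triple :: "nat \<Rightarrow> 3 \<Rightarrow> cpoly3" where
  "grid_triple D = (\<lambda>j. if j = 0 then \<Prod>i<D. (indet 1 + Poly_Mapping.single 0 (- of_nat i) * indet 0)
     else if j = 1 then \<Prod>i<D. (indet 2 + Poly_Mapping.single 0 (- of_nat i) * indet 0)
     else indet 0 ^ (D - 1) * (indet 1 + Poly_Mapping.single 0 (of_nat D) * indet 2))"

lemma forms_prod: "(\<And>i. i < (k::nat) \<Longrightarrow> f i \<in> forms 1) \<Longrightarrow> (\<Prod>i<k. f i) \<in> forms k"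
proof (induction k)
  case 0
  have "(1 :: cpoly3) = Poly_Mapping.single 0 1" by simp
  then show ?case using forms_const[of 1] by (metis lessThan_0 prod.empty)
next
  case (Suc k)
  have "(\<Prod>i<k. f i) * f k \<in> forms (k + 1)" using Suc by (intro forms_mult) auto
  then show ?case by simp
qed

lemma forms_indet_power: "indet i ^ k \<in> forms k"
  using forms_prod[of k "\<lambda>_. indet i"] forms_indet by simp

lemma grid_triple_forms:
  assumes "D > 0"
  shows "grid_triple D j \<in> forms D"
proof -
  have 1: "indet 1 + Poly_Mapping.single 0 c * indet 2 \<in> forms 1" for c
    by (intro forms_add forms_scale forms_indet)
  have "indet 0 ^ (D - 1) * (indet 1 + Poly_Mapping.single 0 (of_nat D) * indet 2) \<in> forms (D - 1 + 1)"
    by (intro forms_mult forms_indet_power 1)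
  moreover have "D - 1 + 1 = D" using assms by simp
  ultimately have 2: "indet 0 ^ (D - 1) * (indet 1 + Poly_Mapping.single 0 (of_nat D) * indet 2) \<in> forms D"
    by (simp only:)
  have 3: "(\<Prod>i<D. (indet k + Poly_Mapping.single 0 (- of_nat i) * indet 0)) \<in> forms D" for k
    by (intro forms_prod forms_add forms_scale forms_indet)
  show ?thesis
    unfolding grid_triple_def using 2 3 by presburger
qed

lemma comm_ring_hom_mpoly_eval: "comm_ring_hom (mpoly_eval (u :: 'v \<Rightarrow> complex))"
proof -
  have "mpoly_eval u = mev (\<lambda>c. c) u" by (rule ext) (rule mpoly_eval_eq_mev)
  then show ?thesis using comm_ring_hom.comm_ring_hom_mev[OF comm_ring_hom_id, of u] by metis
qed

lemma mpoly_eval_hom: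
  fixes u :: "'v \<Rightarrow> complex"
  shows "mpoly_eval u (P * Q) = mpoly_eval u P * mpoly_eval u Q"
    and "mpoly_eval u (P + Q) = mpoly_eval u P + mpoly_eval u Q"
    and "mpoly_eval u (indet x) = u x"
    and "mpoly_eval u (Poly_Mapping.single 0 c) = c"
    and "mpoly_eval u (P ^ n) = mpoly_eval u P ^ n"
    and "mpoly_eval u (prod f A) = (\<Prod>i\<in>A. mpoly_eval u (f i))"
proof -
  interpret m: comm_ring_hom "mpoly_eval u" by (rule comm_ring_hom_mpoly_eval)
  show "mpoly_eval u (P * Q) = mpoly_eval u P * mpoly_eval u Q" by (rule m.hom_mult)
  show "mpoly_eval u (P + Q) = mpoly_eval u P + mpoly_eval u Q" by (rule m.hom_add)
  show "mpoly_eval u (P ^ n) = mpoly_eval u P ^ n" by (rule m.hom_power)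
  show "mpoly_eval u (prod f A) = (\<Prod>i\<in>A. mpoly_eval u (f i))" by (rule m.hom_prod)
next
  show "mpoly_eval u (indet x) = u x"
    unfolding mpoly_eval_eq_mev by (rule comm_ring_hom.mev_indet[OF comm_ring_hom_id])
  show "mpoly_eval u (Poly_Mapping.single 0 c) = c"
    unfolding mpoly_eval_eq_mev by (subst mev_single) simp_all
qed

text \<open>Only the third form moves. At (1 : i : j) its value is i + D j + t: the factor
  \<open>D\<close> in \<open>grid_triple\<close> turns i and j into digits to base \<open>D\<close>,
  so different grid points become common zeros at different t.\<close>

definition grid_pencil :: "nat \<Rightarrow> complex \<Rightarrow> 3 \<Rightarrow> cpoly3" where
  "grid_pencil D t = (\<lambda>j. grid_triple D j + (if j = 2 then Poly_Mapping.single 0 t * indet 0 ^ D else 0))"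

lemma grid_pencil_zero_iff:
  assumes "D > 0"
  shows "common_projective_zero (grid_pencil D t) \<longleftrightarrow>
    t \<in> (\<lambda>(i, j). - of_nat (i + D * j)) ` ({..<D} \<times> {..<D})"
proof -
  have e0: "mpoly_eval z (grid_pencil D t 0) = (\<Prod>i<D. (z 1 - of_nat i * z 0))" for z
    by (simp add: grid_pencil_def grid_triple_def mpoly_eval_hom)
  have e1: "mpoly_eval z (grid_pencil D t 1) = (\<Prod>i<D. (z 2 - of_nat i * z 0))" for z
    by (simp add: grid_pencil_def grid_triple_def mpoly_eval_hom)
  have "mpoly_eval z (of_nat D) = of_nat D" for z :: "3 \<Rightarrow> complex"
    by (metis mpoly_eval_hom(4) single_of_nat)
  then have e2: "mpoly_eval z (grid_pencil D t 2) = z 0 ^ (D - 1) * (z 1 + of_nat D * z 2) + t * z 0 ^ D" for z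
    by (simp add: grid_pencil_def grid_triple_def mpoly_eval_hom)
  show ?thesis
  proof
    assume "common_projective_zero (grid_pencil D t)"
    then obtain z where z: "\<exists>i. z i \<noteq> 0" "\<And>j. mpoly_eval z (grid_pencil D t j) = 0"
      unfolding common_projective_zero_def by blast
    from z(2)[of 0] obtain i where i: "i < D" "z 1 = of_nat i * z 0" unfolding e0 by auto
    from z(2)[of 1] obtain j where j: "j < D" "z 2 = of_nat j * z 0" unfolding e1 by auto
    \<comment> \<open>On the line at infinity the first two forms become powers of X_1 and X_2,
      which have no common zero there.\<close>
    have z0: "z 0 \<noteq> 0"
    proof
      assume "z 0 = 0"
      then have "z 0 = 0" "z 1 = 0" "z 2 = 0" using i j by auto
      then have "z x = 0" for x using exhaust3[of x] by auto
      then show False using z(1) by auto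
    qed
    have p: "z 0 ^ D = z 0 ^ (D - 1) * z 0" using assms by (metis power_minus_mult)
    have "0 = z 0 ^ (D - 1) * (z 1 + of_nat D * z 2) + t * z 0 ^ D" using z(2)[of 2] unfolding e2 by simp
    also have "\<dots> = z 0 ^ D * (of_nat i + of_nat D * of_nat j + t)"
      unfolding p i(2) j(2) by (simp add: algebra_simps)
    finally have "of_nat i + of_nat D * of_nat j + t = 0" using z0 by simp
    then have "t = - of_nat (i + D * j)" by (simp add: add_eq_0_iff2 eq_neg_iff_add_eq_0 add.commute)
    then show "t \<in> (\<lambda>(i, j). - of_nat (i + D * j)) ` ({..<D} \<times> {..<D})" using i j by force
  next
    assume "t \<in> (\<lambda>(i, j). - of_nat (i + D * j)) ` ({..<D} \<times> {..<D})"
    then obtain i j where ij: "i < D" "j < D" "t = - of_nat (i + D * j)" by auto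
    define z :: "3 \<Rightarrow> complex" where "z = aff3 (of_nat i) (of_nat j)"
    have zv: "z 0 = 1" "z 1 = of_nat i" "z 2 = of_nat j" by (simp_all add: z_def)
    have "mpoly_eval z (grid_pencil D t 0) = 0" using ij unfolding e0 zv by auto
    moreover have "mpoly_eval z (grid_pencil D t 1) = 0" using ij unfolding e1 zv by auto
    moreover have "mpoly_eval z (grid_pencil D t 2) = 0" unfolding e2 zv unfolding ij(3) by simp
    ultimately have "mpoly_eval z (grid_pencil D t x) = 0" for x
      using exhaust3[of x] by metis
    moreover have "z 0 \<noteq> 0" by (simp add: zv)
    ultimately show "common_projective_zero (grid_pencil D t)"
      unfolding common_projective_zero_def by blast
  qed
qed

lemma card_grid_parameters:
  "card ((\<lambda>(i, j). - of_nat (i + D * j) :: complex) ` ({..<D} \<times> {..<D})) = D * D"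
proof -
  have "inj_on (\<lambda>(i, j). - of_nat (i + D * j) :: complex) ({..<D} \<times> {..<D})"
  proof (rule inj_onI, clarsimp simp del: of_nat_add of_nat_mult)
    fix i j i' j' assume b: "i < D" "i' < D" and e: "i + D * j = i' + D * j'"
    have "(i + D * j) mod D = (i' + D * j') mod D" using e by simp
    then have "i = i'" using b by simp
    then show "i = i' \<and> j = j'" using e b by simp
  qed
  then show ?thesis by (simp add: card_image card_cartesian_product)
qed

section \<open>Bases consisting of multiples of three polynomials\<close>

abbreviation sc :: "complex \<Rightarrow> complex poly poly \<Rightarrow> complex poly poly" where
  "sc c p \<equiv> smult [:c:] p"

interpretation vs: vector_space sc
  by unfold_locales (simp_all add: smult_add_right smult_add_left[symmetric] one_pCons[symmetric] mult.commute)

lemma V_sc: "p \<in> V n \<Longrightarrow> sc c p \<in> V n"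
  using V_mult[OF V_cc[of c 0], of p n] by simp

lemma subspace_V: "vs.subspace (V n)"
  unfolding vs.subspace_def by (auto intro: V_add V_sc)

definition mono2 :: "nat \<times> nat \<Rightarrow> complex poly poly" where
  "mono2 i = monom (monom 1 (fst i)) (snd i)"

lemma mono2_V: "i \<in> pairs n \<Longrightarrow> mono2 i \<in> V n"
  by (rule VI) (auto simp: mono2_def pairs_def)

lemma coeff_sum_mono2:
  assumes "finite J"
  shows "coeff (coeff (\<Sum>i\<in>J. sc (x i) (mono2 i)) k) j = (if (j, k) \<in> J then x (j, k) else 0)"
proof -
  have "coeff (coeff (\<Sum>i\<in>J. sc (x i) (mono2 i)) k) j = (\<Sum>i\<in>J. if i = (j, k) then x i else 0)"
    unfolding coeff_sum by (intro sum.cong) (auto simp: mono2_def prod_eq_iff)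
  then show ?thesis using assms by simp
qed

lemma V_expand:
  assumes "p \<in> V n"
  shows "p = (\<Sum>i\<in>pairs n. sc (coeff (coeff p (snd i)) (fst i)) (mono2 i))"
proof (intro poly_eqI)
  fix k j
  show "coeff (coeff p k) j = coeff (coeff (\<Sum>i\<in>pairs n. sc (coeff (coeff p (snd i)) (fst i)) (mono2 i)) k) j"
    using VD[OF assms, of j k] by (subst coeff_sum_mono2, simp) (auto simp: pairs_def)
qed

text \<open>Stated for indexed families so that a repeated member is a dependence, as it is for the
  columns of a determinant; the set of values would not show it.\<close>

definition fam_indep :: "'i set \<Rightarrow> ('i \<Rightarrow> complex poly poly) \<Rightarrow> bool" where
  "fam_indep J v \<longleftrightarrow> (\<forall>x. (\<Sum>j\<in>J. sc (x j) (v j)) = 0 \<longrightarrow> (\<forall>j\<in>J. x j = 0))"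

lemma fam_indepD: "fam_indep J v \<Longrightarrow> (\<Sum>j\<in>J. sc (x j) (v j)) = 0 \<Longrightarrow> j \<in> J \<Longrightarrow> x j = 0"
  unfolding fam_indep_def by blast

lemma fam_indep_inj:
  assumes "finite J" "fam_indep J v"
  shows "inj_on v J"
proof (rule inj_onI, rule ccontr)
  fix a b assume ab: "a \<in> J" "b \<in> J" "v a = v b" "a \<noteq> b"
  let ?x = "\<lambda>j. if j = a then 1 else if j = b then - 1 else 0 :: complex"
  have "(\<Sum>j\<in>J. sc (?x j) (v j)) = (\<Sum>j\<in>{a, b}. sc (?x j) (v j))"
    using ab assms by (intro sum.mono_neutral_right) auto
  also have "\<dots> = v a - v b" using ab by (simp add: one_pCons[symmetric])
  finally have "(\<Sum>j\<in>J. sc (?x j) (v j)) = 0" using ab by simp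
  then have "?x a = 0" by (rule fam_indepD[OF assms(2), of ?x a]) (rule ab(1))
  then show False by simp
qed

lemma fam_indep_independent:
  assumes "finite J" "fam_indep J v"
  shows "vs.independent (v ` J)"
proof
  assume "vs.dependent (v ` J)"
  then obtain u where u: "\<exists>w\<in>v ` J. u w \<noteq> 0" "(\<Sum>w\<in>v ` J. sc (u w) w) = 0"
    using vs.dependent_finite[of "v ` J"] assms(1) by auto
  from u(2) have "(\<Sum>j\<in>J. sc (u (v j)) (v j)) = 0"
    by (simp add: sum.reindex[OF fam_indep_inj[OF assms]])
  then show False using fam_indepD[OF assms(2), of "\<lambda>j. u (v j)"] u(1) by auto
qed

lemma independent_fam_indep:
  assumes "finite J" "inj_on v J" "vs.independent (v ` J)"
  shows "fam_indep J v"
  unfolding fam_indep_def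
proof (intro allI impI ballI)
  fix x j assume s: "(\<Sum>j\<in>J. sc (x j) (v j)) = 0" and j: "j \<in> J"
  let ?u = "\<lambda>w. x (the_inv_into J v w)"
  have "(\<Sum>w\<in>v ` J. sc (?u w) w) = (\<Sum>j\<in>J. sc (x j) (v j))"
    by (simp add: sum.reindex[OF assms(2)] the_inv_into_f_f[OF assms(2)])
  then have "\<forall>w\<in>v ` J. ?u w = 0"
    using s assms(1,3) vs.dependent_finite[of "v ` J"] by auto
  then have "?u (v j) = 0" using j by blast
  then show "x j = 0" using j by (simp add: the_inv_into_f_f[OF assms(2)])
qed

lemma fam_indep_mono2: "finite J \<Longrightarrow> fam_indep J mono2"
  unfolding fam_indep_def
proof (intro allI impI ballI)
  fix x :: "nat \<times> nat \<Rightarrow> complex" and i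
  assume "finite J" "(\<Sum>j\<in>J. sc (x j) (mono2 j)) = 0" "i \<in> J"
  then show "x i = 0" using coeff_sum_mono2[of J x "snd i" "fst i"] by simp
qed

lemma span_mono2: "V n \<subseteq> vs.span (mono2 ` pairs n)"
proof
  fix p assume "p \<in> V n"
  then show "p \<in> vs.span (mono2 ` pairs n)"
    by (subst V_expand) (auto intro!: vs.span_sum vs.span_scale intro: vs.span_base)
qed

lemma card_basis_V:
  assumes "B \<subseteq> V n" "V n \<subseteq> vs.span B" "vs.independent B"
  shows "finite B" "card B = card (pairs n)"
proof -
  have fi: "fam_indep (pairs n) mono2" by (rule fam_indep_mono2) simp
  have "B \<subseteq> vs.span (mono2 ` pairs n)" using assms(1) span_mono2 by blast
  then show "finite B" using vs.independent_span_bound[OF _ assms(3), of "mono2 ` pairs n"] by simp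
  have "card B = vs.dim (V n)" using assms by (rule vs.basis_card_eq_dim)
  also have "\<dots> = card (mono2 ` pairs n)"
    by (rule vs.basis_card_eq_dim[symmetric])
       (use fam_indep_independent[OF _ fi] in \<open>auto simp: mono2_V span_mono2\<close>)
  also have "\<dots> = card (pairs n)" by (rule card_image[OF fam_indep_inj[OF _ fi]]) simp
  finally show "card B = card (pairs n)" .
qed

section \<open>Division with remainder by two coprime polynomials\<close>

lemma ev_in_lift: "ev_in a (map_poly (\<lambda>c. [:c:]) \<alpha>) = \<alpha>"
  by (rule poly_eqI) (simp add: coeff_map_poly)

lemma V_lift: "degree \<alpha> \<le> n \<Longrightarrow> map_poly (\<lambda>c. [:c:]) \<alpha> \<in> V n"
  by (rule VI) (auto simp: coeff_map_poly coeff_pCons coeff_eq_0 split: nat.splits)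

lemma V_dividend:
  assumes r: "r \<in> V \<mu>" and z: "ev_in a r = 0"
  obtains q where "q \<in> V (\<mu> - 1)" "r = [:[:- a, 1:]:] * q"
proof -
  have "[:- a, 1:] dvd coeff r k" for k
    using arg_cong[OF z, of "\<lambda>p. coeff p k"] by (simp add: coeff_ev_in poly_eq_0_iff_dvd)
  then have "[:[:- a, 1:]:] dvd r" by (simp add: const_poly_dvd_iff)
  then obtain q where q: "r = [:[:- a, 1:]:] * q" by auto
  have "q \<in> V (\<mu> - 1)"
  proof (rule VI, rule ccontr)
    fix j k assume jk: "j + k > \<mu> - 1" and nz: "coeff (coeff q k) j \<noteq> 0"
    then have q0: "coeff q k \<noteq> 0" by auto
    have cr: "coeff r k = [:- a, 1:] * coeff q k" unfolding q by simp
    have "coeff r k \<noteq> 0" unfolding cr using q0 by (simp only: mult_eq_0_iff pCons_eq_0_iff) simp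
    then have "degree (coeff r k) + k \<le> \<mu>" by (rule V_degree_coeff[OF r])
    moreover have "degree (coeff r k) = 1 + degree (coeff q k)"
      unfolding cr using q0 by (subst degree_mult_eq) auto
    moreover have "j \<le> degree (coeff q k)" using nz by (rule le_degree)
    ultimately show False using jk by simp
  qed
  then show ?thesis using q that by blast
qed

text \<open>At x = a the Bezout identity makes \<open>G0\<close> and \<open>G1\<close> coprime in y,
  so \<open>q\<close> becomes a combination of them, with the second multiplier reduced modulo the
  first polynomial. The multipliers are lifted as polynomials in y alone; the difference vanishes at
  x = a and is divisible by x - a. The coefficient of y^D in \<open>G0\<close> is a constant by the
  bound on the total degree, so \<open>G0\<close> keeps degree \<open>D\<close> in y at every
  \<open>a\<close>.\<close>

lemma monic_division_step:
  assumes G: "G0 \<in> V D" "G1 \<in> V D" "coeff G0 D \<noteq> 0"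
    and bez: "A * G0 + B * G1 = [:c:]" "poly c a \<noteq> 0"
    and q: "q \<in> V \<mu>" and \<mu>: "2 * D \<le> \<mu> + 1" and D: "D > 0"
  obtains A' B' q' where "q = A' * G0 + B' * G1 + [:[:- a, 1:]:] * q'"
    "A' \<in> V (\<mu> - D)" "B' \<in> V (D - 1)" "degree B' < D" "q' \<in> V (\<mu> - 1)"
proof -
  define p0 where "p0 = ev_in a G0"
  define p1 where "p1 = ev_in a G1"
  have "degree (coeff G0 D) = 0" using V_degree_coeff[OF G(1,3)] by simp
  then obtain e where e: "coeff G0 D = [:e:]" by (metis degree_0_id)
  have "coeff p0 D \<noteq> 0" using e G(3) by (simp add: p0_def coeff_ev_in)
  then have "D \<le> degree p0" by (rule le_degree)
  moreover have "degree p0 \<le> D"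
    unfolding p0_def using degree_map_poly_le V_degree[OF G(1)] le_trans by blast
  ultimately have dp0: "degree p0 = D" by simp
  have dp1: "degree p1 \<le> D"
    unfolding p1_def using degree_map_poly_le V_degree[OF G(2)] le_trans by blast
  have p00: "p0 \<noteq> 0" using \<open>coeff p0 D \<noteq> 0\<close> by auto
  define t where "t = ev_in a q"
  have dt: "degree t \<le> \<mu>"
    unfolding t_def using degree_map_poly_le V_degree[OF q] le_trans by blast
  define \<alpha> where "\<alpha> = smult (1 / poly c a) (t * ev_in a A)"
  define \<beta> where "\<beta> = smult (1 / poly c a) (t * ev_in a B)"
  have "ev_in a A * p0 + ev_in a B * p1 = [:poly c a:]"
    using arg_cong[OF bez(1), of "ev_in a"]
    by (simp add: ev_in_mult ev_in_add p0_def p1_def Polynomial.map_poly_pCons)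
  then have "t * (ev_in a A * p0 + ev_in a B * p1) = smult (poly c a) t" by simp
  then have "smult (1 / poly c a) (t * (ev_in a A * p0 + ev_in a B * p1)) = t"
    using bez(2) by simp
  then have t1: "\<alpha> * p0 + \<beta> * p1 = t"
    unfolding \<alpha>_def \<beta>_def by (simp add: algebra_simps smult_add_right)
  define \<beta>' where "\<beta>' = \<beta> mod p0"
  define \<alpha>' where "\<alpha>' = \<alpha> + \<beta> div p0 * p1"
  have \<beta>: "\<beta> = \<beta> div p0 * p0 + \<beta>'" by (simp add: \<beta>'_def)
  have t2: "t = \<alpha>' * p0 + \<beta>' * p1"
    unfolding t1[symmetric] \<alpha>'_def by (subst \<beta>) (simp add: algebra_simps)
  have d\<beta>: "degree \<beta>' < D"
    using degree_mod_less'[of p0 \<beta>] p00 dp0 D unfolding \<beta>'_def by (cases "\<beta> mod p0 = 0") auto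
  \<comment> \<open>The product with \<open>\<beta>'\<close> has degree at most 2 D - 1, hence the
    assumption \<open>2 * D \<le> \<mu> + 1\<close>.\<close>
  have d\<alpha>: "degree \<alpha>' \<le> \<mu> - D"
  proof (cases "\<alpha>' = 0")
    case False
    have "degree (\<beta>' * p1) \<le> degree \<beta>' + degree p1" by (rule degree_mult_le)
    then have "degree (\<beta>' * p1) \<le> \<mu>" using d\<beta> dp1 \<mu> by linarith
    then have "degree (t - \<beta>' * p1) \<le> \<mu>" using dt by (intro degree_diff_le)
    moreover have "t - \<beta>' * p1 = \<alpha>' * p0" using t2 by simp
    ultimately have "degree (\<alpha>' * p0) \<le> \<mu>" by simp
    then show ?thesis using False p00 dp0 by (simp add: degree_mult_eq)
  qed simp
  define A' where "A' = map_poly (\<lambda>c. [:c:]) \<alpha>'"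
  define B' where "B' = map_poly (\<lambda>c. [:c:]) \<beta>'"
  have VA: "A' \<in> V (\<mu> - D)" unfolding A'_def using d\<alpha> by (rule V_lift)
  have VB: "B' \<in> V (D - 1)" unfolding B'_def using d\<beta> by (intro V_lift) simp
  have dB: "degree B' < D" unfolding B'_def using d\<beta> degree_map_poly_le[of "\<lambda>c. [:c:]" \<beta>'] by simp
  have "A' * G0 \<in> V (\<mu> - D + D)" "B' * G1 \<in> V (D - 1 + D)"
    using VA VB G by (auto intro: V_mult)
  then have V2: "A' * G0 \<in> V \<mu>" "B' * G1 \<in> V \<mu>"
    using \<mu> D by (simp, intro subsetD[OF V_mono[of "D - 1 + D" \<mu>]]) auto
  have V3: "q - (A' * G0 + B' * G1) \<in> V \<mu>"
    by (rule vs.subspace_diff[OF subspace_V q V_add[OF V2]])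
  have e: "q - X = q + smult (- 1) X" for X by simp
  have "ev_in a (q - (A' * G0 + B' * G1)) = 0"
    by (simp only: e ev_in_add ev_in_mult ev_in_smult A'_def B'_def ev_in_lift)
       (simp add: t2[unfolded t_def p0_def p1_def])
  from V_dividend[OF V3 this] obtain q' where "q' \<in> V (\<mu> - 1)" "q - (A' * G0 + B' * G1) = [:[:- a, 1:]:] * q'" .
  then show ?thesis using that[of A' B' q'] VA VB dB by (simp add: algebra_simps)
qed

text \<open>Each step takes a factor x - a out of the remainder and lowers its degree bound by one;
  \<open>3 * D \<le> \<nu>\<close> keeps the degree large enough for \<open>D\<close> steps. At
  \<open>i = D\<close> the remainder is a multiple of (x - a)^D, which can act as a third polynomial
  of degree \<open>D\<close>.\<close>

lemma monic_division:
  assumes G: "G0 \<in> V D" "G1 \<in> V D" "coeff G0 D \<noteq> 0"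
    and bez: "A * G0 + B * G1 = [:c:]" "poly c a \<noteq> 0"
    and p: "p \<in> V \<nu>" and \<nu>: "3 * D \<le> \<nu>" and D: "D > 0" and i: "i \<le> D"
  shows "\<exists>A' B' q. p = A' * G0 + B' * G1 + [:[:- a, 1:]:] ^ i * q \<and>
    A' \<in> V (\<nu> - D) \<and> B' \<in> V (\<nu> - D) \<and> degree B' < D \<and> q \<in> V (\<nu> - i)"
  using i
proof (induction i)
  case 0
  then show ?case using p D by (intro exI[of _ 0] exI[of _ p]) auto
next
  case (Suc i)
  then obtain A1 B1 q where 1: "p = A1 * G0 + B1 * G1 + [:[:- a, 1:]:] ^ i * q"
    "A1 \<in> V (\<nu> - D)" "B1 \<in> V (\<nu> - D)" "degree B1 < D" "q \<in> V (\<nu> - i)" by auto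
  have "2 * D \<le> \<nu> - i + 1" using Suc.prems \<nu> by simp
  from monic_division_step[OF G bez 1(5) this D] obtain A2 B2 q' where
    2: "q = A2 * G0 + B2 * G1 + [:[:- a, 1:]:] * q'" "A2 \<in> V (\<nu> - i - D)" "B2 \<in> V (D - 1)"
      "degree B2 < D" "q' \<in> V (\<nu> - i - 1)" .
  have "[:[:- a, 1:]:] \<in> V (Suc 0)" by (auto simp: V_def coeff_pCons split: nat.splits if_splits)
  then have L: "[:[:- a, 1:]:] ^ i \<in> V i" using V_power[of _ "Suc 0" i] by fastforce
  have "[:[:- a, 1:]:] ^ i * A2 \<in> V (i + (\<nu> - i - D))" using L 2(2) by (rule V_mult)
  then have a: "A1 + [:[:- a, 1:]:] ^ i * A2 \<in> V (\<nu> - D)" using 1(2) Suc.prems \<nu> by (auto intro: V_add)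
  have "[:[:- a, 1:]:] ^ i * B2 \<in> V (i + (D - 1))" using L 2(3) by (rule V_mult)
  then have "[:[:- a, 1:]:] ^ i * B2 \<in> V (\<nu> - D)"
    by (rule subsetD[OF V_mono, rotated]) (use Suc.prems \<nu> in arith)
  then have b: "B1 + [:[:- a, 1:]:] ^ i * B2 \<in> V (\<nu> - D)" using 1(3) by (rule V_add[rotated])
  have "[:[:- a, 1:]:] ^ i = [:[:- a, 1:] ^ i:]" by (simp only: poly_const_pow)
  then have "degree ([:[:- a, 1:]:] ^ i * B2) \<le> degree B2" by (simp add: degree_smult_le)
  then have d: "degree (B1 + [:[:- a, 1:]:] ^ i * B2) < D" using 1(4) 2(4) by (intro degree_add_less) auto
  have e: "p = (A1 + [:[:- a, 1:]:] ^ i * A2) * G0 + (B1 + [:[:- a, 1:]:] ^ i * B2) * G1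
      + [:[:- a, 1:]:] ^ Suc i * q'"
    unfolding 1(1) by (subst 2(1)) (simp only: power_Suc2 algebra_simps)
  have q': "q' \<in> V (\<nu> - Suc i)" using 2(5) by simp
  show ?case by (intro exI conjI) (rule e a b d q')+
qed

text \<open>The count behind Bezout's number: two coprime polynomials of degree \<open>D\<close>
  have \<open>card (pairs (\<nu> - D))\<close> monomial multiples each, their mutual relation takes
  away \<open>card (pairs (\<nu> - 2 * D))\<close>, and codimension \<open>D * D\<close>
  remains.\<close>

lemma card_pairs_second_difference:
  "2 * D \<le> \<nu> \<Longrightarrow> card (pairs \<nu>) + card (pairs (\<nu> - 2 * D)) = 2 * card (pairs (\<nu> - D)) + D * D"
proof -
  assume "2 * D \<le> \<nu>"
  then obtain w where w: "\<nu> = w + 2 * D" by (metis le_Suc_ex add.commute)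
  have e: "\<nu> - 2 * D = w" "\<nu> - D = w + D" using w by auto
  have "2 * (card (pairs \<nu>) + card (pairs w)) = (\<nu> + 1) * (\<nu> + 2) + (w + 1) * (w + 2)"
    by (simp add: card_pairs distrib_left)
  also have "\<dots> = 2 * ((w + D + 1) * (w + D + 2)) + 2 * (D * D)"
    unfolding w by (simp add: algebra_simps)
  finally have "2 * (card (pairs \<nu>) + card (pairs w)) = 2 * (2 * card (pairs (w + D))) + 2 * (D * D)"
    by (simp only: card_pairs)
  then show ?thesis unfolding e by simp
qed

definition triple3 :: "'a \<Rightarrow> 'a \<Rightarrow> 'a \<Rightarrow> 3 \<Rightarrow> 'a" where
  "triple3 a b c = (\<lambda>i. if i = 0 then a else if i = 1 then b else c)"

text \<open>The multiples of \<open>G0\<close>, with those multiples of \<open>G1\<close> whose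
  multiplier has degree below \<open>D\<close> in y, are independent, and by
  \<open>monic_division\<close> they span \<open>V \<nu>\<close> together with the multiples of (x -
  a)^D. When they are extended to a basis, the dimension count bounds the number of added
  multiples.\<close>

lemma monic_columns:
  assumes G: "G0 \<in> V D" "G1 \<in> V D" "coeff G0 D \<noteq> 0" "coprime G0 G1"
    and \<nu>: "3 * D \<le> \<nu>" and D: "D > 0"
  obtains J :: "(3 \<times> nat \<times> nat) set" and g where "finite J" "J \<subseteq> UNIV \<times> pairs (\<nu> - D)" "g \<in> V D"
    "fam_indep J (\<lambda>i. mono2 (snd i) * triple3 G0 G1 g (fst i))" "card J = card (pairs \<nu>)"
    "card {i \<in> J. fst i = 2} \<le> D * D"
proof -
  have G00: "G0 \<noteq> 0" using G(3) by auto
  have nocom: "degree \<pi> = 0" if "prime \<pi>" "\<pi> dvd G0" "\<pi> dvd G1" for \<pi>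
    using that G(4) by (meson coprime_common_divisor not_prime_unit)
  from bezout_up_to_constant[OF G00 nocom] obtain A B c
    where c: "c \<noteq> 0" "A * G0 + B * G1 = [:c:]" by blast
  obtain a where a: "poly c a \<noteq> 0" using exists_nonroot[OF c(1)] by auto
  define g where "g = [:[:- a, 1:]:] ^ D"
  have "[:[:- a, 1:]:] \<in> V (Suc 0)" by (auto simp: V_def coeff_pCons split: nat.splits if_splits)
  then have gV: "g \<in> V D" unfolding g_def using V_power[of _ "Suc 0" D] by fastforce
  define v where "v = (\<lambda>i :: 3 \<times> nat \<times> nat. mono2 (snd i) * triple3 G0 G1 g (fst i))"
  have v3: "v (0, m) = mono2 m * G0" "v (1, m) = mono2 m * G1" "v (2, m) = mono2 m * g" for m
    by (simp_all add: v_def triple3_def)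
  let ?P = "pairs (\<nu> - D)"
  \<comment> \<open>The bound on the exponent of y removes the relation between \<open>G0\<close>
    and \<open>G1\<close> and its multiples, since a multiple of \<open>G0\<close> has degree at
    least \<open>D\<close> in y.\<close>
  define P' where "P' = {m \<in> ?P. snd m < D}"
  define J01 where "J01 = ({0} \<times> ?P \<union> {1} \<times> P' :: (3 \<times> nat \<times> nat) set)"
  define J2 where "J2 = ({2} \<times> ?P :: (3 \<times> nat \<times> nat) set)"
  have fin: "finite J01" "finite J2" "finite P'" by (auto simp: J01_def J2_def P'_def)
  have sumJ01: "(\<Sum>i\<in>J01. sc (x i) (v i)) = (\<Sum>m\<in>?P. sc (x (0, m)) (mono2 m)) * G0
      + (\<Sum>m\<in>P'. sc (x (1, m)) (mono2 m)) * G1" for x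
  proof -
    have "(\<Sum>i\<in>J01. sc (x i) (v i)) = (\<Sum>i\<in>{0} \<times> ?P. sc (x i) (v i)) + (\<Sum>i\<in>{1} \<times> P'. sc (x i) (v i))"
      unfolding J01_def using fin by (intro sum.union_disjoint) auto
    moreover have "(\<Sum>i\<in>{k :: 3} \<times> Q. sc (x i) (v i)) = (\<Sum>m\<in>Q. sc (x (k, m)) (v (k, m)))" for k Q
      by (rule sum.reindex_bij_witness[of _ "\<lambda>m. (k, m)" snd]) auto
    ultimately show ?thesis by (simp add: v3 sum_distrib_right)
  qed
  have ind: "fam_indep J01 v"
    unfolding fam_indep_def
  proof (intro allI impI)
    fix x assume s: "(\<Sum>i\<in>J01. sc (x i) (v i)) = 0"
    define A1 where "A1 = (\<Sum>m\<in>?P. sc (x (0, m)) (mono2 m))"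
    define B1 where "B1 = (\<Sum>m\<in>P'. sc (x (1, m)) (mono2 m))"
    have s1: "A1 * G0 + B1 * G1 = 0" using s unfolding sumJ01 A1_def B1_def .
    then have "B1 * G1 = - A1 * G0" by (simp add: eq_neg_iff_add_eq_0 add.commute)
    then have "G0 dvd B1 * G1" by simp
    then have dB: "G0 dvd B1" using G(4) by (simp add: coprime_dvd_mult_left_iff)
    have "coeff (coeff B1 k) j = 0" if "k \<ge> D" for k j
      unfolding B1_def using that fin(3) by (subst coeff_sum_mono2) (auto simp: P'_def)
    then have "coeff B1 k = 0" if "k \<ge> D" for k using that by (intro poly_eqI) auto
    then have "degree B1 < D \<or> B1 = 0"
      by (metis leading_coeff_0_iff not_le)
    moreover have "D \<le> degree G0" using G(3) by (rule le_degree)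
    ultimately have B0: "B1 = 0" using dB dvd_imp_degree_le[of G0 B1] by fastforce
    then have A0: "A1 = 0" using s1 G00 by simp
    have "x (0, m) = 0" if "m \<in> ?P" for m
      using fam_indepD[OF fam_indep_mono2, of ?P "\<lambda>m. x (0, m)"] A0 that unfolding A1_def by simp
    moreover have "x (1, m) = 0" if "m \<in> P'" for m
      using fam_indepD[OF fam_indep_mono2, of P' "\<lambda>m. x (1, m)"] B0 that fin unfolding B1_def by simp
    ultimately show "\<forall>i\<in>J01. x i = 0" by (auto simp: J01_def)
  qed
  have V_sp: "V \<nu> \<subseteq> vs.span (v ` (J01 \<union> J2))"
  proof
    fix p assume p: "p \<in> V \<nu>"
    from monic_division[OF G(1-3) c(2) a p \<nu> D order_refl] obtain A1 B1 q where
      1: "p = A1 * G0 + B1 * G1 + g * q" "A1 \<in> V (\<nu> - D)" "B1 \<in> V (\<nu> - D)" "degree B1 < D" "q \<in> V (\<nu> - D)"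
      unfolding g_def by blast
    have mem: "(\<Sum>m\<in>Q. sc (x m) (mono2 m)) * h \<in> vs.span (v ` (J01 \<union> J2))"
      if "\<And>m. m \<in> Q \<Longrightarrow> mono2 m * h \<in> v ` (J01 \<union> J2)" for Q x h
    proof -
      have "(\<Sum>m\<in>Q. sc (x m) (mono2 m)) * h = (\<Sum>m\<in>Q. sc (x m) (mono2 m * h))"
        by (simp add: sum_distrib_right)
      then show ?thesis using that by (auto intro!: vs.span_sum vs.span_scale intro: vs.span_base)
    qed
    have "A1 * G0 \<in> vs.span (v ` (J01 \<union> J2))"
      by (subst V_expand[OF 1(2)], rule mem) (force simp: J01_def v3[symmetric])
    moreover have "g * q \<in> vs.span (v ` (J01 \<union> J2))"
      by (subst mult.commute, subst V_expand[OF 1(5)], rule mem) (force simp: J2_def v3[symmetric])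
    moreover have "B1 * G1 \<in> vs.span (v ` (J01 \<union> J2))"
    proof -
      have "B1 = (\<Sum>m\<in>?P. sc (coeff (coeff B1 (snd m)) (fst m)) (mono2 m))" by (rule V_expand[OF 1(3)])
      also have "\<dots> = (\<Sum>m\<in>P'. sc (coeff (coeff B1 (snd m)) (fst m)) (mono2 m))"
        using 1(4) by (intro sum.mono_neutral_right) (auto simp: P'_def coeff_eq_0)
      finally have e: "B1 = (\<Sum>m\<in>P'. sc (coeff (coeff B1 (snd m)) (fst m)) (mono2 m))" .
      show ?thesis by (subst e, rule mem) (force simp: J01_def v3[symmetric])
    qed
    ultimately show "p \<in> vs.span (v ` (J01 \<union> J2))" unfolding 1(1) by (intro vs.span_add)
  qed
  have vV: "v i \<in> V \<nu>" if "i \<in> J01 \<union> J2" for i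
  proof -
    have "snd i \<in> ?P" using that by (auto simp: J01_def J2_def P'_def)
    then have "mono2 (snd i) * triple3 G0 G1 g (fst i) \<in> V (\<nu> - D + D)"
      using G gV by (intro V_mult mono2_V) (auto simp: triple3_def)
    then show ?thesis using \<nu> by (simp add: v_def)
  qed
  from vs.maximal_independent_subset_extend[of "v ` J01" "v ` (J01 \<union> J2)"]
    fam_indep_independent[OF fin(1) ind]
  obtain Bs where Bs: "v ` J01 \<subseteq> Bs" "Bs \<subseteq> v ` (J01 \<union> J2)" "vs.independent Bs"
    "v ` (J01 \<union> J2) \<subseteq> vs.span Bs" by blast
  have Bs1: "Bs \<subseteq> V \<nu>" using Bs(2) vV by auto
  have Bs2: "V \<nu> \<subseteq> vs.span Bs"
    using V_sp vs.span_minimal[OF Bs(4) vs.subspace_span] by (rule subset_trans)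
  note cB = card_basis_V[OF Bs1 Bs2 Bs(3)]
  have "Bs - v ` J01 \<subseteq> v ` J2" using Bs(2) by auto
  then obtain J' where J': "J' \<subseteq> J2" "inj_on v J'" "v ` J' = Bs - v ` J01"
    unfolding subset_image_inj by blast
  define J where "J = J01 \<union> J'"
  have finJ: "finite J" "finite J'" using fin finite_subset[OF J'(1)] by (auto simp: J_def)
  have img: "v ` J = Bs" unfolding J_def using J'(3) Bs(1) by auto
  have injJ: "inj_on v J"
    unfolding J_def using J' fam_indep_inj[OF fin(1) ind] by (auto simp: inj_on_Un)
  have "fam_indep J v" using finJ injJ Bs(3) img by (intro independent_fam_indep) auto
  moreover have cJ: "card J = card (pairs \<nu>)" using card_image[OF injJ] img cB by simp
  moreover have "card {i \<in> J. fst i = 2} \<le> D * D"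
  proof -
    have "{i \<in> J. fst i = 2} = J'" using J'(1) by (auto simp: J_def J01_def J2_def)
    moreover have "card J = card J01 + card J'"
      unfolding J_def using fin finJ J'(1) by (intro card_Un_disjoint) (auto simp: J01_def J2_def)
    moreover have "card J01 = card ?P + card P'"
    proof -
      have "card J01 = card ({0 :: 3} \<times> ?P) + card ({1 :: 3} \<times> P')"
        unfolding J01_def using fin by (intro card_Un_disjoint) auto
      then show ?thesis by (simp add: card_cartesian_product_singleton)
    qed
    moreover have "card P' + card (pairs (\<nu> - 2 * D)) = card ?P"
    proof -
      have "(\<lambda>(j, k). (j, k + D)) ` pairs (\<nu> - 2 * D) = ?P - P'"
      proof (intro equalityI subsetI)
        fix x assume "x \<in> ?P - P'"
        then have "x = (\<lambda>(j, k). (j, k + D)) (fst x, snd x - D)" "(fst x, snd x - D) \<in> pairs (\<nu> - 2 * D)"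
          by (auto simp: pairs_def P'_def)
        then show "x \<in> (\<lambda>(j, k). (j, k + D)) ` pairs (\<nu> - 2 * D)" by (rule image_eqI)
      qed (use \<nu> in \<open>auto simp: pairs_def P'_def\<close>)
      moreover have "inj_on (\<lambda>(j, k). (j, k + D)) (pairs (\<nu> - 2 * D))" by (auto simp: inj_on_def)
      ultimately have "card (?P - P') = card (pairs (\<nu> - 2 * D))" by (metis card_image)
      moreover have "card (?P - P') = card ?P - card P'" "card P' \<le> card ?P"
        by (auto intro!: card_Diff_subset card_mono simp: P'_def)
      ultimately show ?thesis by simp
    qed
    moreover have "card (pairs \<nu>) + card (pairs (\<nu> - 2 * D)) = 2 * card ?P + D * D"
      using \<nu> by (intro card_pairs_second_difference) simp
    ultimately show ?thesis using cJ by simp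
  qed
  moreover have "J \<subseteq> UNIV \<times> ?P" using J'(1) by (auto simp: J_def J01_def J2_def P'_def)
  ultimately show ?thesis using that[of J g] finJ(1) gV unfolding v_def by blast
qed

text \<open>
  A generic shear makes a polynomial of total degree \<open>D\<close> monic in \<open>y\<close> up to a constant.
\<close>

definition shear :: "complex \<Rightarrow> complex poly poly \<Rightarrow> complex poly poly" where
  "shear b = bev cc [:[:0, 1:], [:b:]:] py"

lemma comm_ring_hom_shear: "comm_ring_hom (shear b)"
  unfolding shear_def by (rule comm_ring_hom_bev[OF comm_ring_hom_cc])

lemma shear_mult: "shear b (p * q) = shear b p * shear b q"
  and shear_sc: "shear b (sc c p) = sc c (shear b p)"
  and shear_sum: "shear b (sum f A) = (\<Sum>i\<in>A. shear b (f i))"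
  and shear_01: "shear b 0 = 0" "shear b 1 = 1"
proof -
  interpret comm_ring_hom "shear b" by (rule comm_ring_hom_shear)
  show m: "shear b (p * q) = shear b p * shear b q" for p q by (rule hom_mult)
  show "shear b (sum f A) = (\<Sum>i\<in>A. shear b (f i))" by (rule hom_sum)
  show "shear b 0 = 0" "shear b 1 = 1" by simp_all
  have "shear b (cc c * p) = cc c * shear b p"
    by (simp only: m) (simp only: shear_def bev_gens[OF comm_ring_hom_cc])
  then show "shear b (sc c p) = sc c (shear b p)" by simp
qed

lemma shear_shear: "shear (- b) (shear b p) = p"
proof -
  have "bev cc [:[:0, 1:], [:- b:]:] py [:[:0, 1:], [:b:]:] = px"
    by (simp add: bev_pCons[OF comm_ring_hom_cc] Polynomial.map_poly_pCons) (simp add: bev_def)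
  then show ?thesis
    by (simp add: shear_def bev_sub[OF comm_ring_hom_cc] bev_gens[OF comm_ring_hom_cc] bev_id)
qed

lemma V_shear: "p \<in> V n \<Longrightarrow> shear b p \<in> V n"
  unfolding shear_def by (rule V_bev) (auto simp: V_def coeff_pCons split: nat.splits)

lemma coprime_shear:
  assumes "coprime p q"
  shows "coprime (shear b p) (shear b q)"
proof (rule coprimeI)
  fix d assume "d dvd shear b p" "d dvd shear b q"
  then have "shear (- b) d dvd p" "shear (- b) d dvd q"
    by (auto simp: dvd_def) (metis shear_mult shear_shear)+
  then have "is_unit (shear (- b) d)" using assms coprime_common_divisor by blast
  then have "shear b (shear (- b) d) dvd 1" by (auto simp: dvd_def) (metis shear_mult shear_01(2))
  then show "is_unit d" using shear_shear[of "- b" d] by simp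
qed

text \<open>At x = 0 the coefficient of y^D in F(x + b y, y) is the homogeneous part of degree
  \<open>D\<close> of \<open>F\<close> at (b, 1), a nonzero polynomial in \<open>b\<close>; in the
  proof it is called \<open>tp\<close>.\<close>

lemma exists_monic_shear:
  assumes "\<exists>k\<le>D. coeff (coeff F k) (D - k) \<noteq> 0"
  obtains b where "coeff (shear b F) D \<noteq> 0"
proof -
  from assms obtain k0 where k0: "k0 \<le> D" "coeff (coeff F k0) (D - k0) \<noteq> 0" by auto
  define tp where "tp = (\<Sum>k\<le>degree F. \<Sum>j\<le>degree (coeff F k).
      if j + k = D then monom (coeff (coeff F k) j) j else 0)"
  have "coeff tp (D - k0) = (\<Sum>k\<le>degree F. \<Sum>j\<le>degree (coeff F k).
      if k = k0 \<and> j = D - k0 then coeff (coeff F k) j else 0)"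
    unfolding tp_def coeff_sum by (intro sum.cong) (use k0(1) in auto)
  also have "\<dots> = (\<Sum>k\<le>degree F. if k = k0 then coeff (coeff F k0) (D - k0) else 0)"
  proof (rule sum.cong[OF refl])
    fix k assume "k \<in> {..degree F}"
    show "(\<Sum>j\<le>degree (coeff F k). if k = k0 \<and> j = D - k0 then coeff (coeff F k) j else 0) =
        (if k = k0 then coeff (coeff F k0) (D - k0) else 0)"
      by (cases "k = k0") (auto simp: coeff_eq_0)
  qed
  also have "\<dots> = coeff (coeff F k0) (D - k0)"
  proof -
    have "coeff F k0 \<noteq> 0" using k0 by auto
    then have "k0 \<le> degree F" by (rule le_degree)
    then show ?thesis by simp
  qed
  finally have "tp \<noteq> 0" using k0(2) by auto
  then obtain b where b: "poly tp b \<noteq> 0" using exists_nonroot by blast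
  have "ev_in 0 (shear b F) = bev (\<lambda>c. [:c:]) [:0, b:] [:0, 1:] F"
    unfolding shear_def hom_bev[OF comm_ring_hom_ev_in comm_ring_hom_cc]
    by (simp add: Polynomial.map_poly_pCons)
  also have "\<dots> = (\<Sum>k\<le>degree F. \<Sum>j\<le>degree (coeff F k). monom (coeff (coeff F k) j * b ^ j) (j + k))"
  proof -
    have "[:0, b:] ^ j = monom (b ^ j) j" for j
      using monom_power[of b 1 j] by (simp add: monom_Suc monom_0)
    moreover have "[:0, 1 :: complex:] ^ k = monom 1 k" for k by (simp add: monom_altdef)
    ultimately show ?thesis
      unfolding bev_expand[OF comm_ring_hom_const] by (simp add: smult_monom mult_monom)
  qed
  finally have "coeff (ev_in 0 (shear b F)) D = (\<Sum>k\<le>degree F. \<Sum>j\<le>degree (coeff F k).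
      if j + k = D then coeff (coeff F k) j * b ^ j else 0)" by (simp add: coeff_sum)
  also have "\<dots> = poly tp b"
    unfolding tp_def poly_sum by (intro sum.cong refl) (simp add: poly_monom)
  finally have "coeff (shear b F) D \<noteq> 0" using b by (auto simp: coeff_ev_in)
  then show ?thesis by (rule that)
qed

text \<open>A shear is an automorphism that respects total degrees, so the columns found for the
  sheared polynomials are carried back. Their multipliers are then sheared monomials, hence the
  general \<open>m i\<close>.\<close>

lemma exists_columns:
  assumes F: "F0 \<in> V D" "F1 \<in> V D" "coprime F0 F1" "\<exists>k\<le>D. coeff (coeff F0 k) (D - k) \<noteq> 0"
    and \<nu>: "3 * D \<le> \<nu>" and D: "D > 0"
  obtains J :: "(3 \<times> nat \<times> nat) set" and m g where "finite J" "\<And>i. i \<in> J \<Longrightarrow> m i \<in> V (\<nu> - D)" "g \<in> V D"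
    "fam_indep J (\<lambda>i. m i * triple3 F0 F1 g (fst i))" "card J = card (pairs \<nu>)"
    "card {i \<in> J. fst i = 2} \<le> D * D"
proof -
  obtain b where b: "coeff (shear b F0) D \<noteq> 0" using exists_monic_shear[OF F(4)] by blast
  from monic_columns[OF V_shear[OF F(1)] V_shear[OF F(2)] b coprime_shear[OF F(3)] \<nu> D]
  obtain J :: "(3 \<times> nat \<times> nat) set" and g where J: "finite J" "J \<subseteq> UNIV \<times> pairs (\<nu> - D)" "g \<in> V D"
    "fam_indep J (\<lambda>i. mono2 (snd i) * triple3 (shear b F0) (shear b F1) g (fst i))" "card J = card (pairs \<nu>)"
    "card {i \<in> J. fst i = 2} \<le> D * D" by blast
  define m where "m = (\<lambda>i :: 3 \<times> nat \<times> nat. shear (- b) (mono2 (snd i)))"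
  have e: "shear b (m i * triple3 F0 F1 (shear (- b) g) (fst i)) =
      mono2 (snd i) * triple3 (shear b F0) (shear b F1) g (fst i)" for i
    using shear_shear[of "- b"] by (simp only: m_def shear_mult triple3_def if_distrib[of "shear b"] minus_minus)
  have "fam_indep J (\<lambda>i. m i * triple3 F0 F1 (shear (- b) g) (fst i))"
    unfolding fam_indep_def
  proof (intro allI impI ballI)
    fix x j assume z: "(\<Sum>i\<in>J. sc (x i) (m i * triple3 F0 F1 (shear (- b) g) (fst i))) = 0" and j: "j \<in> J"
    have "(\<Sum>i\<in>J. sc (x i) (mono2 (snd i) * triple3 (shear b F0) (shear b F1) g (fst i))) =
        shear b (\<Sum>i\<in>J. sc (x i) (m i * triple3 F0 F1 (shear (- b) g) (fst i)))"
      by (simp only: shear_sum shear_sc e)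
    then have "(\<Sum>i\<in>J. sc (x i) (mono2 (snd i) * triple3 (shear b F0) (shear b F1) g (fst i))) = 0"
      by (simp only: z shear_01)
    then show "x j = 0" by (rule fam_indepD[OF J(4)]) (rule j)
  qed
  moreover have "m i \<in> V (\<nu> - D)" if "i \<in> J" for i
    unfolding m_def using that J(2) by (intro V_shear mono2_V) auto
  moreover have "shear (- b) g \<in> V D" using J(3) by (rule V_shear)
  ultimately show ?thesis using that[of J m "shear (- b) g"] J(1,5,6) by blast
qed

section \<open>Coordinates adapted to the vanishing conditions\<close>

lemma V_prod: "(\<And>i. i \<in> A \<Longrightarrow> f i \<in> V n) \<Longrightarrow> prod f A \<in> V (card A * n)"
proof (induction A rule: infinite_finite_induct)
  case (insert x A)
  then have "f x * prod f A \<in> V (n + card A * n)" by (intro V_mult) auto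
  then show ?case using insert by simp
qed (auto simp: V_1)

text \<open>Hermite interpolation. In a nontrivial relation let \<open>\<gamma>0\<close> be a point
  with a nonzero coefficient and \<open>i0\<close> the largest order that occurs there. The test
  polynomial vanishes to order \<open>T\<close> at the other points and to order exactly
  \<open>i0\<close> at \<open>\<gamma>0\<close>: lower orders die by the polynomial, higher ones by
  the choice of \<open>i0\<close>.\<close>

lemma theta_functionals_independent:
  assumes S: "finite S" and \<nu>: "T * card S + T \<le> \<nu>"
    and y: "\<And>p. p \<in> V \<nu> \<Longrightarrow> (\<Sum>i\<in>S \<times> {..<T}. y i * fps_nth (theta (fst i) p) (snd i)) = 0"
    and i: "i \<in> S \<times> {..<T}"
  shows "y i = 0"
proof (rule ccontr)
  assume nz: "y i \<noteq> 0"
  define \<gamma>0 where "\<gamma>0 = fst i"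
  have g0: "\<gamma>0 \<in> S" using i by (auto simp: \<gamma>0_def)
  define I where "I = {k. k < T \<and> y (\<gamma>0, k) \<noteq> 0}"
  have finI: "finite I" by (simp add: I_def)
  have "snd i \<in> I" using i nz by (auto simp: I_def \<gamma>0_def)
  then have I0: "I \<noteq> {}" by auto
  define i0 where "i0 = Max I"
  have i0: "i0 < T" "y (\<gamma>0, i0) \<noteq> 0"
    using Max_in[OF finI I0] by (auto simp: i0_def I_def)
  have i0max: "y (\<gamma>0, k) = 0" if "k < T" "i0 < k" for k
    using Max_ge[OF finI, of k] that unfolding i0_def I_def by fastforce
  interpret h: comm_ring_hom "theta \<gamma>" for \<gamma> by (rule comm_ring_hom_theta)
  \<comment> \<open>For every other point a line through it that misses \<open>\<gamma>0\<close>: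
    vertical if the first coordinates differ, otherwise horizontal.\<close>
  define lin where "lin = (\<lambda>\<gamma>. if fst \<gamma> \<noteq> fst \<gamma>0 then [:[:- fst \<gamma>, 1:]:] else [:[:- snd \<gamma>:], 1:])"
  have t1: "theta \<gamma> [:[:- c, 1:]:] = fps_const (fst \<gamma>) + fps_X - fps_const c" for \<gamma> c
    by (simp add: theta_def bev_def Polynomial.map_poly_pCons fps_const_neg[symmetric] del: fps_const_neg)
  have t2: "theta \<gamma> [:[:- c:], 1:] = fps_const (snd \<gamma>) * fps_exp 1 - fps_const c" for \<gamma> c
    by (simp add: theta_def bev_def Polynomial.map_poly_pCons fps_const_neg[symmetric] del: fps_const_neg)
  have l1: "fps_nth (theta \<gamma> (lin \<gamma>)) 0 = 0" for \<gamma>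
    unfolding lin_def by (simp add: t1 t2)
  have l2: "fps_nth (theta \<gamma>0 (lin \<gamma>)) 0 \<noteq> 0" if "\<gamma> \<noteq> \<gamma>0" for \<gamma>
    using that unfolding lin_def by (auto simp: t1 t2 prod_eq_iff)
  have linV: "lin \<gamma> \<in> V (Suc 0)" for \<gamma>
    by (auto simp: lin_def V_def coeff_pCons split: nat.splits if_splits)
  define l0 where "l0 = [:[:- fst \<gamma>0, 1:]:]"
  have l0: "theta \<gamma>0 l0 = fps_X" by (simp add: l0_def t1)
  have l0V: "l0 \<in> V (Suc 0)" by (auto simp: l0_def V_def coeff_pCons split: nat.splits if_splits)
  define E where "E = (\<Prod>\<gamma>\<in>S - {\<gamma>0}. lin \<gamma> ^ T)"
  have cS: "card (S - {\<gamma>0}) \<le> card S" using S by (intro card_mono) auto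
  have "E * l0 ^ i0 \<in> V (card (S - {\<gamma>0}) * (T * Suc 0) + i0 * Suc 0)"
    unfolding E_def by (intro V_mult V_prod V_power linV l0V)
  moreover have "card (S - {\<gamma>0}) * (T * Suc 0) + i0 * Suc 0 \<le> \<nu>"
  proof -
    have "card (S - {\<gamma>0}) * T \<le> card S * T" by (rule mult_le_mono1[OF cS])
    then have "card (S - {\<gamma>0}) * T + i0 \<le> \<nu>"
      using \<nu> i0(1) mult.commute[of "card S" T] by linarith
    then show ?thesis by simp
  qed
  ultimately have pV: "E * l0 ^ i0 \<in> V \<nu>" using V_mono by blast
  define u where "u = theta \<gamma>0 E"
  have tp: "theta \<gamma>0 (E * l0 ^ i0) = u * fps_X ^ i0" by (simp add: h.hom_mult h.hom_power u_def l0)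
  have "u = (\<Prod>\<gamma>\<in>S - {\<gamma>0}. theta \<gamma>0 (lin \<gamma>) ^ T)"
    unfolding u_def E_def by (simp only: h.hom_prod h.hom_power)
  moreover interpret z: comm_ring_hom "\<lambda>f. fps_nth f 0 :: complex" by (rule comm_ring_hom_fps_nth_0)
  have "fps_nth (\<Prod>\<gamma>\<in>S - {\<gamma>0}. theta \<gamma>0 (lin \<gamma>) ^ T) 0 = (\<Prod>\<gamma>\<in>S - {\<gamma>0}. fps_nth (theta \<gamma>0 (lin \<gamma>)) 0 ^ T)"
    by (simp only: z.hom_prod z.hom_power)
  ultimately have "fps_nth u 0 = (\<Prod>\<gamma>\<in>S - {\<gamma>0}. fps_nth (theta \<gamma>0 (lin \<gamma>)) 0 ^ T)"
    by simp
  then have u0: "fps_nth u 0 \<noteq> 0" using l2 S by auto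
  have other: "fps_nth (theta \<gamma> (E * l0 ^ i0)) k = 0" if "\<gamma> \<in> S" "\<gamma> \<noteq> \<gamma>0" "k < T" for \<gamma> k
  proof -
    have "E = lin \<gamma> ^ T * (\<Prod>\<gamma>\<in>S - {\<gamma>0} - {\<gamma>}. lin \<gamma> ^ T)"
      unfolding E_def using that S by (intro prod.remove) auto
    then have "theta \<gamma> (E * l0 ^ i0) = theta \<gamma> (lin \<gamma>) ^ T *
        theta \<gamma> ((\<Prod>\<gamma>\<in>S - {\<gamma>0} - {\<gamma>}. lin \<gamma> ^ T) * l0 ^ i0)"
      by (simp only: h.hom_mult h.hom_power mult.assoc)
    then show ?thesis
      using fps_mult_nth_low[of T "theta \<gamma> (lin \<gamma>) ^ T" k] startsby_zero_power_prefix[OF l1] that(3) by auto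
  qed
  have "(\<Sum>i\<in>S \<times> {..<T}. y i * fps_nth (theta (fst i) (E * l0 ^ i0)) (snd i)) =
      (\<Sum>i\<in>{(\<gamma>0, i0)}. y i * fps_nth (theta (fst i) (E * l0 ^ i0)) (snd i))"
  proof (rule sum.mono_neutral_right)
    show "\<forall>i\<in>S \<times> {..<T} - {(\<gamma>0, i0)}. y i * fps_nth (theta (fst i) (E * l0 ^ i0)) (snd i) = 0"
    proof
      fix i assume i: "i \<in> S \<times> {..<T} - {(\<gamma>0, i0)}"
      show "y i * fps_nth (theta (fst i) (E * l0 ^ i0)) (snd i) = 0"
      proof (cases "fst i = \<gamma>0")
        case False
        then show ?thesis using other[of "fst i" "snd i"] i by auto
      next
        case True
        then consider "snd i < i0" | "snd i > i0" "snd i < T" using i by (cases i) force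
        then show ?thesis
        proof cases
          case 1
          then show ?thesis by (simp only: True tp fps_X_power_mult_right_nth) simp
        next
          case 2
          then have "y (\<gamma>0, snd i) = 0" by (intro i0max)
          then show ?thesis using True by (metis mult_zero_left prod.collapse)
        qed
      qed
    qed
  qed (use S g0 i0 in auto)
  also have "\<dots> = y (\<gamma>0, i0) * fps_nth u 0"
    by (simp only: sum.insert sum.empty finite.emptyI empty_iff not_False_eq_True fst_conv snd_conv tp
        fps_X_power_mult_right_nth) simp
  finally show False using y[OF pV] u0 i0(2) by simp
qed

locale coordinates =
  fixes \<nu> :: nat and w :: "nat \<Rightarrow> complex poly poly" and \<ll> :: "nat \<Rightarrow> complex poly poly \<Rightarrow> complex"
  assumes w_V: "r < card (pairs \<nu>) \<Longrightarrow> w r \<in> V \<nu>"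
    and expand: "p \<in> V \<nu> \<Longrightarrow> p = (\<Sum>r<card (pairs \<nu>). sc (\<ll> r p) (w r))"
    and coord_add: "p \<in> V \<nu> \<Longrightarrow> q \<in> V \<nu> \<Longrightarrow> \<ll> r (p + q) = \<ll> r p + \<ll> r q"
    and coord_scale: "p \<in> V \<nu> \<Longrightarrow> \<ll> r (sc c p) = c * \<ll> r p"

lemma subspace_Vsub: "vs.subspace (Vsub S T n)"
proof -
  have "0 \<in> Vsub S T n" using theta_cc[of _ 0] by (simp add: Vsub_def)
  moreover have "sc c p \<in> Vsub S T n" if "p \<in> Vsub S T n" for c p
    using Vsub_scale[OF that, of c] by simp
  ultimately show ?thesis unfolding vs.subspace_def by (auto intro: Vsub_add)
qed

text \<open>A basis of \<open>Vsub S T \<nu>\<close> is extended to \<open>V \<nu>\<close>; the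
  coordinates along the new elements vanish on the subspace. Were there fewer than
  \<open>T * card S\<close> new elements, a nontrivial combination of the Taylor functionals would
  vanish on them and on the subspace, hence on all of \<open>V \<nu>\<close>, against
  independence.\<close>

lemma exists_adapted_coordinates:
  assumes S: "finite S" and \<nu>: "T * card S + T \<le> \<nu>"
  obtains w \<ll> where "coordinates \<nu> w \<ll>"
    "T * card S \<le> card {r. r < card (pairs \<nu>) \<and> (\<forall>p\<in>Vsub S T \<nu>. \<ll> r p = 0)}"
proof -
  obtain BK where BK: "BK \<subseteq> Vsub S T \<nu>" "vs.independent BK" "Vsub S T \<nu> \<subseteq> vs.span BK"
    using vs.maximal_independent_subset[of "Vsub S T \<nu>"] by blast
  have "BK \<subseteq> V \<nu>" using BK(1) Vsub_V by blast
  from vs.maximal_independent_subset_extend[OF this BK(2)]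
  obtain B where B: "BK \<subseteq> B" "B \<subseteq> V \<nu>" "vs.independent B" "V \<nu> \<subseteq> vs.span B" by blast
  note cB = card_basis_V[OF B(2,4,3)]
  obtain h where h: "bij_betw h {..<card (pairs \<nu>)} B"
    using ex_bij_betw_nat_finite[OF cB(1)] cB(2) by (metis atLeast0LessThan)
  define \<ll> where "\<ll> = (\<lambda>r p. vs.representation B p (h r))"
  have hB: "h r \<in> B" if "r < card (pairs \<nu>)" for r using h that by (auto simp: bij_betw_def)
  have co: "coordinates \<nu> h \<ll>"
  proof
    show "h r \<in> V \<nu>" if "r < card (pairs \<nu>)" for r using hB[OF that] B(2) by auto
    show "p = (\<Sum>r<card (pairs \<nu>). sc (\<ll> r p) (h r))" if "p \<in> V \<nu>" for p
    proof -
      have "p = (\<Sum>b\<in>B. sc (vs.representation B p b) b)"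
        using that B cB(1) by (intro vs.sum_representation_eq[symmetric]) auto
      also have "\<dots> = (\<Sum>r<card (pairs \<nu>). sc (\<ll> r p) (h r))"
        unfolding \<ll>_def by (rule sum.reindex_bij_betw[OF h, symmetric])
      finally show ?thesis .
    qed
    show "\<ll> r (p + q) = \<ll> r p + \<ll> r q" if "p \<in> V \<nu>" "q \<in> V \<nu>" for r p q
      unfolding \<ll>_def using that B by (subst vs.representation_add) auto
    show "\<ll> r (sc c p) = c * \<ll> r p" if "p \<in> V \<nu>" for r c p
      unfolding \<ll>_def using that B by (subst vs.representation_scale) auto
  qed
  have zero: "\<ll> r p = 0" if "r < card (pairs \<nu>)" "h r \<notin> BK" "p \<in> Vsub S T \<nu>" for r p
  proof -
    have "vs.representation B p = vs.representation BK p"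
      using that(3) BK(3) B by (intro vs.representation_extend) auto
    then show ?thesis unfolding \<ll>_def using that(2) vs.representation_ne_zero by metis
  qed
  have cBK: "T * card S \<le> card (B - BK)"
  proof (rule ccontr)
    assume "\<not> ?thesis"
    then have lt: "card (B - BK) < card (S \<times> {..<T})" by (simp add: card_cartesian_product mult.commute)
    have fins: "finite (B - BK)" "finite (S \<times> {..<T})" using cB(1) S by auto
    from underdetermined_system[OF fins lt, of "\<lambda>b i. fps_nth (theta (fst i) b) (snd i)"]
    obtain y where y: "\<exists>j\<in>S \<times> {..<T}. y j \<noteq> 0"
      "\<And>b. b \<in> B - BK \<Longrightarrow> (\<Sum>j\<in>S \<times> {..<T}. fps_nth (theta (fst j) b) (snd j) * y j) = 0"
      by blast
    let ?Z = "{p. (\<Sum>j\<in>S \<times> {..<T}. y j * fps_nth (theta (fst j) p) (snd j)) = 0}"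
    have tsc: "theta \<gamma> (sc c p) = fps_const c * theta \<gamma> p" for \<gamma> c p
      using theta_mult[of \<gamma> "cc c" p] by (simp add: theta_cc)
    have t0: "theta \<gamma> 0 = 0" for \<gamma> using theta_cc[of \<gamma> 0] by simp
    have "vs.subspace ?Z"
    proof (rule vs.subspaceI)
      show "0 \<in> ?Z" by (simp add: t0)
      show "p + q \<in> ?Z" if "p \<in> ?Z" "q \<in> ?Z" for p q
        using that by (simp add: theta_add distrib_left sum.distrib)
      show "sc c p \<in> ?Z" if "p \<in> ?Z" for c p
      proof -
        have "(\<Sum>j\<in>S \<times> {..<T}. y j * fps_nth (theta (fst j) (sc c p)) (snd j)) =
            c * (\<Sum>j\<in>S \<times> {..<T}. y j * fps_nth (theta (fst j) p) (snd j))"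
          by (simp add: tsc sum_distrib_left mult_ac)
        then show ?thesis using that by simp
      qed
    qed
    moreover have "B \<subseteq> ?Z"
    proof
      fix b assume b: "b \<in> B"
      show "b \<in> ?Z"
      proof (cases "b \<in> BK")
        case True
        then have "fps_nth (theta (fst j) b) (snd j) = 0" if "j \<in> S \<times> {..<T}" for j
          using that BK(1) by (auto simp: Vsub_def)
        then show ?thesis by simp
      next
        case False
        then show ?thesis using y(2)[of b] b by (simp add: mult.commute)
      qed
    qed
    ultimately have "vs.span B \<subseteq> ?Z" by (intro vs.span_minimal)
    then have "\<And>p. p \<in> V \<nu> \<Longrightarrow> (\<Sum>j\<in>S \<times> {..<T}. y j * fps_nth (theta (fst j) p) (snd j)) = 0"
      using B(4) by blast
    then have "y j = 0" if "j \<in> S \<times> {..<T}" for j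
      using theta_functionals_independent[OF S \<nu>, of y j] that by blast
    then show False using y(1) by blast
  qed
  have "card (B - BK) = card {r. r < card (pairs \<nu>) \<and> h r \<notin> BK}"
  proof -
    have "h ` {r. r < card (pairs \<nu>) \<and> h r \<notin> BK} = B - BK"
      using h unfolding bij_betw_def by auto
    moreover have "inj_on h {r. r < card (pairs \<nu>) \<and> h r \<notin> BK}"
      using h unfolding bij_betw_def by (auto intro: inj_on_subset)
    ultimately show ?thesis by (metis card_image)
  qed
  also have "\<dots> \<le> card {r. r < card (pairs \<nu>) \<and> (\<forall>p\<in>Vsub S T \<nu>. \<ll> r p = 0)}"
    using zero by (intro card_mono) auto
  finally show ?thesis using that[OF co] cBK by simp
qed

section \<open>Determinants in coordinates\<close>

lemma linear_on_V_sum: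
  assumes "\<And>p q. p \<in> V n \<Longrightarrow> q \<in> V n \<Longrightarrow> E (p + q) = E p + E q"
    and "\<And>c p. p \<in> V n \<Longrightarrow> E (sc c p) = c * (E p :: complex)"
    and "finite J" "\<And>j. j \<in> J \<Longrightarrow> v j \<in> V n"
  shows "E (\<Sum>j\<in>J. sc (x j) (v j)) = (\<Sum>j\<in>J. x j * E (v j))"
  using assms(3,4)
proof (induction J)
  case empty
  show ?case using assms(2)[of 0 0] by simp
next
  case (insert j J)
  have "(\<Sum>j\<in>J. sc (x j) (v j)) \<in> V n" using insert by (intro V_sum V_sc) auto
  then show ?case using insert by (simp add: assms V_sc)
qed

context coordinates
begin

abbreviation "N \<equiv> card (pairs \<nu>)"

lemma det_ne_0_iff:
  assumes v: "\<And>i. i < N \<Longrightarrow> v i \<in> V \<nu>"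
  shows "det (mat N N (\<lambda>(r, i). \<ll> r (v i))) \<noteq> 0 \<longleftrightarrow> fam_indep {..<N} v"
proof -
  let ?A = "mat N N (\<lambda>(r, i). \<ll> r (v i))"
  have A: "?A \<in> carrier_mat N N" by simp
  have key: "?A *\<^sub>v vec N x = 0\<^sub>v N \<longleftrightarrow> (\<Sum>i<N. sc (x i) (v i)) = 0" for x
  proof -
    let ?s = "\<Sum>i<N. sc (x i) (v i)"
    have s: "?s \<in> V \<nu>" using v by (intro V_sum V_sc) auto
    have l: "\<ll> r ?s = (\<Sum>i<N. x i * \<ll> r (v i))" for r
      by (rule linear_on_V_sum[of \<nu>]) (use v coord_add coord_scale in auto)
    have "?A *\<^sub>v vec N x = 0\<^sub>v N \<longleftrightarrow> (\<forall>r<N. (\<Sum>i<N. \<ll> r (v i) * x i) = 0)"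
      by (auto simp: vec_eq_iff scalar_prod_def lessThan_atLeast0)
    also have "\<dots> \<longleftrightarrow> (\<forall>r<N. \<ll> r ?s = 0)" by (simp add: l mult.commute)
    also have "\<dots> \<longleftrightarrow> ?s = 0"
    proof
      assume "\<forall>r<N. \<ll> r ?s = 0"
      then show "?s = 0" by (subst expand[OF s]) simp
    next
      assume "?s = 0"
      moreover have "\<ll> r 0 = 0" for r using coord_scale[of 0 r 0] by simp
      ultimately show "\<forall>r<N. \<ll> r ?s = 0" by simp
    qed
    finally show ?thesis .
  qed
  have vecx: "x = vec N (\<lambda>i. x $ i)" if "x \<in> carrier_vec N" for x :: "complex vec"
    using that by auto
  show ?thesis
  proof
    assume d: "det ?A \<noteq> 0"
    show "fam_indep {..<N} v"
      unfolding fam_indep_def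
    proof (intro allI impI ballI)
      fix x i assume s: "(\<Sum>i<N. sc (x i) (v i)) = 0" and i: "i \<in> {..<N}"
      have "?A *\<^sub>v vec N x = 0\<^sub>v N" using s key by blast
      then have "vec N x = 0\<^sub>v N"
        using d det_0_iff_vec_prod_zero[OF A] by (metis vec_carrier)
      then have "vec N x $ i = 0\<^sub>v N $ i" by simp
      then show "x i = 0" using i by simp
    qed
  next
    assume f: "fam_indep {..<N} v"
    show "det ?A \<noteq> 0"
    proof
      assume "det ?A = 0"
      then obtain x where x: "x \<in> carrier_vec N" "x \<noteq> 0\<^sub>v N" "?A *\<^sub>v x = 0\<^sub>v N"
        using det_0_iff_vec_prod_zero[OF A] by blast
      then have "(\<Sum>i<N. sc (x $ i) (v i)) = 0" using key[of "\<lambda>i. x $ i"] vecx[OF x(1)] by metis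
      then have "x $ i = 0" if "i < N" for i using fam_indepD[OF f, of "\<lambda>i. x $ i" i] that by simp
      then have "x = 0\<^sub>v N" using x(1) by auto
      then show False using x(2) by simp
    qed
  qed
qed

text \<open>Independent columns would form a basis by their number, and a functional that kills a
  basis is 0. The functional in mind is evaluation at a common zero.\<close>

lemma det_eq_0_if_common_functional:
  assumes v: "\<And>i. i < N \<Longrightarrow> v i \<in> V \<nu>"
    and E: "\<And>p q. p \<in> V \<nu> \<Longrightarrow> q \<in> V \<nu> \<Longrightarrow> E (p + q) = E p + E q"
      "\<And>c p. p \<in> V \<nu> \<Longrightarrow> E (sc c p) = c * (E p :: complex)"
    and ne: "p0 \<in> V \<nu>" "E p0 \<noteq> 0" and kill: "\<And>i. i < N \<Longrightarrow> E (v i) = 0"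
  shows "det (mat N N (\<lambda>(r, i). \<ll> r (v i))) = 0"
proof -
  have exp: "E p = (\<Sum>r<N. \<ll> r p * E (w r))" if "p \<in> V \<nu>" for p
    by (subst expand[OF that]) (rule linear_on_V_sum[of \<nu>, OF E], use w_V in auto)
  have "E (w r) = 0" if f: "fam_indep {..<N} v" "r < N" for r
  proof -
    have inj: "inj_on v {..<N}" by (rule fam_indep_inj[OF _ f(1)]) simp
    have ind: "vs.independent (v ` {..<N})" by (rule fam_indep_independent[OF _ f(1)]) simp
    have "v ` {..<N} \<subseteq> V \<nu>" using v by auto
    from vs.maximal_independent_subset_extend[OF this ind] obtain B where
      B: "v ` {..<N} \<subseteq> B" "B \<subseteq> V \<nu>" "vs.independent B" "V \<nu> \<subseteq> vs.span B" by blast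
    note cB = card_basis_V[OF B(2,4,3)]
    have "card (v ` {..<N}) = N" using card_image[OF inj] by simp
    then have Beq: "v ` {..<N} = B" using cB B(1) by (intro card_subset_eq) auto
    have sub: "vs.subspace {p \<in> V \<nu>. E p = 0}"
    proof (rule vs.subspaceI)
      show "0 \<in> {p \<in> V \<nu>. E p = 0}" using E(2)[of 0 0] by simp
    qed (auto simp: E V_add V_sc)
    have "B \<subseteq> {p \<in> V \<nu>. E p = 0}" using Beq kill v by auto
    then have "vs.span B \<subseteq> {p \<in> V \<nu>. E p = 0}" using sub by (rule vs.span_minimal)
    then show ?thesis using B(4) w_V[OF f(2)] by blast
  qed
  then have "\<not> fam_indep {..<N} v" using exp[OF ne(1)] ne(2) by fastforce
  then show ?thesis using det_ne_0_iff[of v] v by blast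
qed

end

lemma degree_det_le:
  fixes A :: "'a::idom poly mat"
  assumes A: "A \<in> carrier_mat n n" and deg: "\<And>r i. r < n \<Longrightarrow> i < n \<Longrightarrow> degree (A $$ (r, i)) \<le> d i"
  shows "degree (det A) \<le> (\<Sum>i<n. d i)"
  unfolding det_def'[OF A]
proof (rule degree_sum_le)
  show "finite {p. p permutes {0..<n}}" by (rule finite_permutations) simp
  fix p assume "p \<in> {p. p permutes {0..<n}}"
  then have p: "p permutes {0..<n}" by simp
  have "degree (signof p * (\<Prod>i = 0..<n. A $$ (i, p i))) \<le> degree (\<Prod>i = 0..<n. A $$ (i, p i))"
    by (simp add: sign_def)
  also have "\<dots> \<le> (\<Sum>i = 0..<n. degree (A $$ (i, p i)))"
    using degree_prod_sum_le[of "{0..<n}" "\<lambda>i. A $$ (i, p i)"] by (simp add: o_def)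
  also have "\<dots> \<le> (\<Sum>i = 0..<n. d (p i))"
    using permutes_in_image[OF p] by (intro sum_mono deg) auto
  also have "\<dots> = (\<Sum>i = 0..<n. d i)" using sum.permute[OF p, of d] by (simp add: o_def)
  finally show "degree (signof p * (\<Prod>i = 0..<n. A $$ (i, p i))) \<le> (\<Sum>i<n. d i)"
    by (simp add: lessThan_atLeast0)
qed

text \<open>Each term of the Leibniz expansion takes one factor from every row in
  \<open>R\<close>.\<close>

lemma power_dvd_det:
  fixes A :: "'a::comm_ring_1 mat"
  assumes A: "A \<in> carrier_mat n n" and R: "R \<subseteq> {..<n}"
    and dv: "\<And>r i. r \<in> R \<Longrightarrow> i < n \<Longrightarrow> x dvd A $$ (r, i)"
  shows "x ^ card R dvd det A"
  unfolding det_def'[OF A]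
proof (rule dvd_sum)
  fix p assume "p \<in> {p. p permutes {0..<n}}"
  then have p: "p permutes {0..<n}" by simp
  have R': "R \<subseteq> {0..<n}" "finite R" using R finite_subset by auto
  have "x ^ card R = (\<Prod>i\<in>R. x)" by simp
  also have "\<dots> dvd (\<Prod>i\<in>R. A $$ (i, p i))"
    using dv permutes_in_image[OF p] R' by (intro prod_dvd_prod) fastforce
  also have "\<dots> dvd (\<Prod>i = 0..<n. A $$ (i, p i))" using R' by (intro prod_dvd_prod_subset) auto
  finally show "x ^ card R dvd signof p * (\<Prod>i = 0..<n. A $$ (i, p i))" by (rule dvd_mult)
qed

section \<open>Order of vanishing of the resultant\<close>

lemma dvd_diff_mult:
  fixes q :: "'a::comm_ring_1"
  assumes "q dvd a - b" "q dvd c - d"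
  shows "q dvd a * c - b * d"
proof -
  have "a * c - b * d = (a - b) * c + b * (c - d)" by (simp add: algebra_simps)
  then show ?thesis using assms by simp
qed

lemma mev_cong_mod:
  fixes q :: "'b::comm_ring_1"
  assumes "\<And>x. q dvd u x - v x"
  shows "q dvd mev \<iota> u p - mev \<iota> v p"
proof -
  have 1: "q dvd u x ^ n - v x ^ n" for x n
    by (induction n) (auto intro: dvd_diff_mult assms)
  have "q dvd (\<Prod>x\<in>A. u x ^ f x) - (\<Prod>x\<in>A. v x ^ f x)" for A and f :: "_ \<Rightarrow> nat"
    by (induction A rule: infinite_finite_induct) (auto intro: dvd_diff_mult 1)
  then have 2: "q dvd mmon u m - mmon v m" for m by (simp add: mmon_def)
  have "mev \<iota> u p - mev \<iota> v p = (\<Sum>m\<in>Poly_Mapping.keys p. \<iota> (Poly_Mapping.lookup p m) * (mmon u m - mmon v m))"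
    by (simp add: mev_def sum_subtractf right_diff_distrib)
  then show ?thesis using 2 by (auto intro: dvd_sum)
qed

lemma coeffs_of_add: "coeffs_of (\<lambda>j. f j + h j) x = coeffs_of f x + coeffs_of h x"
  by (cases x) (simp add: lookup_add)

lemma coeffs_of_scale: "coeffs_of (\<lambda>j. Poly_Mapping.single 0 c * f j) x = c * coeffs_of f x"
  by (cases x) (simp add: lookup_scale)

lemma homog_add: "p \<in> V n \<Longrightarrow> q \<in> V n \<Longrightarrow> homog n (p + q) = homog n p + homog n q"
  by (rule forms_eqI[of _ n]) (auto simp: homog_forms forms_add delta_add delta_homog V_add)

lemma homog_sc: "p \<in> V n \<Longrightarrow> homog n (sc c p) = Poly_Mapping.single 0 c * homog n p"
  by (rule forms_eqI[of _ n]) (simp_all add: homog_forms forms_scale delta_scale delta_homog V_sc)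

lemma homog_mult:
  "p \<in> V a \<Longrightarrow> Q \<in> forms b \<Longrightarrow> homog (a + b) (p * delta Q) = homog a p * Q"
  by (rule forms_eqI[of _ "a + b"])
     (auto simp: homog_forms forms_mult delta_mult delta_homog V_mult delta_V)

lemma fam_indep_scale:
  assumes "fam_indep J v" "\<And>i. i \<in> J \<Longrightarrow> a i \<noteq> 0"
  shows "fam_indep J (\<lambda>i. sc (a i) (v i))"
  unfolding fam_indep_def
proof (intro allI impI ballI)
  fix x j assume s: "(\<Sum>i\<in>J. sc (x i) (sc (a i) (v i))) = 0" and j: "j \<in> J"
  have "(\<Sum>i\<in>J. sc (x i * a i) (v i)) = 0" using s by (simp add: mult.commute)
  then have "x j * a j = 0" by (rule fam_indepD[OF assms(1), of "\<lambda>i. x i * a i"]) (rule j)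
  then show "x j = 0" using assms(2)[OF j] by simp
qed

lemma fam_indep_reindex:
  assumes "fam_indep J v" "bij_betw b I J"
  shows "fam_indep I (\<lambda>i. v (b i))"
  unfolding fam_indep_def
proof (intro allI impI ballI)
  fix x i assume s: "(\<Sum>i\<in>I. sc (x i) (v (b i))) = 0" and i: "i \<in> I"
  let ?y = "\<lambda>j. x (the_inv_into I b j)"
  have inj: "inj_on b I" using assms(2) by (rule bij_betw_imp_inj_on)
  have "(\<Sum>j\<in>J. sc (?y j) (v j)) = (\<Sum>i\<in>I. sc (?y (b i)) (v (b i)))"
    by (rule sum.reindex_bij_betw[OF assms(2), symmetric])
  also have "\<dots> = (\<Sum>i\<in>I. sc (x i) (v (b i)))"
    by (intro sum.cong refl) (simp add: the_inv_into_f_f[OF inj])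
  finally have "(\<Sum>j\<in>J. sc (?y j) (v j)) = 0" using s by simp
  then have "?y (b i) = 0"
    using fam_indepD[OF assms(1), of ?y "b i"] i assms(2) by (auto simp: bij_betw_def)
  then show "x i = 0" using i by (simp add: the_inv_into_f_f[OF inj])
qed

lemma comm_ring_hom_eval2: "comm_ring_hom (\<lambda>p :: complex poly poly. poly (poly p [:t:]) s)"
  by (rule comm_ring_hom_comp[OF comm_ring_hom_poly_at comm_ring_hom_poly_at])

lemma det_mat_hom:
  assumes "comm_ring_hom h"
  shows "h (det (mat n n f)) = det (mat n n (\<lambda>x. h (f x)))"
proof -
  have "map_mat h (mat n n f) = mat n n (\<lambda>x. h (f x))" by (rule eq_matI) auto
  then show ?thesis using comm_ring_hom.hom_det[OF assms, of "mat n n f"] by simp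
qed

context coordinates
begin

lemma coord_0: "\<ll> r 0 = 0"
  using coord_scale[of 0 r 0] by simp

text \<open>
  Independence holds at \<open>t = \<infinity>\<close>, hence for a generic \<open>t = 1/u\<close> with \<open>u\<close> close to \<open>0\<close>.
\<close>

lemma exists_independent_pencil_member:
  assumes F: "\<And>i. i < N \<Longrightarrow> F i \<in> V \<nu>" "\<And>i. i < N \<Longrightarrow> G i \<in> V \<nu>"
    and ind: "fam_indep {..<N} (\<lambda>i. if k i then G i else F i)"
  obtains t where "fam_indep {..<N} (\<lambda>i. F i + (if k i then sc t (G i) else 0))"
proof -
  define B where "B = mat N N (\<lambda>(r, i). if k i then [:\<ll> r (G i), \<ll> r (F i):] else [:\<ll> r (F i):])"
  have ev: "poly (det B) u = det (mat N N (\<lambda>(r, i). \<ll> r (if k i then G i + sc u (F i) else F i)))" for u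
    unfolding B_def det_mat_hom[OF comm_ring_hom_poly_at]
    by (intro arg_cong[of _ _ det] cong_mat refl)
       (auto simp: coord_add coord_scale F V_sc)
  have "poly (det B) 0 \<noteq> 0"
  proof -
    have "(\<lambda>i. if k i then G i + sc 0 (F i) else F i) = (\<lambda>i. if k i then G i else F i)" by auto
    then have "fam_indep {..<N} (\<lambda>i. if k i then G i + sc 0 (F i) else F i)" using ind by simp
    then show ?thesis unfolding ev by (subst det_ne_0_iff) (auto intro: V_add V_sc F)
  qed
  \<comment> \<open>The extra factor keeps \<open>u = 0\<close> out of the choice.\<close>
  then have "[:0, 1:] * det B \<noteq> 0" by auto
  then obtain u where u: "poly ([:0, 1:] * det B) u \<noteq> 0" using exists_nonroot by blast
  then have u0: "u \<noteq> 0" and du: "poly (det B) u \<noteq> 0" by auto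
  from du have fu: "fam_indep {..<N} (\<lambda>i. if k i then G i + sc u (F i) else F i)"
    unfolding ev by (subst (asm) det_ne_0_iff) (auto intro: V_add V_sc F)
  have "fam_indep {..<N} (\<lambda>i. sc (if k i then 1 / u else 1) (if k i then G i + sc u (F i) else F i))"
    by (rule fam_indep_scale[OF fu]) (use u0 in auto)
  moreover have "(\<lambda>i. sc (if k i then 1 / u else 1) (if k i then G i + sc u (F i) else F i)) =
      (\<lambda>i. F i + (if k i then sc (1 / u) (G i) else 0))"
    using u0 by (auto simp: smult_add_right one_pCons[symmetric])
  ultimately show ?thesis using that[of "1 / u"] by simp
qed

text \<open>
  The path from \<open>f\<close> in direction \<open>h\<close> is bent by a term of order \<open>s\<^sup>M\<close>, which does not affect the
  claim, so that it reaches the grid configuration at \<open>s = 1\<close>.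
\<close>

lemma resultant_order_at_good_triple:
  fixes f h :: "3 \<Rightarrow> cpoly3" and kind :: "nat \<Rightarrow> 3"
  assumes R: "generic_resultant D R" and D: "D > 0" "D \<le> \<nu>" and M: "M > 0"
    and rows: "M \<le> card {r. r < N \<and> (\<forall>p\<in>Vsub S T \<nu>. \<ll> r p = 0)}"
    and f: "\<And>j. f j \<in> forms D" "\<And>j. delta (f j) \<in> Vsub S T D"
    and h: "\<And>j. h j \<in> forms D"
    and m: "\<And>i. i < N \<Longrightarrow> m i \<in> V (\<nu> - D)" and g: "g \<in> V D"
    and ind: "fam_indep {..<N} (\<lambda>i. m i * triple3 (delta (f 0)) (delta (f 1)) g (kind i))"
    and kinds: "card {i. i < N \<and> kind i = 2} \<le> D * D"
  shows "[:0, 1:] ^ M dvd mev (\<lambda>c. [:c:]) (\<lambda>x. [:coeffs_of f x, coeffs_of h x:]) (complexify R)"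
proof -
  let ?C = "Poly_Mapping.single 0 :: complex \<Rightarrow> cpoly3"
  \<comment> \<open>Chosen so that \<open>f + h + e\<close> is the grid triple, which is reached at
    \<open>s = 1\<close>.\<close>
  define e where "e = (\<lambda>j. grid_triple D j + ?C (- 1) * (f j + h j))"
  define G where "G = (\<lambda>j :: 3. if j = 2 then homog D g else 0)"
  \<comment> \<open>The direction of the pencil starts as \<open>g\<close> at \<open>s = 0\<close>
    and becomes X_0^D, that of the grid pencil, at \<open>s = 1\<close>.\<close>
  define G' where "G' = (\<lambda>j :: 3. if j = 2 then indet 0 ^ D + ?C (- 1) * homog D g else 0)"
  define form where "form = (\<lambda>s t j. f j + ?C s * h j + ?C (s ^ M) * e j + ?C t * (G j + ?C s * G' j))"
  have frm: "e j \<in> forms D" "G j \<in> forms D" "G' j \<in> forms D" for j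
    unfolding e_def G_def G'_def
    by (auto intro!: forms_add forms_scale grid_triple_forms D f h homog_forms forms_indet_power
        simp del: single_uminus single_one)
  have form: "form s t j \<in> forms D" for s t j
    unfolding form_def by (intro forms_add forms_scale f h frm)
  have form1: "form 1 t = grid_pencil D t" for t
  proof
    fix j
    have c1: "?C (- 1) * X = - X" for X by (simp add: single_uminus)
    show "form 1 t j = grid_pencil D t j"
      unfolding form_def e_def G_def G'_def grid_pencil_def power_one single_one mult_1 c1 by simp
  qed
  define u where "u = (\<lambda>x. [: [:coeffs_of f x, coeffs_of h x:] + monom (coeffs_of e x) M,
      [:coeffs_of G x, coeffs_of G' x:] :])"
  define r where "r = mev cc u (complexify R)"
  have evu: "poly (poly (u x) [:t:]) s = coeffs_of (form s t) x" for s t x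
    unfolding u_def form_def coeffs_of_add coeffs_of_scale
    by (simp add: poly_monom algebra_simps)
  have evr: "poly (poly r [:t:]) s = mpoly_eval (coeffs_of (form s t)) (complexify R)" for s t
    unfolding r_def mpoly_eval_eq_mev comm_ring_hom.hom_mev[OF comm_ring_hom_eval2] evu by simp
  have evr0: "poly (poly r [:t:]) s = 0 \<longleftrightarrow> common_projective_zero (form s t)" for s t
    unfolding evr using R form unfolding generic_resultant_def by blast
  \<comment> \<open>The outer variable t enters through \<open>G\<close> and \<open>G'\<close> only,
    thus linearly and only in columns of kind 2; this bounds the degree of the determinant.\<close>
  define A where "A = mat N N (\<lambda>(k, i). [: [:\<ll> k (m i * delta (f (kind i))), \<ll> k (m i * delta (h (kind i))):]
      + monom (\<ll> k (m i * delta (e (kind i)))) M,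
      [:\<ll> k (m i * delta (G (kind i))), \<ll> k (m i * delta (G' (kind i))):] :])"
  have Ac: "A \<in> carrier_mat N N" by (simp add: A_def)
  define d where "d = det A"
  have mV: "m i * delta P \<in> V \<nu>" if "i < N" "P \<in> forms D" for i P
    using V_mult[OF m[OF that(1)] delta_V[OF that(2)]] D by simp
  have ll: "\<ll> k (m i * delta (form s t j)) = \<ll> k (m i * delta (f j)) + s * \<ll> k (m i * delta (h j))
      + s ^ M * \<ll> k (m i * delta (e j)) + t * (\<ll> k (m i * delta (G j)) + s * \<ll> k (m i * delta (G' j)))"
    if i: "i < N" for k i s t j
  proof -
    have eq: "m i * delta (form s t j) = m i * delta (f j) + sc s (m i * delta (h j))
        + sc (s ^ M) (m i * delta (e j)) + sc t (m i * delta (G j) + sc s (m i * delta (G' j)))"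
      unfolding form_def delta_add delta_scale by (simp add: algebra_simps smult_add_right)
    show ?thesis
      unfolding eq by (simp add: coord_add coord_scale V_add V_sc mV[OF i] f h frm)
  qed
  have evd: "poly (poly d [:t:]) s = det (mat N N (\<lambda>(k, i). \<ll> k (m i * delta (form s t (kind i)))))" for s t
    unfolding d_def A_def det_mat_hom[OF comm_ring_hom_eval2]
    by (intro arg_cong[of _ _ det] cong_mat refl) (simp add: ll poly_monom algebra_simps)
  have "[:0, 1:] ^ M dvd poly r 0"
  proof (rule bivariate_order_transfer[where d = d and n = "D * D"])
    \<comment> \<open>At \<open>s = 0\<close> the bending term is absent because
      \<open>M > 0\<close>, and the third member is moved by t times \<open>g\<close>.\<close>
    show "ev_in 0 d \<noteq> 0"
    proof -
      have gd: "delta (homog D g) = g" using g by (rule delta_homog)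
      have "fam_indep {..<N} (\<lambda>i. if kind i = 2 then m i * g else m i * delta (f (kind i)))"
      proof -
        have "m i * triple3 (delta (f 0)) (delta (f 1)) g (kind i) =
            (if kind i = 2 then m i * g else m i * delta (f (kind i)))" for i
          using exhaust3[of "kind i"] by (auto simp: triple3_def)
        then show ?thesis using ind by simp
      qed
      from exists_independent_pencil_member[OF _ _ this] obtain t where
        t: "fam_indep {..<N} (\<lambda>i. m i * delta (f (kind i)) + (if kind i = 2 then sc t (m i * g) else 0))"
        using mV f homog_forms[of D g] gd by metis
      have "m i * delta (form 0 t (kind i)) =
          m i * delta (f (kind i)) + (if kind i = 2 then sc t (m i * g) else 0)" for i
      proof -
        have "delta 0 = 0" by (simp add: delta_def)
        then have "delta (form 0 t j) = delta (f j) + (if j = 2 then sc t g else 0)" for j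
          unfolding form_def delta_add delta_scale using M by (simp add: G_def gd zero_power)
        then show ?thesis by (simp add: distrib_left)
      qed
      then have "fam_indep {..<N} (\<lambda>i. m i * delta (form 0 t (kind i)))" using t by simp
      then have "poly (poly d [:t:]) 0 \<noteq> 0"
        unfolding evd by (subst det_ne_0_iff) (auto intro: mV form)
      then show ?thesis by (metis poly_0 poly_ev_in)
    qed
    show "degree d \<le> D * D"
    proof -
      have d0: "delta 0 = 0" by (simp add: delta_def)
      have "degree d \<le> (\<Sum>i<N. if kind i = 2 then 1 else 0)"
        unfolding d_def
        by (rule degree_det_le[OF Ac]) (auto simp: A_def G_def G'_def d0 coord_0)
      also have "\<dots> = card {i. i < N \<and> kind i = 2}"
        by (simp add: sum.If_cases Int_def)
      finally show ?thesis using kinds by simp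
    qed
    show "poly (poly d [:t:]) s = 0" if "poly (poly r [:t:]) s = 0" for s t
    proof -
      from that obtain z where z: "\<exists>i. z i \<noteq> 0" "\<And>j. mpoly_eval z (form s t j) = 0"
        unfolding evr0 common_projective_zero_def by blast
      from z(1) obtain i0 where i0: "z i0 \<noteq> 0" by auto
      show ?thesis unfolding evd
      \<comment> \<open>The common zero may lie at infinity, so the functional homogenises before it
        evaluates.\<close>
      proof (rule det_eq_0_if_common_functional[where E = "\<lambda>p. mpoly_eval z (homog \<nu> p)"])
        show "m i * delta (form s t (kind i)) \<in> V \<nu>" if "i < N" for i using that form by (rule mV)
        show "mpoly_eval z (homog \<nu> (p + q)) = mpoly_eval z (homog \<nu> p) + mpoly_eval z (homog \<nu> q)"
          if "p \<in> V \<nu>" "q \<in> V \<nu>" for p q using that by (simp add: homog_add mpoly_eval_hom)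
        show "mpoly_eval z (homog \<nu> (sc c p)) = c * mpoly_eval z (homog \<nu> p)"
          if "p \<in> V \<nu>" for c p using that by (simp add: homog_sc mpoly_eval_hom)
        show "delta (indet i0 ^ \<nu>) \<in> V \<nu>" by (rule delta_V[OF forms_indet_power])
        show "mpoly_eval z (homog \<nu> (delta (indet i0 ^ \<nu>))) \<noteq> 0"
          using i0 by (simp add: homog_delta[OF forms_indet_power] mpoly_eval_hom)
        show "mpoly_eval z (homog \<nu> (m i * delta (form s t (kind i)))) = 0" if "i < N" for i
        proof -
          have "homog (\<nu> - D + D) (m i * delta (form s t (kind i))) = homog (\<nu> - D) (m i) * form s t (kind i)"
            using m[OF that] form by (rule homog_mult)
          then show ?thesis using D z(2) by (simp add: mpoly_eval_hom)
        qed
      qed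
    qed
    let ?Z = "(\<lambda>(i, j). - of_nat (i + D * j) :: complex) ` ({..<D} \<times> {..<D})"
    show "finite ?Z" by simp
    show "D * D \<le> card ?Z" by (simp only: card_grid_parameters)
    show "poly (poly r [:t:]) 1 = 0" if "t \<in> ?Z" for t
      using that unfolding evr0 form1 grid_pencil_zero_iff[OF D(1)] .
    \<comment> \<open>The elements of \<open>?Z\<close> are integers at most 0, so
      \<open>t = 1\<close> gives a triple without common zero.\<close>
    have "1 \<notin> ?Z"
    proof
      assume "1 \<in> ?Z"
      then obtain n where n: "(1 :: complex) = - of_nat n"
        by (auto simp del: of_nat_add of_nat_mult)
      have "(of_nat (Suc n) :: complex) = 1 + of_nat n" by simp
      also have "\<dots> = 0" by (subst n) (rule add.left_inverse)
      finally have "(of_nat (Suc n) :: complex) = 0" .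
      then show False by (simp only: of_nat_eq_0_iff)
    qed
    then show "poly (poly r [:1:]) 1 \<noteq> 0" unfolding evr0 form1 grid_pencil_zero_iff[OF D(1)] .
    show "[:0, 1:] ^ M dvd poly d 0"
    proof -
      have "poly d 0 = det (mat N N (\<lambda>(k, i). [:\<ll> k (m i * delta (f (kind i))), \<ll> k (m i * delta (h (kind i))):]
          + monom (\<ll> k (m i * delta (e (kind i)))) M))" (is "_ = det ?B")
        unfolding d_def A_def det_mat_hom[OF comm_ring_hom_poly_at]
        by (intro arg_cong[of _ _ det] cong_mat refl) auto
      \<comment> \<open>At \<open>s = 0\<close> and \<open>t = 0\<close> every column is a multiple
        of a form satisfying the conditions, so the rows that vanish on
        \<open>Vsub S T \<nu>\<close> have entries without constant term.\<close>
      moreover have "[:0, 1:] ^ card {r. r < N \<and> (\<forall>p\<in>Vsub S T \<nu>. \<ll> r p = 0)} dvd det ?B"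
      proof (rule power_dvd_det)
        fix k i assume k: "k \<in> {r. r < N \<and> (\<forall>p\<in>Vsub S T \<nu>. \<ll> r p = 0)}" and i: "i < N"
        have "delta (f (kind i)) * m i \<in> Vsub S T (D + (\<nu> - D))" by (rule Vsub_mult[OF f(2) m[OF i]])
        then have "\<ll> k (m i * delta (f (kind i))) = 0" using k D by (simp add: mult.commute)
        then show "[:0, 1:] dvd ?B $$ (k, i)"
          using k i M X_power_dvd_iff[of 1 "?B $$ (k, i)"] by simp
      qed auto
      ultimately have "[:0, 1:] ^ card {r. r < N \<and> (\<forall>p\<in>Vsub S T \<nu>. \<ll> r p = 0)} dvd poly d 0"
        by (simp only:)
      then show ?thesis using rows by (rule power_le_dvd)
    qed
  qed
  moreover have "poly r 0 = mev (\<lambda>c. [:c:]) (\<lambda>x. poly (u x) 0) (complexify R)"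
    unfolding r_def comm_ring_hom.hom_mev[OF comm_ring_hom_poly_at] by simp
  ultimately have 1: "[:0, 1:] ^ M dvd mev (\<lambda>c. [:c:]) (\<lambda>x. poly (u x) 0) (complexify R)"
    by (simp only:)
  have "[:0, 1:] ^ M dvd mev (\<lambda>c. [:c:]) (\<lambda>x. poly (u x) 0) (complexify R)
      - mev (\<lambda>c. [:c:]) (\<lambda>x. [:coeffs_of f x, coeffs_of h x:]) (complexify R)"
    by (rule mev_cong_mod) (simp add: u_def monom_altdef dvd_smult)
  from dvd_diff[OF 1 this] show ?thesis by (simp only: diff_diff_eq2 add_diff_cancel_left')
qed

end

section \<open>From good triples to all triples\<close>

lemma vector_as_coeffs_of:
  obtains h where "\<And>j. h j \<in> forms D"
    "\<And>j m. m \<in> monomials_of_degree D \<Longrightarrow> coeffs_of h (Coeff j m) = v (Coeff j m)"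
proof -
  define h where "h = (\<lambda>j. \<Sum>i\<in>pairs D. Poly_Mapping.single (m3 D (fst i) (snd i)) (v (Coeff j (m3 D (fst i) (snd i)))))"
  have "h j \<in> forms D" for j
    unfolding h_def by (rule forms_sum) (auto simp: forms_def pairs_def m3_in split: if_splits)
  moreover have "coeffs_of h (Coeff j m) = v (Coeff j m)" if m: "m \<in> monomials_of_degree D" for j m
  proof -
    let ?i = "(Poly_Mapping.lookup m 1, Poly_Mapping.lookup m 2)"
    have i: "?i \<in> pairs D" using m by (auto simp: pairs_def monomials_of_degree_iff)
    have me: "m = m3 D (fst i) (snd i) \<longleftrightarrow> i = ?i" if "i \<in> pairs D" for i
      using that eq_m3_iff[OF m, of "fst i" "snd i"] by (auto simp: pairs_def prod_eq_iff)
    have "coeffs_of h (Coeff j m) = (\<Sum>i\<in>pairs D. if i = ?i then v (Coeff j m) else 0)"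
      unfolding h_def coeffs_of.simps lookup_sum
      by (intro sum.cong refl) (use me me[OF i] in \<open>auto simp: lookup_single when_def\<close>)
    then show ?thesis using i by simp
  qed
  ultimately show ?thesis using that by blast
qed

lemma keys_complexify:
  "Poly_Mapping.keys (complexify R) \<subseteq> Poly_Mapping.keys R"
  by (auto simp: in_keys_iff Poly_Mapping.map.rep_eq when_def split: if_splits)

theorem theorem5p7:
  fixes \<Sigma> \<Sigma>\<^sub>1 :: "(complex \<times> complex) set"
    and T T\<^sub>1 D :: nat
    and Res\<^sub>D :: "(coeff_var, int) mpoly"
    and f :: "3 \<Rightarrow> cpoly3"
  assumes "\<Sigma> \<subseteq> group_G" and "finite \<Sigma>" and "\<Sigma> \<noteq> {}"
    and "T > 0"
    and "D > 0"
    and "\<Sigma>\<^sub>1 \<subseteq> group_G" and "finite \<Sigma>\<^sub>1"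
    and "D < (T\<^sub>1 + 1) * min (card (fst ` \<Sigma>\<^sub>1)) (card (snd ` \<Sigma>\<^sub>1))"
    and "(T + T\<^sub>1) * card (G_sumset \<Sigma> \<Sigma>\<^sub>1) < (D + 2) choose 2"
    and "generic_resultant D Res\<^sub>D"
    and "\<And>j. f j \<in> ideal_I \<Sigma> T \<inter> forms D"
  shows "vanishes_to_order (T * card \<Sigma>) (complexify Res\<^sub>D) (coeffs_of f)"
proof -
  define M where "M = T * card \<Sigma>"
  have M: "M > 0" using assms(2,3,4) by (simp add: M_def card_gt_0_iff)
  \<comment> \<open>The summand \<open>3 * D\<close> is for the division that yields the columns,
    the rest for the independence of the vanishing conditions.\<close>
  define \<nu> where "\<nu> = 3 * D + (T * card \<Sigma> + T)"
  have \<nu>: "3 * D \<le> \<nu>" "T * card \<Sigma> + T \<le> \<nu>" "D \<le> \<nu>" by (simp_all add: \<nu>_def)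
  let ?N = "card (pairs \<nu>)"
  obtain F0 F1 where F: "F0 \<in> Vsub \<Sigma> T D" "F1 \<in> Vsub \<Sigma> T D" "coprime F0 F1"
    "\<exists>k\<le>D. coeff (coeff F0 k) (D - k) \<noteq> 0"
    using zero_estimate[OF assms(1,2,6,7,8,9)] by blast
  obtain J :: "(3 \<times> nat \<times> nat) set" and m0 g where J: "finite J" "\<And>i. i \<in> J \<Longrightarrow> m0 i \<in> V (\<nu> - D)"
    "g \<in> V D" "fam_indep J (\<lambda>i. m0 i * triple3 F0 F1 g (fst i))" "card J = ?N"
    "card {i \<in> J. fst i = 2} \<le> D * D"
    using exists_columns[OF Vsub_V[OF F(1)] Vsub_V[OF F(2)] F(3,4) \<nu>(1) assms(5)] by blast
  obtain b where b: "bij_betw b {..<?N} J"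
    using ex_bij_betw_nat_finite[OF J(1)] J(5) by (metis atLeast0LessThan)
  define m where "m = (\<lambda>i. m0 (b i))"
  define kind where "kind = (\<lambda>i. fst (b i))"
  have bJ: "b i \<in> J" if "i < ?N" for i using b that by (auto simp: bij_betw_def)
  have m: "m i \<in> V (\<nu> - D)" if "i < ?N" for i unfolding m_def by (rule J(2)[OF bJ[OF that]])
  have ind: "fam_indep {..<?N} (\<lambda>i. m i * triple3 F0 F1 g (kind i))"
    unfolding m_def kind_def by (rule fam_indep_reindex[OF J(4) b])
  have kinds: "card {i. i < ?N \<and> kind i = 2} \<le> D * D"
  proof -
    have "inj_on b {i. i < ?N \<and> kind i = 2}"
      using b by (auto simp: bij_betw_def intro: inj_on_subset)
    moreover have "b ` {i. i < ?N \<and> kind i = 2} \<subseteq> {i \<in> J. fst i = 2}"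
      using bJ by (auto simp: kind_def)
    ultimately have "card {i. i < ?N \<and> kind i = 2} \<le> card {i \<in> J. fst i = 2}"
      using J(1) by (intro card_inj_on_le) auto
    then show ?thesis using J(6) by simp
  qed
  obtain w \<ll> where co: "coordinates \<nu> w \<ll>"
    and rows: "M \<le> card {r. r < ?N \<and> (\<forall>p\<in>Vsub \<Sigma> T \<nu>. \<ll> r p = 0)}"
    using exists_adapted_coordinates[OF assms(2) \<nu>(2)] unfolding M_def by blast
  interpret co: coordinates \<nu> w \<ll> by (rule co)
  let ?C = "Poly_Mapping.single 0 :: complex \<Rightarrow> cpoly3"
  \<comment> \<open>The line in direction \<open>fs\<close> reaches at parameter 1 a triple that
    begins with the two coprime forms. The third member only has to satisfy the vanishing
    conditions, which \<open>F1\<close> does.\<close>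
  define fs where "fs = (\<lambda>j :: 3. triple3 (homog D F0) (homog D F1) (homog D F1) j + ?C (- 1) * f j)"
  have ff: "f j \<in> forms D" "delta (f j) \<in> Vsub \<Sigma> T D" for j
    using assms(11)[of j] delta_ideal_I by auto
  have fsf: "fs j \<in> forms D" for j
    unfolding fs_def triple3_def by (auto intro!: forms_add forms_scale homog_forms ff simp del: single_uminus single_one)
  have dfs: "delta (fs j) = triple3 F0 F1 F1 j - delta (f j)" for j
    unfolding fs_def delta_add delta_scale using F(1,2)
    by (auto simp: triple3_def delta_homog Vsub_V)
  define fe where "fe = (\<lambda>\<epsilon> j. f j + ?C \<epsilon> * fs j)"
  have fe: "fe \<epsilon> j \<in> forms D" for \<epsilon> j unfolding fe_def by (intro forms_add forms_scale ff fsf)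
  have dfe: "delta (fe \<epsilon> j) = delta (f j) + sc \<epsilon> (triple3 F0 F1 F1 j - delta (f j))" for \<epsilon> j
    by (simp add: fe_def delta_add delta_scale dfs)
  have "delta (fs j) \<in> Vsub \<Sigma> T D" for j
    unfolding dfs by (intro vs.subspace_diff[OF subspace_Vsub] ff(2)) (use F in \<open>auto simp: triple3_def\<close>)
  then have feV: "delta (fe \<epsilon> j) \<in> Vsub \<Sigma> T D" for \<epsilon> j
    unfolding fe_def delta_add delta_scale by (intro Vsub_add Vsub_scale ff(2))
  \<comment> \<open>With \<open>g\<close> in the columns of kind 2 this determinant tests whether
    the chosen columns suit the triple \<open>fe \<epsilon>\<close>. It is nonzero at 1, hence
    outside a finite set of parameters.\<close>
  define B where "B = mat ?N ?N (\<lambda>(r, i). if kind i = 2 then [:\<ll> r (m i * g):]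
      else [:\<ll> r (m i * delta (f (kind i))), \<ll> r (m i * delta (fs (kind i))):])"
  have mV: "m i * p \<in> V \<nu>" if "i < ?N" "p \<in> V D" for i p
    using V_mult[OF m[OF that(1)] that(2)] \<nu>(3) by simp
  have evB: "poly (det B) \<epsilon> = det (mat ?N ?N (\<lambda>(r, i). \<ll> r (m i *
      triple3 (delta (fe \<epsilon> 0)) (delta (fe \<epsilon> 1)) g (kind i))))" for \<epsilon>
  proof -
    have 1: "\<ll> r (m i * delta (fe \<epsilon> j)) = \<ll> r (m i * delta (f j)) + \<epsilon> * \<ll> r (m i * delta (fs j))"
      if i: "i < ?N" for r i j
    proof -
      have "m i * delta (fe \<epsilon> j) = m i * delta (f j) + sc \<epsilon> (m i * delta (fs j))"
        by (simp add: fe_def delta_add delta_scale distrib_left)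
      then show ?thesis
        by (simp add: co.coord_add co.coord_scale V_sc mV[OF i] delta_V ff fsf)
    qed
    have "poly (if kind i = 2 then [:\<ll> r (m i * g):]
        else [:\<ll> r (m i * delta (f (kind i))), \<ll> r (m i * delta (fs (kind i))):]) \<epsilon> =
      \<ll> r (m i * triple3 (delta (fe \<epsilon> 0)) (delta (fe \<epsilon> 1)) g (kind i))" if "i < ?N" for r i
      using exhaust3[of "kind i"] 1[OF that] by (auto simp: triple3_def)
    then show ?thesis
      unfolding B_def det_mat_hom[OF comm_ring_hom_poly_at]
      by (intro arg_cong[of _ _ det] cong_mat refl) (simp only: prod.case)
  qed
  have tV: "m i * triple3 (delta (fe \<epsilon> 0)) (delta (fe \<epsilon> 1)) g (kind i) \<in> V \<nu>" if "i < ?N" for i \<epsilon>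
    using fe J(3) by (intro mV[OF that]) (auto simp: triple3_def delta_V)
  have "poly (det B) 1 \<noteq> 0"
  proof -
    have "delta (fe 1 0) = F0" "delta (fe 1 1) = F1" by (simp_all add: dfe triple3_def one_pCons[symmetric])
    then have "fam_indep {..<?N} (\<lambda>i. m i * triple3 (delta (fe 1 0)) (delta (fe 1 1)) g (kind i))"
      using ind by simp
    then show ?thesis unfolding evB by (subst co.det_ne_0_iff) (auto intro: tV)
  qed
  then have B0: "det B \<noteq> 0" by auto
  define E where "E = {\<epsilon>. poly (det B) \<epsilon> = 0}"
  have finE: "finite E" unfolding E_def using B0 by (rule poly_roots_finite)
  have good: "[:0, 1:] ^ M dvd mev (\<lambda>c. [:c:]) (\<lambda>x. [:coeffs_of (fe \<epsilon>) x, coeffs_of h x:]) (complexify Res\<^sub>D)"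
    if \<epsilon>: "\<epsilon> \<notin> E" and h: "\<And>j. h j \<in> forms D" for \<epsilon> h
  proof (rule co.resultant_order_at_good_triple[OF assms(10) assms(5) \<nu>(3) M rows fe feV h m J(3) _ kinds])
    show "fam_indep {..<?N} (\<lambda>i. m i * triple3 (delta (fe \<epsilon> 0)) (delta (fe \<epsilon> 1)) g (kind i))"
      using \<epsilon> unfolding E_def evB mem_Collect_eq by (subst (asm) co.det_ne_0_iff) (auto intro: tV)
  qed
  show ?thesis
    unfolding M_def[symmetric]
  proof (rule vanishes_to_order_if_lines)
    fix v :: "coeff_var \<Rightarrow> complex"
    obtain h where h: "\<And>j. h j \<in> forms D"
      "\<And>j m. m \<in> monomials_of_degree D \<Longrightarrow> coeffs_of h (Coeff j m) = v (Coeff j m)"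
      using vector_as_coeffs_of[of D v] by blast
    \<comment> \<open>\<open>v\<close> has components also for coefficients of other degrees. They
      do not occur in the resultant, so the coefficients of a triple \<open>h\<close> of forms may
      replace \<open>v\<close>.\<close>
    have hv: "coeffs_of h x = v x" if "mm \<in> Poly_Mapping.keys (complexify Res\<^sub>D)" "x \<in> Poly_Mapping.keys mm" for mm x
    proof -
      have "x \<in> {Coeff j m | j m. m \<in> monomials_of_degree D}"
        using that keys_complexify[of Res\<^sub>D] assms(10) unfolding generic_resultant_def by blast
      then show ?thesis using h(2) by auto
    qed
    define Q where "Q = mev cc (\<lambda>x. [: [:coeffs_of f x, v x:], [:coeffs_of fs x:] :]) (complexify Res\<^sub>D)"
    have "poly Q [:\<epsilon>:] = mev (\<lambda>c. [:c:]) (\<lambda>x. [:coeffs_of (fe \<epsilon>) x, v x:]) (complexify Res\<^sub>D)" for \<epsilon>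
      unfolding Q_def comm_ring_hom.hom_mev[OF comm_ring_hom_poly_at] fe_def coeffs_of_add coeffs_of_scale
      by (simp add: mult.commute)
    moreover have "mev (\<lambda>c. [:c:]) (\<lambda>x. [:coeffs_of (fe \<epsilon>) x, v x:]) (complexify Res\<^sub>D) =
        mev (\<lambda>c. [:c:]) (\<lambda>x. [:coeffs_of (fe \<epsilon>) x, coeffs_of h x:]) (complexify Res\<^sub>D)" for \<epsilon>
      by (rule mev_cong) (simp add: hv)
    ultimately have "[:0, 1:] ^ M dvd poly Q [:\<epsilon>:]" if "\<epsilon> \<notin> E" for \<epsilon>
      using good[OF that h(1)] by simp
    \<comment> \<open>The parameter 0, which belongs to \<open>f\<close>, may lie in
      \<open>E\<close>. Divisibility at the remaining parameters carries over to every coefficient,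
      and the constant one is the restriction at \<open>f\<close>.\<close>
    then have "[:0, 1:] ^ M dvd coeff Q 0" using finE by (rule X_power_dvd_coeffs)
    moreover have "coeff Q 0 = mev (\<lambda>c. [:c:]) (\<lambda>x. [:coeffs_of f x, v x:]) (complexify Res\<^sub>D)"
      unfolding poly_0_coeff_0[symmetric] Q_def comm_ring_hom.hom_mev[OF comm_ring_hom_poly_at] by simp
    ultimately show "[:0, 1:] ^ M dvd mev (\<lambda>c. [:c:]) (\<lambda>x. [:coeffs_of f x, v x:]) (complexify Res\<^sub>D)"
      by simp
  qed
qed

end
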